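(* For $n\ge 1$, let $g_n$ denote a random matrix which is Haar-distributed in the unitary group $U(n)$. Then for any bounded Borel subset $B\subset\mathbb{C}$ whose boundary has Lebesgue measure $0$, and for any $b\in\mathbb{C}$, $$\lim_{n\to+\infty}\Bigl(\frac{\log n}{2}\Bigr)\,\mathbb{P}\Bigl[\log\det(1-g_n)-\Bigl(\frac{\log n}{2}\Bigr)^{1/2} b\in B\Bigr]=\frac{1}{2\pi}e^{-|b|^2/2}\,m(B),$$ where $m$ denotes Lebesgue measure on $\mathbb{C}$.
   Context: Haar measure on $U(n)$ is normalized to be a probability measure. The determination of $\log\det(1-g)$ is the one obtained from the standard Taylor series of the logarithm at $z=1$: if $e^{i\theta_1},\dots,e^{i\theta_n}$ are the eigenvalues of $g$ (almost surely all different from $1$), then $\log\det(1-g)=\sum_{j=1}^n\log(1-e^{i\theta_j})$ with the principal branch of $\log$. $\mathbb{C}$ is identified with $\mathbb{R}^2$. *)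

theory Defs
  imports
    "HOL-Probability.Probability"
    "Jordan_Normal_Form.Schur_Decomposition"
begin

definition unitary_group :: "nat \<Rightarrow> complex mat set" where
  "unitary_group n = {g \<in> carrier_mat n n. mat_adjoint g * g = 1\<^sub>m n}"

(* The dimension of a matrix is not part of its type, so complex mat carries no topology.
   U(n) gets the subspace topology of C^(n x n): the pullback of the product topology along
   the map sending a matrix to the family of its entries. *)
definition unitary_topology :: "nat \<Rightarrow> complex mat topology" where
  "unitary_topology n = pullback_topology (unitary_group n)
     (\<lambda>g. restrict (\<lambda>ij. g $$ ij) ({..<n} \<times> {..<n}))
     (product_topology (\<lambda>_. euclidean) ({..<n} \<times> {..<n}))"

definition unitary_borel :: "nat \<Rightarrow> complex mat measure" where
  "unitary_borel n = sigma (unitary_group n) {S. openin (unitary_topology n) S}"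

(* On the compact group U(n), left invariance and total mass 1 determine the measure,
   and right invariance follows. *)
definition haar_unitary :: "nat \<Rightarrow> complex mat measure \<Rightarrow> bool" where
  "haar_unitary n \<mu> \<longleftrightarrow>
     prob_space \<mu> \<and> sets \<mu> = sets (unitary_borel n) \<and>
     (\<forall>h \<in> unitary_group n. distr \<mu> \<mu> (\<lambda>g. h * g) = \<mu>)"

(* The eigenvalues are the roots of the characteristic polynomial, with multiplicity. Ln is the
   principal branch; Ln 0 = 0 is only reached when 1 is an eigenvalue. *)
definition logdet_one_minus :: "complex mat \<Rightarrow> complex" where
  "logdet_one_minus g = (\<Sum>z\<in>#proots (char_poly g). Ln (1 - z))"

lemma topspace_unitary_topology: "topspace (unitary_topology n) = unitary_group n"
  unfolding unitary_topology_def by (auto simp: topspace_pullback_topology)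

lemma opens_unitary_subset: "{S. openin (unitary_topology n) S} \<subseteq> Pow (unitary_group n)"
  by (auto dest!: openin_subset simp: topspace_unitary_topology)

lemma space_unitary_borel: "space (unitary_borel n) = unitary_group n"
  unfolding unitary_borel_def by (rule space_measure_of[OF opens_unitary_subset])

lemma sets_unitary_borel:
  "sets (unitary_borel n) = sigma_sets (unitary_group n) {S. openin (unitary_topology n) S}"
  unfolding unitary_borel_def by (rule sets_measure_of[OF opens_unitary_subset])

lemma mat_adjoint_mult:
  fixes A B :: "complex mat"
  assumes "A \<in> carrier_mat n n" "B \<in> carrier_mat n n"
  shows "mat_adjoint (A * B) = mat_adjoint B * mat_adjoint A"
  using assms
  by (intro eq_matI)
     (auto simp: mat_adjoint_def mat_of_rows_index scalar_prod_def mult.commute conjugate_complex_def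
           intro!: sum.cong)

lemma unitary_group_mult:
  assumes "h \<in> unitary_group n" "g \<in> unitary_group n"
  shows "h * g \<in> unitary_group n"
proof -
  have h: "h \<in> carrier_mat n n" "mat_adjoint h * h = 1\<^sub>m n"
    and g: "g \<in> carrier_mat n n" "mat_adjoint g * g = 1\<^sub>m n"
    using assms by (auto simp: unitary_group_def)
  have a: "mat_adjoint h \<in> carrier_mat n n" "mat_adjoint g \<in> carrier_mat n n"
    using h g by (auto simp: mat_adjoint_def)
  have "mat_adjoint (h * g) * (h * g) = mat_adjoint g * ((mat_adjoint h * h) * g)"
    using h(1) g(1) a by (simp add: mat_adjoint_mult[of _ n] assoc_mult_mat[of _ n n _ n _ n])
  also have "\<dots> = 1\<^sub>m n" using h g by simp
  finally show ?thesis using h g by (simp add: unitary_group_def)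
qed

lemma continuous_map_unitary_mult_left:
  assumes h: "h \<in> unitary_group n"
  shows "continuous_map (unitary_topology n) (unitary_topology n) (\<lambda>g. h * g)"
proof -
  let ?I = "{..<n} \<times> {..<n}"
  let ?T = "product_topology (\<lambda>_. euclidean :: complex topology) ?I"
  let ?E = "\<lambda>g :: complex mat. restrict (\<lambda>ij. g $$ ij) ?I"
  have hc: "h \<in> carrier_mat n n" using h by (simp add: unitary_group_def)
  have entry: "continuous_map (unitary_topology n) euclidean (\<lambda>g. g $$ ij)" if "ij \<in> ?I" for ij
  proof -
    have "continuous_map ?T euclidean (\<lambda>e. e ij)"
      using continuous_map_product_projection[OF that, of "\<lambda>_. euclidean"] by simp
    hence "continuous_map (unitary_topology n) euclidean ((\<lambda>e. e ij) \<circ> ?E)"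
      unfolding unitary_topology_def by (rule continuous_map_pullback)
    thus ?thesis using that by (simp add: o_def)
  qed
  have 1: "continuous_map (unitary_topology n) euclidean (\<lambda>g. (h * g) $$ ij)" if ij: "ij \<in> ?I" for ij
  proof -
    obtain i j where [simp]: "ij = (i, j)" by (cases ij)
    have "continuous_map (unitary_topology n) euclidean (\<lambda>g. h $$ (i, k) * g $$ (k, j))"
      if "k < n" for k
    proof -
      have "continuous_map euclidean euclidean (\<lambda>z. h $$ (i, k) * z)"
        by (simp add: continuous_intros)
      from continuous_map_compose[OF entry this, of "(k, j)"] show ?thesis
        using that ij by (simp add: o_def)
    qed
    hence "continuous_map (unitary_topology n) euclidean
            (\<lambda>g. \<Sum>k\<in>{..<n}. h $$ (i, k) * g $$ (k, j))"
      by (intro continuous_map_sum) auto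
    moreover have "(\<Sum>k\<in>{..<n}. h $$ (i, k) * g $$ (k, j)) = (h * g) $$ ij"
      if "g \<in> topspace (unitary_topology n)" for g
      using that hc ij
      by (auto simp: topspace_unitary_topology unitary_group_def scalar_prod_def atLeast0LessThan)
    ultimately show ?thesis by (rule continuous_map_eq)
  qed
  have "continuous_map (unitary_topology n) ?T (\<lambda>g. ?E (h * g))"
    unfolding continuous_map_componentwise using 1 by auto
  moreover have "topspace (unitary_topology n) \<subseteq> (\<lambda>g. h * g) -` unitary_group n"
    using unitary_group_mult[OF h] by (auto simp: topspace_unitary_topology)
  ultimately show ?thesis
    unfolding unitary_topology_def[of n] by (intro continuous_map_pullback') (auto simp: o_def)
qed

lemma measurable_unitary_mult_left:
  assumes h: "h \<in> unitary_group n"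
  shows "(\<lambda>g. h * g) \<in> measurable (unitary_borel n) (unitary_borel n)"
proof -
  have "(\<lambda>g. h * g) -` S \<inter> space (unitary_borel n) \<in> sets (unitary_borel n)"
    if "openin (unitary_topology n) S" for S
  proof -
    have "(\<lambda>g. h * g) -` S \<inter> unitary_group n = {g \<in> unitary_group n. h * g \<in> S}" by auto
    also have "openin (unitary_topology n) \<dots>"
      using openin_continuous_map_preimage[OF continuous_map_unitary_mult_left[OF h] that]
      by (simp add: topspace_unitary_topology)
    finally show ?thesis by (simp add: space_unitary_borel sets_unitary_borel)
  qed
  thus ?thesis
    by (intro measurable_sigma_sets[OF sets_unitary_borel opens_unitary_subset])
       (auto simp: space_unitary_borel unitary_group_mult[OF h])
qed

end

theory Submission
  imports Defs "HOL-Real_Asymp.Real_Asymp"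
begin

text \<open>
  Under Haar measure, the logarithm of \<open>det (1 - g)\<close> is a sum of \<open>n\<close> independent terms, and each
  of them is close to a centred complex Gaussian variable.

  The splitting comes from the Schur complement of \<open>1 - g\<close> with respect to its corner entry: it
  has the form \<open>1 - h\<close> with \<open>h\<close> unitary of size one less. Multiplying \<open>g\<close> from the left by a
  unitary matrix \<open>k\<close> that acts on the rows other than the first leaves the corner entry alone and
  replaces \<open>h\<close> by \<open>k h\<close>; hence \<open>h\<close> is Haar distributed and independent of the corner entry
  (\<open>haar_corner_reduce_independent\<close>). The determinant is multiplicative under this reduction,
  and a homotopy shows that the principal branches add up without a multiple of \<open>2 \<pi> \<i>\<close>
  (\<open>logdet_schur_reduce\<close>). The characteristic function of the logarithm is therefore the product
  over \<open>k \<le> n\<close> of the characteristic functions of \<open>Ln (1 - w)\<close>, where \<open>w\<close> is a corner entry of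
  a Haar matrix of size \<open>k\<close> (\<open>logdet_charfun_prod\<close>).

  The law of \<open>w\<close> is invariant under rotations, so distinct powers of \<open>w\<close> are orthogonal. With
  \<open>E |w|^2 = 1/k\<close> and \<open>E |w|^4 = 2/(k(k+1))\<close>, the variable \<open>Ln (1 - w)\<close> is \<open>-w\<close> up to a centred
  error of second moment \<open>O(1/k^2)\<close>, and its characteristic function at \<open>t\<close> is
  \<open>1 - |t|^2/(4k)\<close> up to \<open>O(|t|^2 (1 + |t|) k^(-3/2))\<close> (\<open>corner_charfun_estimate\<close>). These errors are
  summable in \<open>k\<close>. With \<open>N = ln n / 2\<close>, the product at \<open>u / sqrt N\<close> thus converges to
  \<open>exp (- |u|^2/2)\<close>, and it is bounded by a Gaussian in \<open>u\<close> as long as \<open>|u| / sqrt N\<close> is below a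
  small power of \<open>n\<close> (\<open>product_limit\<close>, \<open>product_decay\<close>).

  This is enough for a local limit theorem (\<open>hit_limit\<close>). Convolve the law with a Gaussian kernel
  of fixed width \<open>\<delta>\<close>. By Fourier inversion, \<open>N\<close> times the resulting density near \<open>sqrt N b\<close> is an
  integral to which dominated convergence applies: it is bounded, and it converges pointwise to a
  multiple of \<open>exp (- |b|^2/2)\<close>. This gives the claim for the smoothed law. The probability of
  \<open>B\<close> is then enclosed between smoothed probabilities of a slightly smaller and a slightly larger
  set; first \<open>\<delta>\<close> and then the width of the enlargement tend to \<open>0\<close>, and the boundary of \<open>B\<close> has
  measure \<open>0\<close>.
\<close>

section \<open>Unitary matrices\<close>

lemma mat_adjoint_carrier: "A \<in> carrier_mat m n \<Longrightarrow> mat_adjoint A \<in> carrier_mat n m"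
  by (auto simp: mat_adjoint_def)

lemma mat_adjoint_index:
  fixes A :: "complex mat"
  assumes "A \<in> carrier_mat m n" "i < n" "j < m"
  shows "mat_adjoint A $$ (i, j) = cnj (A $$ (j, i))"
  using assms by (auto simp: mat_adjoint_def mat_of_rows_index conjugate_complex_def)

lemma mat_mult_index:
  assumes "A \<in> carrier_mat m n" "B \<in> carrier_mat n p" "i < m" "j < p"
  shows "(A * B) $$ (i, j) = (\<Sum>k<n. A $$ (i, k) * B $$ (k, j))"
  using assms by (auto simp: scalar_prod_def atLeast0LessThan)

lemma unitary_group_iff_columns:
  "g \<in> unitary_group n \<longleftrightarrow> g \<in> carrier_mat n n \<and>
     (\<forall>i<n. \<forall>j<n. (\<Sum>k<n. cnj (g $$ (k, i)) * g $$ (k, j)) = (if i = j then 1 else 0))"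
proof (cases "g \<in> carrier_mat n n")
  case True
  note a = mat_adjoint_carrier[OF True]
  have *: "(mat_adjoint g * g) $$ (i, j) = (\<Sum>k<n. cnj (g $$ (k, i)) * g $$ (k, j))"
    if "i < n" "j < n" for i j
    using mat_mult_index[OF a True that] mat_adjoint_index[OF True] that by auto
  have "mat_adjoint g * g = 1\<^sub>m n \<longleftrightarrow>
     (\<forall>i<n. \<forall>j<n. (mat_adjoint g * g) $$ (i, j) = (if i = j then 1 else 0))"
  proof
    assume "\<forall>i<n. \<forall>j<n. (mat_adjoint g * g) $$ (i, j) = (if i = j then 1 else 0)"
    thus "mat_adjoint g * g = 1\<^sub>m n"
      using True a by (intro eq_matI) auto
  qed auto
  thus ?thesis using True * by (simp add: unitary_group_def)
qed (auto simp: unitary_group_def)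

lemma unitary_mult_adjoint:
  assumes "g \<in> unitary_group n"
  shows "g * mat_adjoint g = 1\<^sub>m n"
proof -
  have g: "g \<in> carrier_mat n n" "mat_adjoint g * g = 1\<^sub>m n"
    using assms by (auto simp: unitary_group_def)
  show ?thesis
    using mat_mult_left_right_inverse[OF mat_adjoint_carrier[OF g(1)] g(1) g(2)] .
qed

lemma mat_adjoint_adjoint:
  "(A :: complex mat) \<in> carrier_mat m n \<Longrightarrow> mat_adjoint (mat_adjoint A) = A"
  using mat_adjoint_carrier[of A m n] mat_adjoint_carrier[of "mat_adjoint A" n m]
  by (intro eq_matI) (auto simp: mat_adjoint_index[of _ m n] mat_adjoint_index[of _ n m])

lemma unitary_group_adjoint:
  assumes "g \<in> unitary_group n" shows "mat_adjoint g \<in> unitary_group n"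
  using assms unitary_mult_adjoint[OF assms]
  by (auto simp: unitary_group_def mat_adjoint_carrier mat_adjoint_adjoint[of _ n n])

lemma unitary_rows:
  assumes "g \<in> unitary_group n" "i < n" "j < n"
  shows "(\<Sum>k<n. g $$ (i, k) * cnj (g $$ (j, k))) = (if i = j then 1 else 0)"
proof -
  have g: "g \<in> carrier_mat n n" using assms by (simp add: unitary_group_def)
  have "(\<Sum>k<n. g $$ (i, k) * cnj (g $$ (j, k))) = (g * mat_adjoint g) $$ (i, j)"
    unfolding mat_mult_index[OF g mat_adjoint_carrier[OF g] assms(2,3)]
    using assms by (intro sum.cong) (auto simp: mat_adjoint_index[OF g])
  thus ?thesis using unitary_mult_adjoint[OF assms(1)] assms by simp
qed

lemma unitary_cols:
  assumes "g \<in> unitary_group n" "i < n" "j < n"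
  shows "(\<Sum>k<n. cnj (g $$ (k, i)) * g $$ (k, j)) = (if i = j then 1 else 0)"
  using assms by (auto simp: unitary_group_iff_columns)

lemma unitary_row_norm:
  assumes "g \<in> unitary_group n" "i < n"
  shows "(\<Sum>k<n. (cmod (g $$ (i, k)))\<^sup>2) = 1"
proof -
  have "complex_of_real (\<Sum>k<n. (cmod (g $$ (i, k)))\<^sup>2) = 1"
    using unitary_rows[OF assms assms(2)] by (simp add: complex_norm_square del: of_real_power)
  thus ?thesis using of_real_eq_1_iff by blast
qed

lemma unitary_col_norm:
  assumes "g \<in> unitary_group n" "i < n"
  shows "(\<Sum>k<n. (cmod (g $$ (k, i)))\<^sup>2) = 1"
proof -
  have "complex_of_real (\<Sum>k<n. (cmod (g $$ (k, i)))\<^sup>2) = 1"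
    using unitary_cols[OF assms assms(2)] by (simp add: complex_norm_square mult.commute del: of_real_power)
  thus ?thesis using of_real_eq_1_iff by blast
qed

lemma unitary_entry_le_1:
  assumes "g \<in> unitary_group n" "i < n" "j < n"
  shows "cmod (g $$ (i, j)) \<le> 1"
proof -
  have "(cmod (g $$ (i, j)))\<^sup>2 \<le> (\<Sum>k<n. (cmod (g $$ (i, k)))\<^sup>2)"
    using assms by (intro member_le_sum) auto
  thus ?thesis using unitary_row_norm[OF assms(1,2)] by (simp add: abs_square_le_1)
qed

lemma unitary_mult_vec_norm:
  assumes "g \<in> unitary_group n"
  shows "(\<Sum>i<n. (cmod (\<Sum>k<n. g $$ (i, k) * y k))\<^sup>2) = (\<Sum>k<n. (cmod (y k))\<^sup>2)"
proof -
  have "complex_of_real (\<Sum>i<n. (cmod (\<Sum>k<n. g $$ (i, k) * y k))\<^sup>2)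
      = (\<Sum>i<n. (\<Sum>k<n. g $$ (i, k) * y k) * cnj (\<Sum>l<n. g $$ (i, l) * y l))"
    by (simp add: complex_norm_square del: of_real_power cnj_sum complex_cnj_mult)
  also have "\<dots> = (\<Sum>i<n. \<Sum>k<n. \<Sum>l<n. y k * cnj (y l) * (cnj (g $$ (i, l)) * g $$ (i, k)))"
    by (simp add: sum_product ac_simps)
  also have "\<dots> = (\<Sum>k<n. \<Sum>l<n. y k * cnj (y l) * (\<Sum>i<n. cnj (g $$ (i, l)) * g $$ (i, k)))"
    by (subst sum.swap, rule sum.cong[OF refl], subst sum.swap) (simp add: sum_distrib_left)
  also have "\<dots> = (\<Sum>k<n. \<Sum>l<n. y k * cnj (y l) * (if l = k then 1 else 0))"
    using unitary_cols[OF assms] by (intro sum.cong) auto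
  also have "\<dots> = (\<Sum>k<n. y k * cnj (y k))"
    by (intro sum.cong refl) (simp add: if_distrib cong: if_cong)
  also have "\<dots> = complex_of_real (\<Sum>k<n. (cmod (y k))\<^sup>2)"
    by (simp add: complex_norm_square del: of_real_power)
  finally show ?thesis using of_real_eq_iff by blast
qed

section \<open>The Borel structure of the unitary group\<close>

lemma measurable_unitary_entry:
  assumes ij: "i < n" "j < n"
  shows "(\<lambda>g. g $$ (i, j)) \<in> borel_measurable (unitary_borel n)"
proof (rule borel_measurableI)
  fix S :: "complex set" assume S: "open S"
  let ?I = "{..<n} \<times> {..<n}"
  let ?T = "product_topology (\<lambda>_. euclidean :: complex topology) ?I"
  have "continuous_map ?T euclidean (\<lambda>e. e (i, j))"
    using continuous_map_product_projection[of "(i, j)" ?I "\<lambda>_. euclidean"] ij by simp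
  hence "continuous_map (unitary_topology n) euclidean ((\<lambda>e. e (i, j)) \<circ> (\<lambda>g. restrict (\<lambda>ij. g $$ ij) ?I))"
    unfolding unitary_topology_def by (rule continuous_map_pullback)
  hence "continuous_map (unitary_topology n) euclidean (\<lambda>g. g $$ (i, j))"
    using ij by (simp add: o_def)
  from openin_continuous_map_preimage[OF this, of S] S
  have "openin (unitary_topology n) {g \<in> unitary_group n. g $$ (i, j) \<in> S}"
    by (simp add: topspace_unitary_topology)
  moreover have "(\<lambda>g. g $$ (i, j)) -` S \<inter> space (unitary_borel n) = {g \<in> unitary_group n. g $$ (i, j) \<in> S}"
    by (auto simp: space_unitary_borel)
  ultimately show "(\<lambda>g. g $$ (i, j)) -` S \<inter> space (unitary_borel n) \<in> sets (unitary_borel n)"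
    by (simp add: sets_unitary_borel)
qed

text \<open>The topology is a pullback along the entries, so an open set is the preimage of an open set of
arrays. Extending the arrays by \<open>0\<close> to all index pairs makes them elements of a countable product
of copies of the plane, where measurability can be tested coordinate by coordinate.\<close>

lemma measurable_into_unitary:
  assumes U: "\<And>\<omega>. \<omega> \<in> space N \<Longrightarrow> f \<omega> \<in> unitary_group n"
    and entry: "\<And>i j. i < n \<Longrightarrow> j < n \<Longrightarrow> (\<lambda>\<omega>. f \<omega> $$ (i, j)) \<in> borel_measurable N"
  shows "f \<in> measurable N (unitary_borel n)"
proof (intro measurable_sigma_sets[OF sets_unitary_borel opens_unitary_subset])
  show "f \<in> space N \<rightarrow> unitary_group n" using U by auto
next
  fix S assume "S \<in> {S. openin (unitary_topology n) S}"
  let ?I = "{..<n} \<times> {..<n}"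
  let ?T = "product_topology (\<lambda>_. euclidean :: complex topology) ?I"
  from \<open>S \<in> _\<close> obtain V where V: "openin ?T V"
    and S: "S = (\<lambda>g. restrict (\<lambda>ij. g $$ ij) ?I) -` V \<inter> unitary_group n"
    unfolding unitary_topology_def by (auto simp: openin_pullback_topology)
  define W where "W = {e :: nat \<times> nat \<Rightarrow> complex. restrict e ?I \<in> V}"
  have "continuous_map (product_topology (\<lambda>_. euclidean :: complex topology) UNIV) ?T (\<lambda>e. restrict e ?I)"
    by (intro continuous_map_into_subtopology continuous_map_componentwise[THEN iffD2])
       (auto intro: continuous_map_product_projection simp: continuous_map_componentwise)
  from openin_continuous_map_preimage[OF this V] have "open W"
    by (simp add: W_def open_fun_def)
  \<comment> \<open>the array of entries, extended by \<open>0\<close>\<close>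
  define F where "F \<omega> = (\<lambda>ij. if ij \<in> ?I then f \<omega> $$ ij else 0)" for \<omega>
  have "F \<in> borel_measurable N"
  proof (rule measurable_coordinatewise_then_product)
    fix ij :: "nat \<times> nat"
    obtain i j where "ij = (i, j)" by (cases ij)
    thus "(\<lambda>\<omega>. F \<omega> ij) \<in> borel_measurable N"
      using entry[of i j] by (cases "ij \<in> ?I") (auto simp: F_def)
  qed
  hence "F -` W \<inter> space N \<in> sets N" using \<open>open W\<close> by (simp add: measurable_sets)
  moreover have "restrict (F \<omega>) ?I = restrict (\<lambda>ij. f \<omega> $$ ij) ?I" for \<omega>
    by (auto simp: F_def)
  hence "F -` W \<inter> space N = f -` S \<inter> space N"
    using U by (auto simp: W_def S)
  ultimately show "f -` S \<inter> space N \<in> sets N" by simp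
qed

lemma measurable_unitary_entry':
  assumes "f \<in> measurable N (unitary_borel n)" "i < n" "j < n"
  shows "(\<lambda>\<omega>. f \<omega> $$ (i, j)) \<in> borel_measurable N"
  using measurable_compose[OF assms(1) measurable_unitary_entry[OF assms(2,3)]] .

lemma measurable_unitary_in:
  assumes "f \<in> measurable N (unitary_borel n)" "\<omega> \<in> space N"
  shows "f \<omega> \<in> unitary_group n"
  using measurable_space[OF assms] by (simp add: space_unitary_borel)

lemma measurable_unitary_mult:
  assumes f: "f \<in> measurable N (unitary_borel n)" and g: "g \<in> measurable N (unitary_borel n)"
  shows "(\<lambda>\<omega>. f \<omega> * g \<omega>) \<in> measurable N (unitary_borel n)"
proof (rule measurable_into_unitary)
  show "f \<omega> * g \<omega> \<in> unitary_group n" if "\<omega> \<in> space N" for \<omega>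
    using unitary_group_mult measurable_unitary_in[OF f that] measurable_unitary_in[OF g that] by blast
  fix i j assume ij: "i < n" "j < n"
  have "(\<lambda>\<omega>. (f \<omega> * g \<omega>) $$ (i, j)) \<in> borel_measurable N \<longleftrightarrow>
        (\<lambda>\<omega>. \<Sum>k<n. f \<omega> $$ (i, k) * g \<omega> $$ (k, j)) \<in> borel_measurable N"
    using ij measurable_unitary_in[OF f] measurable_unitary_in[OF g]
    by (intro measurable_cong mat_mult_index[of _ n n _ n]) (auto simp: unitary_group_def)
  moreover have "(\<lambda>\<omega>. \<Sum>k<n. f \<omega> $$ (i, k) * g \<omega> $$ (k, j)) \<in> borel_measurable N"
    using ij by (intro borel_measurable_sum borel_measurable_times measurable_unitary_entry'[OF f]
      measurable_unitary_entry'[OF g]) auto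
  ultimately show "(\<lambda>\<omega>. (f \<omega> * g \<omega>) $$ (i, j)) \<in> borel_measurable N" by simp
qed

lemma measurable_unitary_adjoint:
  assumes f: "f \<in> measurable N (unitary_borel n)"
  shows "(\<lambda>\<omega>. mat_adjoint (f \<omega>)) \<in> measurable N (unitary_borel n)"
proof (rule measurable_into_unitary)
  show "mat_adjoint (f \<omega>) \<in> unitary_group n" if "\<omega> \<in> space N" for \<omega>
    using unitary_group_adjoint measurable_unitary_in[OF f that] by blast
  fix i j assume ij: "i < n" "j < n"
  have "(\<lambda>\<omega>. mat_adjoint (f \<omega>) $$ (i, j)) \<in> borel_measurable N \<longleftrightarrow>
        (\<lambda>\<omega>. cnj (f \<omega> $$ (j, i))) \<in> borel_measurable N"
    using ij measurable_unitary_in[OF f]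
    by (intro measurable_cong mat_adjoint_index[of _ n n]) (auto simp: unitary_group_def)
  moreover have "(\<lambda>\<omega>. cnj (f \<omega> $$ (j, i))) \<in> borel_measurable N"
    by (rule borel_measurable_continuous_on[OF _ measurable_unitary_entry'[OF f ij(2,1)]])
       (intro continuous_intros)
  ultimately show "(\<lambda>\<omega>. mat_adjoint (f \<omega>) $$ (i, j)) \<in> borel_measurable N" by simp
qed

lemma borel_measurable_det:
  assumes A: "\<And>\<omega>. \<omega> \<in> space N \<Longrightarrow> A \<omega> \<in> carrier_mat n n"
    and entry: "\<And>i j. i < n \<Longrightarrow> j < n \<Longrightarrow> (\<lambda>\<omega>. A \<omega> $$ (i, j) :: complex) \<in> borel_measurable N"
  shows "(\<lambda>\<omega>. det (A \<omega>)) \<in> borel_measurable N"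
proof -
  have "(\<lambda>\<omega>. det (A \<omega>)) \<in> borel_measurable N \<longleftrightarrow>
     (\<lambda>\<omega>. \<Sum>p | p permutes {0..<n}. signof p * (\<Prod>i = 0..<n. A \<omega> $$ (i, p i))) \<in> borel_measurable N"
    using A by (intro measurable_cong det_def') auto
  moreover have "(\<lambda>\<omega>. \<Sum>p | p permutes {0..<n}. signof p * (\<Prod>i = 0..<n. A \<omega> $$ (i, p i)))
      \<in> borel_measurable N"
    by (intro borel_measurable_sum borel_measurable_times borel_measurable_prod borel_measurable_const entry)
       (auto dest: permutes_in_image)
  ultimately show ?thesis by simp
qed

section \<open>Invariance of Haar measure\<close>

lemma haar_space: "haar_unitary n \<mu> \<Longrightarrow> space \<mu> = unitary_group n"
  using sets_eq_imp_space_eq[of \<mu> "unitary_borel n"] by (simp add: haar_unitary_def space_unitary_borel)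

lemma haar_sets: "haar_unitary n \<mu> \<Longrightarrow> sets \<mu> = sets (unitary_borel n)"
  by (simp add: haar_unitary_def)

lemma haar_prob: "haar_unitary n \<mu> \<Longrightarrow> prob_space \<mu>"
  by (simp add: haar_unitary_def)

lemma haar_left: "haar_unitary n \<mu> \<Longrightarrow> h \<in> unitary_group n \<Longrightarrow> distr \<mu> \<mu> (\<lambda>g. h * g) = \<mu>"
  by (simp add: haar_unitary_def)

lemma haar_measurable_cong: 
  "haar_unitary n \<mu> \<Longrightarrow> measurable \<mu> N = measurable (unitary_borel n) N"
  "haar_unitary n \<mu> \<Longrightarrow> measurable N \<mu> = measurable N (unitary_borel n)"
  using haar_sets by (auto intro!: measurable_cong_sets)

lemma haar_nn_integral_left:
  assumes H: "haar_unitary n \<mu>" and h: "h \<in> unitary_group n"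
    and f: "f \<in> borel_measurable (unitary_borel n)"
  shows "(\<integral>\<^sup>+g. f (h * g) \<partial>\<mu>) = (\<integral>\<^sup>+g. f g \<partial>\<mu>)"
proof -
  have "(\<integral>\<^sup>+g. f g \<partial>\<mu>) = (\<integral>\<^sup>+g. f g \<partial>distr \<mu> \<mu> (\<lambda>g. h * g))"
    using haar_left[OF H h] by simp
  also have "\<dots> = (\<integral>\<^sup>+g. f (h * g) \<partial>\<mu>)"
    using f measurable_unitary_mult_left[OF h]
    by (intro nn_integral_distr) (auto simp: haar_measurable_cong[OF H])
  finally show ?thesis ..
qed

text \<open>Integrate \<open>f (g\<^sup>* h)\<close> over both variables, where \<open>g\<^sup>*\<close> is the adjoint. For fixed \<open>g\<close>, left
invariance in \<open>h\<close> gives the integral of \<open>f\<close>; for fixed \<open>h\<close>, the argument is the adjoint of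
\<open>h\<^sup>* g\<close>, and left invariance in \<open>g\<close> gives the integral of \<open>f\<close> over adjoints.\<close>

lemma haar_nn_integral_adjoint:
  fixes f :: "complex mat \<Rightarrow> ennreal"
  assumes H: "haar_unitary n \<mu>" and f: "f \<in> borel_measurable (unitary_borel n)"
  shows "(\<integral>\<^sup>+g. f (mat_adjoint g) \<partial>\<mu>) = (\<integral>\<^sup>+g. f g \<partial>\<mu>)"
proof -
  interpret \<mu>: prob_space \<mu> by (rule haar_prob[OF H])
  interpret P: pair_prob_space \<mu> \<mu> ..
  note mc = haar_measurable_cong[OF H]
  have m1: "fst \<in> measurable (\<mu> \<Otimes>\<^sub>M \<mu>) (unitary_borel n)" "snd \<in> measurable (\<mu> \<Otimes>\<^sub>M \<mu>) (unitary_borel n)"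
    using measurable_fst[of \<mu> \<mu>] measurable_snd[of \<mu> \<mu>] by (auto simp: mc)
  have m: "(\<lambda>(g, h). f (mat_adjoint g * h)) \<in> borel_measurable (\<mu> \<Otimes>\<^sub>M \<mu>)"
    unfolding case_prod_beta
    by (rule measurable_compose[OF _ f], rule measurable_unitary_mult,
        rule measurable_unitary_adjoint) (rule m1)+
  have sp: "space \<mu> = unitary_group n" by (rule haar_space[OF H])
  have fa: "(\<lambda>g. f (mat_adjoint g)) \<in> borel_measurable (unitary_borel n)"
    by (rule measurable_compose[OF _ f], rule measurable_unitary_adjoint) simp
  have "(\<integral>\<^sup>+g. f g \<partial>\<mu>) = (\<integral>\<^sup>+g. (\<integral>\<^sup>+h. f h \<partial>\<mu>) \<partial>\<mu>)"
    by (simp add: \<mu>.emeasure_space_1)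
  also have "\<dots> = (\<integral>\<^sup>+g. (\<integral>\<^sup>+h. f (mat_adjoint g * h) \<partial>\<mu>) \<partial>\<mu>)"
    by (rule nn_integral_cong, rule haar_nn_integral_left[OF H unitary_group_adjoint f, symmetric])
       (simp add: sp)
  also have "\<dots> = (\<integral>\<^sup>+h. (\<integral>\<^sup>+g. f (mat_adjoint g * h) \<partial>\<mu>) \<partial>\<mu>)"
    using P.Fubini'[OF m] by simp
  also have "\<dots> = (\<integral>\<^sup>+h. (\<integral>\<^sup>+g. f (mat_adjoint g) \<partial>\<mu>) \<partial>\<mu>)"
  proof (rule nn_integral_cong)
    fix h assume "h \<in> space \<mu>"
    hence h: "h \<in> unitary_group n" by (simp add: sp)
    hence hc: "h \<in> carrier_mat n n" by (simp add: unitary_group_def)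
    have "mat_adjoint (mat_adjoint h * g) = mat_adjoint g * h" if "g \<in> unitary_group n" for g
      using that hc mat_adjoint_carrier[OF hc]
      by (simp add: mat_adjoint_mult[of _ n] unitary_group_def mat_adjoint_adjoint[OF hc])
    hence "(\<integral>\<^sup>+g. f (mat_adjoint g * h) \<partial>\<mu>) = (\<integral>\<^sup>+g. f (mat_adjoint (mat_adjoint h * g)) \<partial>\<mu>)"
      by (intro nn_integral_cong) (auto simp: sp)
    also have "\<dots> = (\<integral>\<^sup>+g. f (mat_adjoint g) \<partial>\<mu>)"
      by (rule haar_nn_integral_left[OF H unitary_group_adjoint[OF h] fa])
    finally show "(\<integral>\<^sup>+g. f (mat_adjoint g * h) \<partial>\<mu>) = (\<integral>\<^sup>+g. f (mat_adjoint g) \<partial>\<mu>)" .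
  qed
  also have "\<dots> = (\<integral>\<^sup>+g. f (mat_adjoint g) \<partial>\<mu>)"
    by (simp add: \<mu>.emeasure_space_1)
  finally show ?thesis ..
qed

lemma measurable_unitary_mult_right:
  assumes h: "h \<in> unitary_group n"
  shows "(\<lambda>g. g * h) \<in> measurable (unitary_borel n) (unitary_borel n)"
  by (rule measurable_unitary_mult) (auto simp: h space_unitary_borel)

text \<open>Taking adjoints turns right multiplication into left multiplication.\<close>

lemma haar_right:
  assumes H: "haar_unitary n \<mu>" and h: "h \<in> unitary_group n"
  shows "distr \<mu> \<mu> (\<lambda>g. g * h) = \<mu>"
proof (rule measure_eqI)
  note mc = haar_measurable_cong[OF H]
  have sp: "space \<mu> = unitary_group n" by (rule haar_space[OF H])
  have mr: "(\<lambda>g. g * h) \<in> measurable \<mu> \<mu>" using measurable_unitary_mult_right[OF h] by (auto simp: mc)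
  fix A assume "A \<in> sets (distr \<mu> \<mu> (\<lambda>g. g * h))"
  hence A: "A \<in> sets \<mu>" by simp
  define f :: "complex mat \<Rightarrow> ennreal" where "f = indicator A"
  have f: "f \<in> borel_measurable (unitary_borel n)" using A haar_sets[OF H] by (simp add: f_def)
  have fh: "(\<lambda>g. f (g * h)) \<in> borel_measurable (unitary_borel n)"
    by (rule measurable_compose[OF measurable_unitary_mult_right[OF h] f])
  have fa: "(\<lambda>g. f (mat_adjoint g)) \<in> borel_measurable (unitary_borel n)"
    by (rule measurable_compose[OF _ f], rule measurable_unitary_adjoint) simp
  have hc: "h \<in> carrier_mat n n" using h by (simp add: unitary_group_def)
  have "emeasure (distr \<mu> \<mu> (\<lambda>g. g * h)) A = (\<integral>\<^sup>+g. f g \<partial>distr \<mu> \<mu> (\<lambda>g. g * h))"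
    using A by (simp add: f_def)
  also have "\<dots> = (\<integral>\<^sup>+g. f (g * h) \<partial>\<mu>)"
    using f mr by (intro nn_integral_distr) (auto simp: mc)
  also have "\<dots> = (\<integral>\<^sup>+g. f (mat_adjoint g * h) \<partial>\<mu>)"
    using haar_nn_integral_adjoint[OF H fh] by simp
  also have "\<dots> = (\<integral>\<^sup>+g. f (mat_adjoint (mat_adjoint h * g)) \<partial>\<mu>)"
    using hc mat_adjoint_carrier[OF hc]
    by (intro nn_integral_cong) (simp add: sp mat_adjoint_mult[of _ n] unitary_group_def
        mat_adjoint_adjoint[OF hc])
  also have "\<dots> = (\<integral>\<^sup>+g. f (mat_adjoint g) \<partial>\<mu>)"
    by (rule haar_nn_integral_left[OF H unitary_group_adjoint[OF h] fa])
  also have "\<dots> = (\<integral>\<^sup>+g. f g \<partial>\<mu>)"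
    by (rule haar_nn_integral_adjoint[OF H f])
  also have "\<dots> = emeasure \<mu> A" using A by (simp add: f_def)
  finally show "emeasure (distr \<mu> \<mu> (\<lambda>g. g * h)) A = emeasure \<mu> A" .
qed simp

section \<open>The Schur reduction\<close>

text \<open>From here on a sum over \<open>{..<Suc m}\<close> is always split at the index \<open>0\<close> of the corner entry,
  never at the last index.\<close>

declare sum.lessThan_Suc [simp del]

text \<open>The matrix \<open>h\<close> for which \<open>1 - h\<close> is the Schur complement of \<open>1 - g\<close> with respect to the corner
  entry. The value at corner \<open>1\<close>, an event of probability \<open>0\<close>, is chosen so that the result is
  always unitary.\<close>

definition schur_reduce :: "nat \<Rightarrow> complex mat \<Rightarrow> complex mat" where
  "schur_reduce m g = (if g $$ (0, 0) = 1 then 1\<^sub>m m else mat m m (\<lambda>(i, j).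
     g $$ (Suc i, Suc j) + g $$ (Suc i, 0) * g $$ (0, Suc j) / (1 - g $$ (0, 0))))"

definition unitary_extend :: "nat \<Rightarrow> complex mat \<Rightarrow> complex mat" where
  "unitary_extend m k = mat (Suc m) (Suc m) (\<lambda>(i, j).
     if i = 0 \<or> j = 0 then (if i = j then 1 else 0) else k $$ (i - 1, j - 1))"

lemma schur_reduce_carrier [simp]: "schur_reduce m g \<in> carrier_mat m m"
  by (simp add: schur_reduce_def)

lemma schur_reduce_dim [simp]: "dim_row (schur_reduce m g) = m" "dim_col (schur_reduce m g) = m"
  using schur_reduce_carrier[of m g] by blast+

lemma unitary_group_carrier: "g \<in> unitary_group n \<Longrightarrow> g \<in> carrier_mat n n"
  by (simp add: unitary_group_def)

text \<open>The orthonormality relations of the columns of \<open>g\<close> express all sums that occur through the corner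
entry \<open>a\<close> and the first row \<open>r\<close>; the coefficient of \<open>cnj (r j) * r l\<close> that remains vanishes
because of the choice \<open>\<gamma> = 1 / (1 - a)\<close>.\<close>

lemma schur_reduce_unitary:
  assumes g: "g \<in> unitary_group (Suc m)" and ne: "g $$ (0, 0) \<noteq> 1"
  shows "schur_reduce m g \<in> unitary_group m"
  unfolding unitary_group_iff_columns
proof (intro conjI allI impI)
  fix j l assume j: "j < m" and l: "l < m"
  define a where "a = g $$ (0, 0)"
  define c where "c i = g $$ (Suc i, 0)" for i
  define r where "r i = g $$ (0, Suc i)" for i
  define G where "G i j = g $$ (Suc i, Suc j)" for i j
  define \<gamma> where "\<gamma> = 1 / (1 - a)"
  have \<gamma>: "\<gamma> * (1 - a) = 1" using ne by (simp add: \<gamma>_def a_def)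
  hence \<gamma>': "cnj \<gamma> * (1 - cnj a) = 1"
    by (metis complex_cnj_diff complex_cnj_mult complex_cnj_one)
  define \<delta> :: complex where "\<delta> = (if j = l then 1 else 0)"
  have s1: "cnj (r j) * r l + (\<Sum>i<m. cnj (G i j) * G i l) = \<delta>"
    using unitary_cols[OF g, of "Suc j" "Suc l"] j l by (simp add: sum.lessThan_Suc_shift r_def G_def \<delta>_def)
  have s2: "cnj (r j) * a + (\<Sum>i<m. cnj (G i j) * c i) = 0"
    using unitary_cols[OF g, of "Suc j" 0] j by (simp add: sum.lessThan_Suc_shift r_def G_def c_def a_def)
  have s3: "cnj a * r l + (\<Sum>i<m. cnj (c i) * G i l) = 0"
    using unitary_cols[OF g, of 0 "Suc l"] l by (simp add: sum.lessThan_Suc_shift r_def G_def c_def a_def)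
  have s4: "cnj a * a + (\<Sum>i<m. cnj (c i) * c i) = 1"
    using unitary_cols[OF g, of 0 0] by (simp add: sum.lessThan_Suc_shift c_def a_def)
  have "(\<Sum>k<m. cnj (schur_reduce m g $$ (k, j)) * schur_reduce m g $$ (k, l))
      = (\<Sum>k<m. cnj (G k j + \<gamma> * (c k * r j)) * (G k l + \<gamma> * (c k * r l)))"
    using j l ne by (intro sum.cong) (auto simp: schur_reduce_def G_def c_def r_def \<gamma>_def a_def)
  also have "\<dots> = (\<Sum>k<m. cnj (G k j) * G k l + \<gamma> * r l * (cnj (G k j) * c k)
      + cnj \<gamma> * cnj (r j) * (cnj (c k) * G k l)
      + cnj \<gamma> * \<gamma> * cnj (r j) * r l * (cnj (c k) * c k))"
    by (intro sum.cong refl) (simp add: algebra_simps)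
  also have "\<dots> = (\<Sum>k<m. cnj (G k j) * G k l) + \<gamma> * r l * (\<Sum>k<m. cnj (G k j) * c k)
      + cnj \<gamma> * cnj (r j) * (\<Sum>k<m. cnj (c k) * G k l)
      + cnj \<gamma> * \<gamma> * cnj (r j) * r l * (\<Sum>k<m. cnj (c k) * c k)"
    by (simp only: sum_distrib_left sum.distrib)
  also have "\<dots> = (\<delta> - cnj (r j) * r l) + \<gamma> * r l * (- cnj (r j) * a)
      + cnj \<gamma> * cnj (r j) * (- cnj a * r l)
      + cnj \<gamma> * \<gamma> * cnj (r j) * r l * (1 - cnj a * a)"
  proof -
    have e: "(\<Sum>k<m. cnj (G k j) * G k l) = \<delta> - cnj (r j) * r l"
      "(\<Sum>k<m. cnj (G k j) * c k) = - cnj (r j) * a"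
      "(\<Sum>k<m. cnj (c k) * G k l) = - cnj a * r l"
      "(\<Sum>k<m. cnj (c k) * c k) = 1 - cnj a * a"
      using s1 s2 s3 s4 by (auto simp: algebra_simps eq_neg_iff_add_eq_0)
    show ?thesis unfolding e ..
  qed
  also have "\<dots> = \<delta>"
    using \<gamma> \<gamma>' by Groebner_Basis.algebra
  finally show "(\<Sum>k<m. cnj (schur_reduce m g $$ (k, j)) * schur_reduce m g $$ (k, l))
      = (if j = l then 1 else 0)" by (simp add: \<delta>_def)
qed simp

lemma unitary_extend_unitary:
  assumes k: "k \<in> unitary_group m"
  shows "unitary_extend m k \<in> unitary_group (Suc m)"
  unfolding unitary_group_iff_columns
proof (intro conjI allI impI)
  fix i j assume "i < Suc m" "j < Suc m"
  thus "(\<Sum>l<Suc m. cnj (unitary_extend m k $$ (l, i)) * unitary_extend m k $$ (l, j))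
      = (if i = j then 1 else 0)"
    using unitary_cols[OF k, of "i - 1" "j - 1"]
    by (cases i; cases j) (simp_all add: sum.lessThan_Suc_shift unitary_extend_def)
qed (simp add: unitary_extend_def)

lemma unitary_extend_mult:
  assumes g: "g \<in> carrier_mat (Suc m) (Suc m)"
  shows "j < Suc m \<Longrightarrow> (unitary_extend m k * g) $$ (0, j) = g $$ (0, j)"
    and "i < m \<Longrightarrow> j < Suc m \<Longrightarrow>
      (unitary_extend m k * g) $$ (Suc i, j) = (\<Sum>l<m. k $$ (i, l) * g $$ (Suc l, j))"
proof -
  have c: "unitary_extend m k \<in> carrier_mat (Suc m) (Suc m)" by (simp add: unitary_extend_def)
  show "j < Suc m \<Longrightarrow> (unitary_extend m k * g) $$ (0, j) = g $$ (0, j)"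
    by (subst mat_mult_index[OF c g]) (auto simp: sum.lessThan_Suc_shift unitary_extend_def)
  show "i < m \<Longrightarrow> j < Suc m \<Longrightarrow>
      (unitary_extend m k * g) $$ (Suc i, j) = (\<Sum>l<m. k $$ (i, l) * g $$ (Suc l, j))"
    by (subst mat_mult_index[OF c g]) (auto simp: sum.lessThan_Suc_shift unitary_extend_def)
qed

text \<open>The corner entry and the first row of \<open>g\<close> do not change, while the rest of the first column and the
remaining block are multiplied by \<open>k\<close>; the reduction is linear in these two. This equivariance is
what makes the reduction of a Haar matrix a Haar matrix.\<close>

lemma schur_reduce_extend_mult:
  assumes g: "g \<in> carrier_mat (Suc m) (Suc m)" and ne: "g $$ (0, 0) \<noteq> 1" and k: "k \<in> carrier_mat m m"
  shows "schur_reduce m (unitary_extend m k * g) = k * schur_reduce m g"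
proof (rule eq_matI)
  fix i j assume "i < dim_row (k * schur_reduce m g)" "j < dim_col (k * schur_reduce m g)"
  hence ij: "i < m" "j < m" using k by auto
  have "(k * schur_reduce m g) $$ (i, j) = (\<Sum>l<m. k $$ (i, l) * schur_reduce m g $$ (l, j))"
    using ij by (intro mat_mult_index[OF k]) auto
  also have "\<dots> = (\<Sum>l<m. k $$ (i, l) * g $$ (Suc l, Suc j))
      + (\<Sum>l<m. k $$ (i, l) * g $$ (Suc l, 0)) * g $$ (0, Suc j) / (1 - g $$ (0, 0))"
    unfolding sum_distrib_right sum_divide_distrib sum.distrib[symmetric]
    using ij ne by (intro sum.cong refl) (simp add: schur_reduce_def algebra_simps)
  also have "\<dots> = schur_reduce m (unitary_extend m k * g) $$ (i, j)"
    using ij ne by (simp add: schur_reduce_def unitary_extend_mult[OF g])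
  finally show "schur_reduce m (unitary_extend m k * g) $$ (i, j) = (k * schur_reduce m g) $$ (i, j)" ..
qed (use k in auto)

section \<open>Determinants and eigenvalues\<close>

text \<open>Gaussian elimination of the first column, written as a product of two triangular factors.\<close>

lemma det_schur_complement:
  fixes A :: "'a :: field mat"
  assumes A: "A \<in> carrier_mat (Suc m) (Suc m)" and nz: "A $$ (0, 0) \<noteq> 0"
  shows "det A = A $$ (0, 0) * det (mat m m (\<lambda>(i, j).
           A $$ (Suc i, Suc j) - A $$ (Suc i, 0) * A $$ (0, Suc j) / A $$ (0, 0)))"
proof -
  define S where "S = mat m m (\<lambda>(i, j).
           A $$ (Suc i, Suc j) - A $$ (Suc i, 0) * A $$ (0, Suc j) / A $$ (0, 0))"
  define L where "L = mat (Suc m) (Suc m) (\<lambda>(i, j).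
     if i = j then 1 else if j = 0 then A $$ (i, 0) / A $$ (0, 0) else 0)"
  define U where "U = mat (Suc m) (Suc m) (\<lambda>(i, j).
     if i = 0 then A $$ (0, j) else if j = 0 then 0 else S $$ (i - 1, j - 1))"
  have Lc: "L \<in> carrier_mat (Suc m) (Suc m)" and Uc: "U \<in> carrier_mat (Suc m) (Suc m)"
    by (auto simp: L_def U_def)
  have "A = L * U"
  proof (rule eq_matI)
    fix i j assume "i < dim_row (L * U)" "j < dim_col (L * U)"
    hence ij: "i < Suc m" "j < Suc m" by (auto simp: L_def U_def)
    have "(L * U) $$ (i, j) = (\<Sum>k<Suc m. L $$ (i, k) * U $$ (k, j))"
      by (rule mat_mult_index[OF Lc Uc ij])
    also have "\<dots> = L $$ (i, 0) * U $$ (0, j) + (\<Sum>k<m. L $$ (i, Suc k) * U $$ (Suc k, j))"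
      by (simp add: sum.lessThan_Suc_shift)
    also have "(\<Sum>k<m. L $$ (i, Suc k) * U $$ (Suc k, j)) = (\<Sum>k<m. if Suc k = i then U $$ (i, j) else 0)"
      using ij by (intro sum.cong) (auto simp: L_def)
    also have "\<dots> = (if i = 0 then 0 else U $$ (i, j))"
      using ij by (cases i) auto
    also have "L $$ (i, 0) * U $$ (0, j) + \<dots> = A $$ (i, j)"
      using ij nz by (cases i; cases j) (auto simp: L_def U_def S_def)
    finally show "A $$ (i, j) = (L * U) $$ (i, j)" ..
  qed (use A in \<open>auto simp: L_def U_def\<close>)
  moreover have "det L = 1"
  proof -
    have "det L = prod_list (diag_mat L)"
      by (rule det_lower_triangular[OF _ Lc]) (auto simp: L_def)
    also have "diag_mat L = map (\<lambda>_. 1) [0..<Suc m]"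
      unfolding diag_mat_def using Lc by (intro map_cong) (auto simp: L_def)
    finally show ?thesis by (simp add: map_replicate_const)
  qed
  moreover have "det U = A $$ (0, 0) * det S"
  proof -
    have "det U = (\<Sum>i<Suc m. U $$ (i, 0) * cofactor U i 0)"
      by (rule laplace_expansion_column[OF Uc]) simp
    also have "\<dots> = A $$ (0, 0) * cofactor U 0 0"
      by (simp add: sum.lessThan_Suc_shift U_def)
    also have "cofactor U 0 0 = det (mat_delete U 0 0)" by (simp add: cofactor_def)
    also have "mat_delete U 0 0 = S"
      by (rule eq_matI) (auto simp: mat_delete_def U_def S_def)
    finally show ?thesis .
  qed
  ultimately show ?thesis using det_mult[OF Lc Uc] by (simp add: S_def)
qed

lemma det_add_corner:
  fixes A :: "'a :: comm_ring_1 mat"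
  assumes A: "A \<in> carrier_mat (Suc m) (Suc m)"
  shows "det (mat (Suc m) (Suc m) (\<lambda>(i, j). A $$ (i, j) + (if i = 0 \<and> j = 0 then w else 0)))
       = det A + w * cofactor A 0 0"
proof -
  let ?B = "mat (Suc m) (Suc m) (\<lambda>(i, j). A $$ (i, j) + (if i = 0 \<and> j = 0 then w else 0))"
  have B: "?B \<in> carrier_mat (Suc m) (Suc m)" by simp
  have "mat_delete ?B 0 j = mat_delete A 0 j" if "j < Suc m" for j
    using A that by (intro eq_matI) (auto simp: mat_delete_def)
  hence cof: "cofactor ?B 0 j = cofactor A 0 j" if "j < Suc m" for j
    using that by (simp add: cofactor_def)
  have "det ?B = (\<Sum>j<Suc m. ?B $$ (0, j) * cofactor ?B 0 j)"
    by (rule laplace_expansion_row[OF B]) simp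
  also have "\<dots> = (\<Sum>j<Suc m. ?B $$ (0, j) * cofactor A 0 j)"
    using cof by (intro sum.cong) auto
  also have "\<dots> = (\<Sum>j<Suc m. A $$ (0, j) * cofactor A 0 j) + w * cofactor A 0 0"
    by (simp add: sum.lessThan_Suc_shift algebra_simps)
  also have "(\<Sum>j<Suc m. A $$ (0, j) * cofactor A 0 j) = det A"
    by (rule laplace_expansion_row[OF A, symmetric]) simp
  finally show ?thesis .
qed

definition eigs :: "complex mat \<Rightarrow> complex multiset" where
  "eigs g = proots (char_poly g)"

lemma char_poly_eigs:
  assumes "g \<in> carrier_mat n n"
  shows "poly (char_poly g) x = (\<Prod>z\<in>#eigs g. x - z)"
proof -
  have "lead_coeff (char_poly g) = 1" using degree_monic_char_poly[OF assms] by simp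
  with complex_poly_decompose_multiset[of "char_poly g"]
  have "char_poly g = (\<Prod>x\<in>#eigs g. [:-x, 1:])" by (simp add: eigs_def)
  moreover have "poly (\<Prod>z\<in>#M. [:-z, 1:]) x = (\<Prod>z\<in>#M. x - z)" for M
    by (induction M) (auto simp: algebra_simps)
  ultimately show ?thesis by metis
qed

lemma size_eigs: "g \<in> carrier_mat n n \<Longrightarrow> size (eigs g) = n"
  using degree_monic_char_poly[of g n] by (simp add: eigs_def size_proots_complex)

lemma det_shift_eigs:
  fixes g :: "complex mat"
  assumes g: "g \<in> carrier_mat n n"
  shows "det (mat n n (\<lambda>(i, j). (if i = j then x else 0) - g $$ (i, j))) = (\<Prod>z\<in>#eigs g. x - z)"
proof -
  have "mat n n (\<lambda>(i, j). (if i = j then x else 0) - g $$ (i, j)) = - (char_matrix g x)"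
    using g by (intro eq_matI) (auto simp: char_matrix_def)
  thus ?thesis using char_poly_matrix[OF g, of x] char_poly_eigs[OF g, of x] by simp
qed

lemma det_one_minus_scaled_eigs:
  fixes g :: "complex mat"
  assumes g: "g \<in> carrier_mat n n"
  shows "det (mat n n (\<lambda>(i, j). (if i = j then 1 else 0) - r * g $$ (i, j))) = (\<Prod>z\<in>#eigs g. 1 - r * z)"
proof (cases "r = 0")
  case True
  have "mat n n (\<lambda>(i, j). if i = j then 1 else 0 :: complex) = 1\<^sub>m n" by (intro eq_matI) auto
  thus ?thesis using True by simp
next
  case False
  have m: "(\<Prod>z\<in>#M. 1 - r * z) = r ^ size M * (\<Prod>z\<in>#M. 1 / r - z)" for M
    using False by (induction M) (auto simp: field_simps)
  have "mat n n (\<lambda>(i, j). (if i = j then 1 else 0) - r * g $$ (i, j))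
     = r \<cdot>\<^sub>m mat n n (\<lambda>(i, j). (if i = j then 1 / r else 0) - g $$ (i, j))"
    using False by (intro eq_matI) (auto simp: algebra_simps)
  thus ?thesis using det_shift_eigs[OF g, of "1 / r"] m[of "eigs g"] size_eigs[OF g] by simp
qed

lemma eigs_unitary_norm:
  assumes g: "g \<in> unitary_group n" and z: "z \<in># eigs g"
  shows "cmod z = 1"
proof -
  have gc: "g \<in> carrier_mat n n" using g by (rule unitary_group_carrier)
  have "char_poly g \<noteq> 0" using degree_monic_char_poly[OF gc] by auto
  with z have "poly (char_poly g) z = 0" by (simp add: eigs_def)
  hence "eigenvalue g z" using eigenvalue_root_char_poly[OF gc] by simp
  then obtain v where v: "v \<in> carrier_vec n" "v \<noteq> 0\<^sub>v n" "g *\<^sub>v v = z \<cdot>\<^sub>v v"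
    using gc by (auto simp: eigenvalue_def eigenvector_def)
  have "(\<Sum>k<n. g $$ (i, k) * v $ k) = z * v $ i" if "i < n" for i
  proof -
    have "(g *\<^sub>v v) $ i = z * v $ i" using v that by simp
    thus ?thesis using gc v(1) that by (simp add: scalar_prod_def atLeast0LessThan)
  qed
  hence "(\<Sum>i<n. (cmod (z * v $ i))\<^sup>2) = (\<Sum>k<n. (cmod (v $ k))\<^sup>2)"
    using unitary_mult_vec_norm[OF g, of "\<lambda>k. v $ k"] by simp
  hence "(cmod z)\<^sup>2 * (\<Sum>k<n. (cmod (v $ k))\<^sup>2) = (\<Sum>k<n. (cmod (v $ k))\<^sup>2)"
    by (simp add: norm_mult power_mult_distrib sum_distrib_left)
  moreover have "(\<Sum>k<n. (cmod (v $ k))\<^sup>2) \<noteq> 0"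
  proof
    assume "(\<Sum>k<n. (cmod (v $ k))\<^sup>2) = 0"
    hence "\<forall>k<n. v $ k = 0" by (subst (asm) sum_nonneg_eq_0_iff) auto
    hence "v = 0\<^sub>v n" using v(1) by (intro eq_vecI) auto
    thus False using v by simp
  qed
  ultimately have "(cmod z)\<^sup>2 = 1" by simp
  thus ?thesis by (simp add: power2_eq_1_iff) (use norm_ge_zero[of z] in linarith)
qed

lemma Re_less_1_of_unit_disc:
  assumes "cmod z \<le> 1" "z \<noteq> 1" shows "Re z < 1"
proof (rule ccontr)
  assume "\<not> Re z < 1"
  hence "Re z = 1" using complex_Re_le_cmod[of z] assms by linarith
  moreover from this have "Im z = 0"
    using assms by (smt (verit) cmod_power2 power_one power2_eq_square mult_eq_0_iff zero_le_square
        norm_ge_zero power_mono abs_le_square_iff)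
  ultimately show False using assms by (simp add: complex_eq_iff)
qed

lemma Re_one_minus_scaled_pos:
  assumes "cmod z \<le> 1" "z \<noteq> 1" "0 \<le> r" "r \<le> 1"
  shows "Re (1 - of_real r * z) > 0"
proof -
  have "r * Re z < 1"
  proof (cases "Re z \<le> 0")
    case True thus ?thesis using assms by (smt (verit) mult_nonneg_nonpos)
  next
    case False
    hence "r * Re z \<le> 1 * Re z" using assms by (intro mult_right_mono) auto
    thus ?thesis using Re_less_1_of_unit_disc[OF assms(1,2)] by simp
  qed
  thus ?thesis by simp
qed

text \<open>A kernel vector \<open>v\<close> satisfies \<open>g v = D v\<close> with \<open>D\<close> diagonal. Since \<open>g\<close> is an isometry and no diagonal
entry has modulus below \<open>1\<close>, all coordinates with a diagonal entry of modulus above \<open>1\<close> vanish.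
Only the corner coordinate is left, and the first equation excludes it.\<close>

lemma corner_nonsingular:
  assumes g: "g \<in> unitary_group (Suc m)" and ne: "g $$ (0, 0) \<noteq> 1"
    and x: "x > 1" and w: "Re w \<ge> 0"
  shows "det (mat (Suc m) (Suc m) (\<lambda>(i, j).
     (if i = j then if i = 0 then 1 + w else of_real x else 0) - g $$ (i, j))) \<noteq> 0"
proof
  let ?A = "mat (Suc m) (Suc m) (\<lambda>(i, j).
     (if i = j then if i = 0 then 1 + w else of_real x else 0) - g $$ (i, j))"
  assume "det ?A = 0"
  then obtain v where v: "v \<in> carrier_vec (Suc m)" "v \<noteq> 0\<^sub>v (Suc m)" "?A *\<^sub>v v = 0\<^sub>v (Suc m)"
    using det_0_iff_vec_prod_zero[of ?A "Suc m"] by auto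
  define d where "d i = (if i = (0::nat) then 1 + w else of_real x)" for i
  have eq: "(\<Sum>k<Suc m. g $$ (i, k) * v $ k) = d i * v $ i" if "i < Suc m" for i
  proof -
    have "0 = (?A *\<^sub>v v) $ i" using v that by simp
    also have "(?A *\<^sub>v v) $ i = (\<Sum>k<Suc m. ((if i = k then d i else 0) - g $$ (i, k)) * v $ k)"
      using that v(1) by (auto simp: scalar_prod_def atLeast0LessThan d_def intro!: sum.cong)
    also have "\<dots> = (\<Sum>k<Suc m. (if i = k then d i * v $ k else 0)) - (\<Sum>k<Suc m. g $$ (i, k) * v $ k)"
      unfolding sum_subtractf[symmetric] by (intro sum.cong) (auto simp: algebra_simps)
    also have "(\<Sum>k<Suc m. (if i = k then d i * v $ k else 0)) = d i * v $ i"
      using that by simp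
    finally show ?thesis by simp
  qed
  have "(\<Sum>i<Suc m. (cmod (d i * v $ i))\<^sup>2) = (\<Sum>k<Suc m. (cmod (v $ k))\<^sup>2)"
    using unitary_mult_vec_norm[OF g, of "\<lambda>k. v $ k"] eq by simp
  hence z: "(\<Sum>i<Suc m. ((cmod (d i))\<^sup>2 - 1) * (cmod (v $ i))\<^sup>2) = 0"
    by (simp only: norm_mult power_mult_distrib left_diff_distrib sum_subtractf) simp
  have "1 \<le> cmod (1 + w)" using complex_Re_le_cmod[of "1 + w"] w by simp
  hence d1: "cmod (d i) \<ge> 1" for i using x by (auto simp: d_def)
  have "((cmod (d i))\<^sup>2 - 1) * (cmod (v $ i))\<^sup>2 = 0" if "i < Suc m" for i
    using z d1 that by (subst (asm) sum_nonneg_eq_0_iff) (auto intro!: mult_nonneg_nonneg one_le_power)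
  moreover have "(cmod (d i))\<^sup>2 - 1 \<noteq> 0" if "i \<noteq> 0" for i
    using x that by (simp add: d_def power2_eq_1_iff)
  ultimately have v0: "v $ i = 0" if "i < Suc m" "i \<noteq> 0" for i
    using that by (metis mult_eq_0_iff norm_eq_zero power_eq_0_iff)
  have "(\<Sum>k<Suc m. g $$ (0, k) * v $ k) = g $$ (0, 0) * v $ 0"
    using v0 by (simp add: sum.lessThan_Suc_shift)
  with eq[of 0] have "(g $$ (0, 0) - (1 + w)) * v $ 0 = 0" by (simp add: d_def algebra_simps)
  moreover have "g $$ (0, 0) \<noteq> 1 + w"
    using Re_less_1_of_unit_disc[OF unitary_entry_le_1[OF g, of 0 0] ne] w by auto
  ultimately have "v $ 0 = 0" by simp
  with v0 have "v $ i = 0" if "i < Suc m" for i using that by (cases "i = 0") auto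
  hence "v = 0\<^sub>v (Suc m)" using v by (intro eq_vecI) auto
  thus False using v by simp
qed

text \<open>If the quotient \<open>q\<close> had negative real part, \<open>w = -1/q\<close> would be a forbidden zero.\<close>

lemma Re_quotient_nonneg:
  assumes "\<And>w :: complex. Re w \<ge> 0 \<Longrightarrow> a + w * b \<noteq> 0"
  shows "Re (b / a) \<ge> 0"
proof (rule ccontr)
  assume "\<not> Re (b / a) \<ge> 0"
  hence neg: "Re (b / a) < 0" by simp
  hence ab: "a \<noteq> 0" "b \<noteq> 0" by auto
  define q where "q = b / a"
  have "Re (- 1 / q) = - Re q / (cmod q)\<^sup>2"
    by (simp add: Re_divide cmod_power2)
  also have "\<dots> \<ge> 0" using neg by (intro divide_nonneg_nonneg) (auto simp: q_def)
  finally have "a + (- 1 / q) * b \<noteq> 0" by (intro assms)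
  thus False using ab by (simp add: q_def)
qed

text \<open>Let \<open>K x\<close> be the matrix \<open>x - g\<close> with the diagonal \<open>(x, ..., x)\<close> changed to \<open>(1, x, ..., x)\<close>.
The Schur complement of \<open>K x\<close> is \<open>x - h\<close>, where \<open>h\<close> is the reduction of \<open>g\<close>, so the denominator
below is \<open>det (K x)\<close>. The numerator is \<open>det (x - g) = det (K x) + (x - 1) * cofactor\<close>. As \<open>K x\<close>
stays nonsingular when any number of nonnegative real part is added to its corner, the cofactor
divided by \<open>det (K x)\<close> has nonnegative real part.\<close>

lemma eigs_schur_ratio:
  assumes g: "g \<in> unitary_group (Suc m)" and ne: "g $$ (0, 0) \<noteq> 1" and x: "x \<ge> 1"
    and inv: "1 \<notin># eigs g"
  shows "(\<Prod>z\<in>#eigs (schur_reduce m g). of_real x - z) \<noteq> 0" 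
    and "Re ((\<Prod>z\<in>#eigs g. of_real x - z) /
          ((1 - g $$ (0, 0)) * (\<Prod>z\<in>#eigs (schur_reduce m g). of_real x - z))) \<ge> 1"
    and "(\<Prod>z\<in>#eigs g. 1 - z) = (1 - g $$ (0, 0)) * (\<Prod>z\<in>#eigs (schur_reduce m g). 1 - z)"
proof -
  have gc: "g \<in> carrier_mat (Suc m) (Suc m)" using g by (rule unitary_group_carrier)
  define K where "K x = mat (Suc m) (Suc m) (\<lambda>(i, j).
     (if i = j then if i = 0 then 1 else of_real x else 0) - g $$ (i, j))" for x :: real
  have Kc: "K x \<in> carrier_mat (Suc m) (Suc m)" for x by (simp add: K_def)
  have corner: "det (mat (Suc m) (Suc m) (\<lambda>(i, j).
     (if i = j then if i = 0 then 1 + w else of_real x else 0) - g $$ (i, j)))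
     = det (K x) + w * cofactor (K x) 0 0" for w x
    unfolding det_add_corner[OF Kc, symmetric]
    by (intro arg_cong[where f = det] eq_matI) (auto simp: K_def)
  have K: "det (K x) = (1 - g $$ (0, 0)) * (\<Prod>z\<in>#eigs (schur_reduce m g). of_real x - z)" for x
  proof -
    have "det (K x) = K x $$ (0, 0) * det (mat m m (\<lambda>(i, j).
           K x $$ (Suc i, Suc j) - K x $$ (Suc i, 0) * K x $$ (0, Suc j) / K x $$ (0, 0)))"
      using ne by (intro det_schur_complement[OF Kc]) (simp add: K_def)
    also have "mat m m (\<lambda>(i, j).
           K x $$ (Suc i, Suc j) - K x $$ (Suc i, 0) * K x $$ (0, Suc j) / K x $$ (0, 0))
        = mat m m (\<lambda>(i, j). (if i = j then of_real x else 0) - schur_reduce m g $$ (i, j))"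
      using ne by (intro eq_matI) (auto simp: K_def schur_reduce_def)
    also have "det \<dots> = (\<Prod>z\<in>#eigs (schur_reduce m g). of_real x - z)"
      by (rule det_shift_eigs) simp
    finally show ?thesis by (simp add: K_def)
  qed
  have P: "(\<Prod>z\<in>#eigs g. of_real x - z) = det (K x) + (of_real x - 1) * cofactor (K x) 0 0" for x
    unfolding det_shift_eigs[OF gc, symmetric] corner[symmetric]
    by (intro arg_cong[where f = det] eq_matI) auto
  have one: "(\<Prod>z\<in>#eigs g. 1 - z) = det (K 1)" using P[of 1] by simp
  show "(\<Prod>z\<in>#eigs g. 1 - z) = (1 - g $$ (0, 0)) * (\<Prod>z\<in>#eigs (schur_reduce m g). 1 - z)"
    using one K[of 1] by simp
  have "(\<Prod>z\<in>#eigs g. 1 - z) \<noteq> 0" using inv by (auto simp: prod_mset_zero_iff)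
  hence K1: "det (K 1) \<noteq> 0" using one by simp
  have dK: "det (K x) \<noteq> 0"
  proof (cases "x = 1")
    case False
    hence "x > 1" using x by simp
    from corner_nonsingular[OF g ne this, of 0] corner[where w=0 and x=x] show ?thesis by simp
  qed (use K1 in simp)
  thus "(\<Prod>z\<in>#eigs (schur_reduce m g). of_real x - z) \<noteq> 0" using K[of x] by simp
  have "Re ((of_real x - 1) * cofactor (K x) 0 0 / det (K x)) \<ge> 0"
  proof (cases "x = 1")
    case False
    hence x1: "x > 1" using x by simp
    have "Re (cofactor (K x) 0 0 / det (K x)) \<ge> 0"
      by (rule Re_quotient_nonneg) (use corner_nonsingular[OF g ne x1] corner in metis)
    hence "0 \<le> (x - 1) * Re (cofactor (K x) 0 0 / det (K x))" using x1 by simp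
    also have "\<dots> = Re (of_real (x - 1) * (cofactor (K x) 0 0 / det (K x)))"
      by (simp only: Re_complex_of_real[symmetric] times_complex.sel Im_complex_of_real) simp
    finally show ?thesis by simp
  qed simp
  moreover have "(\<Prod>z\<in>#eigs g. of_real x - z) / det (K x)
       = 1 + (of_real x - 1) * cofactor (K x) 0 0 / det (K x)"
    using dK by (simp add: P field_simps)
  ultimately show "Re ((\<Prod>z\<in>#eigs g. of_real x - z) /
          ((1 - g $$ (0, 0)) * (\<Prod>z\<in>#eigs (schur_reduce m g). of_real x - z))) \<ge> 1"
    by (simp only: K[symmetric]) simp
qed

section \<open>Branches of the logarithm under Schur reduction\<close>

lemma exp_sum_mset: "exp (\<Sum>z\<in>#M. f z) = (\<Prod>z\<in>#M. exp (f z :: 'a :: {banach, real_normed_field}))"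
  by (induction M) (auto simp: exp_add)

lemma continuous_on_sum_mset:
  fixes f :: "'b \<Rightarrow> 'a :: topological_space \<Rightarrow> 'c :: real_normed_vector"
  assumes "\<And>z. z \<in># M \<Longrightarrow> continuous_on S (f z)"
  shows "continuous_on S (\<lambda>x. \<Sum>z\<in>#M. f z x)"
  using assms by (induction M) (auto intro!: continuous_intros)

lemma continuous_on_prod_mset:
  fixes f :: "'b \<Rightarrow> 'a :: topological_space \<Rightarrow> 'c :: real_normed_field"
  assumes "\<And>z. z \<in># M \<Longrightarrow> continuous_on S (f z)"
  shows "continuous_on S (\<lambda>x. \<Prod>z\<in>#M. f z x)"
  using assms by (induction M) (auto intro!: continuous_intros)

text \<open>A continuous function with values in \<open>2 \<pi> \<i> \<int>\<close> on an interval is constant.\<close>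

lemma continuous_log_of_one_constant:
  fixes F :: "real \<Rightarrow> complex"
  assumes cont: "continuous_on {0..1} F" and e: "\<And>r. r \<in> {0..1} \<Longrightarrow> exp (F r) = 1" and "F 0 = 0"
  shows "F 1 = 0"
proof -
  have "F constant_on {0..1}"
  proof (rule continuous_discrete_range_constant[OF connected_Icc cont])
    fix x :: real assume x: "x \<in> {0..1}"
    have "2 * pi \<le> cmod (F y - F x)" if y: "y \<in> {0..1}" and ne: "F y \<noteq> F x" for y
    proof -
      have "exp (F y - F x) = 1" using e[OF x] e[OF y] by (simp add: exp_diff)
      then obtain k :: int where k: "F y - F x = of_real (2 * real_of_int k * pi) * \<i>"
        using exp_eq_1[of "F y - F x"] by (auto simp: complex_eq_iff)
      with ne have "k \<noteq> 0" by auto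
      hence "1 \<le> \<bar>real_of_int k\<bar>" by linarith
      hence "2 * pi * 1 \<le> 2 * pi * \<bar>real_of_int k\<bar>" by (intro mult_left_mono) auto
      thus ?thesis unfolding k by (simp add: norm_mult abs_mult)
    qed
    thus "\<exists>e>0. \<forall>y. y \<in> {0..1} \<and> F y \<noteq> F x \<longrightarrow> e \<le> norm (F y - F x)"
      by (intro exI[of _ "2 * pi"]) auto
  qed
  thus ?thesis using \<open>F 0 = 0\<close> by (auto simp: constant_on_def)
qed

text \<open>Replace \<open>g\<close> by \<open>r g\<close> and the reduced matrix \<open>h\<close> by \<open>r h\<close>. The quotient \<open>\<delta> r\<close> of
\<open>det (1 - r g)\<close> by \<open>(1 - g\<^sub>0\<^sub>0) det (1 - r h)\<close> equals \<open>1\<close> at \<open>r = 1\<close> and stays in the right half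
plane, by \<open>eigs_schur_ratio\<close> with \<open>x = 1/r\<close>. So the difference of the two logarithms minus
\<open>Ln (\<delta> r)\<close> is continuous in \<open>r\<close>, and it can be evaluated at \<open>r = 0\<close>.\<close>

lemma logdet_schur_reduce:
  assumes g: "g \<in> unitary_group (Suc m)" and inv: "1 \<notin># eigs g" and ne: "g $$ (0, 0) \<noteq> 1"
  shows "logdet_one_minus g = Ln (1 - g $$ (0, 0)) + logdet_one_minus (schur_reduce m g)"
proof -
  define h where "h = schur_reduce m g"
  have h: "h \<in> unitary_group m" unfolding h_def by (rule schur_reduce_unitary[OF g ne])
  have gc: "g \<in> carrier_mat (Suc m) (Suc m)" and hc: "h \<in> carrier_mat m m"
    using g h by (auto simp: unitary_group_carrier)
  define a where "a = 1 - g $$ (0, 0)"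
  have a0: "a \<noteq> 0" using ne by (simp add: a_def)
  have Re_a: "Re a > 0"
    using Re_less_1_of_unit_disc[OF unitary_entry_le_1[OF g, of 0 0] ne] by (simp add: a_def)
  note ratio = eigs_schur_ratio[OF g ne _ inv, folded h_def a_def]
  have one: "(\<Prod>z\<in>#eigs g. 1 - z) = a * (\<Prod>z\<in>#eigs h. 1 - z)"
    using ratio(3)[of 1] by simp
  have "(\<Prod>z\<in>#eigs g. 1 - z) \<noteq> 0" using inv by (auto simp: prod_mset_zero_iff)
  hence invh: "1 \<notin># eigs h" using one by (auto simp: prod_mset_zero_iff)
  have pos: "Re (1 - of_real r * z) > 0" if "z \<in># eigs g + eigs h" "r \<in> {0..1}" for r z
    using that eigs_unitary_norm[OF g, of z] eigs_unitary_norm[OF h, of z] inv invh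
    by (intro Re_one_minus_scaled_pos) auto
  have nz: "1 - of_real r * z \<noteq> 0" if "z \<in># eigs g + eigs h" "r \<in> {0..1}" for r z
    using pos[OF that] by (metis order_less_irrefl zero_complex.sel(1))
  have nz': "of_real r * z \<noteq> 1" if "z \<in># eigs g + eigs h" "r \<in> {0..1}" for r z
    using nz[OF that] by auto
  define \<delta> where "\<delta> r = (\<Prod>z\<in>#eigs g. 1 - of_real r * z) / (a * (\<Prod>z\<in>#eigs h. 1 - of_real r * z))"
    for r :: real
  have prod_nz: "(\<Prod>z\<in>#eigs h. 1 - of_real r * z) \<noteq> 0" "(\<Prod>z\<in>#eigs g. 1 - of_real r * z) \<noteq> 0"
    if "r \<in> {0..1}" for r :: real
    using nz'[OF _ that] by (auto simp: prod_mset_zero_iff)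
  have Re_\<delta>: "Re (\<delta> r) > 0" if r: "r \<in> {0..1}" for r
  proof (cases "r = 0")
    case True
    have "Re (1 / a) = Re a / (cmod a)\<^sup>2" by (simp add: Re_divide cmod_power2)
    also have "\<dots> > 0" using Re_a a0 by (intro divide_pos_pos) auto
    finally show ?thesis using True by (simp add: \<delta>_def)
  next
    case False
    hence r0: "r > 0" "1 / r \<ge> 1" using r by auto
    have sc: "(\<Prod>z\<in>#M. 1 - of_real r * z) = of_real r ^ size M * (\<Prod>z\<in>#M. of_real (1 / r) - z)"
      for M :: "complex multiset"
      using False by (induction M) (auto simp: field_simps)
    have "\<delta> r = of_real r * ((\<Prod>z\<in>#eigs g. of_real (1 / r) - z) / (a * (\<Prod>z\<in>#eigs h. of_real (1 / r) - z)))"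
      using False unfolding \<delta>_def sc size_eigs[OF gc] size_eigs[OF hc] by simp
    hence "Re (\<delta> r) = r * Re ((\<Prod>z\<in>#eigs g. of_real (1 / r) - z) / (a * (\<Prod>z\<in>#eigs h. of_real (1 / r) - z)))"
      by (simp only: times_complex.sel Re_complex_of_real Im_complex_of_real mult_zero_left diff_zero)
    also have "\<dots> > 0" using ratio(2)[OF r0(2)] r0 by (intro mult_pos_pos) auto
    finally show ?thesis .
  qed
  define F where "F r = (\<Sum>z\<in>#eigs g. Ln (1 - of_real r * z)) - (\<Sum>z\<in>#eigs h. Ln (1 - of_real r * z))
     - Ln (\<delta> r) - Ln a" for r :: real
  have slit: "z \<notin> \<real>\<^sub>\<le>\<^sub>0" if "Re z > 0" for z using that by (auto simp: complex_nonpos_Reals_iff)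
  have "F 1 = 0"
  proof (rule continuous_log_of_one_constant)
    have "continuous_on {0..1} \<delta>"
      unfolding \<delta>_def using a0 prod_nz
      by (intro continuous_intros continuous_on_prod_mset) auto
    thus "continuous_on {0..1} F"
      unfolding F_def using pos Re_\<delta>
      by (intro continuous_intros continuous_on_sum_mset continuous_on_Ln ballI slit) auto
    show "exp (F r) = 1" if r: "r \<in> {0..1}" for r
    proof -
      have "(\<Prod>z\<in>#M. exp (Ln (1 - of_real r * z))) = (\<Prod>z\<in>#M. 1 - of_real r * z)"
        if "M \<subseteq># eigs g + eigs h" for M
        using that nz[OF _ r] by (intro arg_cong[where f = prod_mset] image_mset_cong)
          (metis exp_Ln mset_subset_eqD)
      note el = this[of "eigs g"] this[of "eigs h"]
      have "\<delta> r \<noteq> 0" using Re_\<delta>[OF r] by auto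
      with el have "exp (F r) = (\<Prod>z\<in>#eigs g. 1 - of_real r * z) / (\<Prod>z\<in>#eigs h. 1 - of_real r * z) / \<delta> r / a"
        using a0 by (simp add: F_def exp_diff exp_sum_mset)
      thus ?thesis using a0 prod_nz[OF r] by (simp add: \<delta>_def)
    qed
    have "Ln (1 / a) = - Ln a"
      using Re_a a0 by (simp add: Ln_inverse slit inverse_eq_divide[symmetric])
    thus "F 0 = 0" by (simp add: F_def \<delta>_def)
  qed
  moreover have "\<delta> 1 = 1" using one a0 prod_nz[of 1] by (simp add: \<delta>_def)
  ultimately show ?thesis
    by (simp add: F_def logdet_one_minus_def eigs_def h_def a_def algebra_simps)
qed

section \<open>Haar matrices do not have the eigenvalue one\<close>

lemma proots_prod_linear: "proots (\<Prod>z\<in>#M. [:- z, 1:]) = (M :: complex multiset)"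
proof (induction M)
  case (add x M)
  have "(\<Prod>z\<in>#M. [:- z, 1:]) \<noteq> 0" by (auto simp: prod_mset_zero_iff)
  moreover have "proots [:- x, 1:] = {#x#}"
    by (intro multiset_eqI) (auto simp: order_linear')
  ultimately show ?case using add by (simp add: proots_mult del: mult_pCons_left)
qed simp

lemma eigs_unique:
  assumes g: "g \<in> carrier_mat n n"
    and eq: "\<And>x. det (mat n n (\<lambda>(i, j). (if i = j then x else 0) - g $$ (i, j))) = (\<Prod>z\<in>#M. x - z)"
  shows "eigs g = M"
proof -
  have pp: "poly (\<Prod>z\<in>#M. [:- z, 1:]) x = (\<Prod>z\<in>#M. x - z)" for M :: "complex multiset" and x
    by (induction M) (auto simp: algebra_simps)
  have "(\<Prod>z\<in>#eigs g. [:- z, 1:]) = (\<Prod>z\<in>#M. [:- z, 1:])"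
    unfolding poly_eq_poly_eq_iff[symmetric] by (rule ext) (simp add: pp eq[symmetric] det_shift_eigs[OF g])
  thus ?thesis by (metis proots_prod_linear)
qed

lemma eigs_smult:
  assumes g: "g \<in> carrier_mat n n" and c: "c \<noteq> 0"
  shows "eigs (c \<cdot>\<^sub>m g) = image_mset (\<lambda>z. c * z) (eigs g)"
proof (rule eigs_unique[where n = n])
  fix x
  have m: "(\<Prod>z\<in>#M. x - c * z) = c ^ size M * (\<Prod>z\<in>#M. x / c - z)" for M
    using c by (induction M) (auto simp: field_simps)
  have "mat n n (\<lambda>(i, j). (if i = j then x else 0) - (c \<cdot>\<^sub>m g) $$ (i, j))
     = c \<cdot>\<^sub>m mat n n (\<lambda>(i, j). (if i = j then x / c else 0) - g $$ (i, j))"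
    using c g by (intro eq_matI) (auto simp: algebra_simps)
  hence "det (mat n n (\<lambda>(i, j). (if i = j then x else 0) - (c \<cdot>\<^sub>m g) $$ (i, j)))
     = (\<Prod>z\<in>#eigs g. x - c * z)"
    using det_shift_eigs[OF g, of "x / c"] m[of "eigs g"] size_eigs[OF g] by simp
  thus "det (mat n n (\<lambda>(i, j). (if i = j then x else 0) - (c \<cdot>\<^sub>m g) $$ (i, j)))
     = (\<Prod>z\<in>#image_mset (\<lambda>z. c * z) (eigs g). x - z)"
    by (simp add: image_mset.compositionality o_def)
qed (use g in auto)

lemma smult_unitary:
  assumes g: "g \<in> unitary_group n" and c: "cmod c = 1"
  shows "c \<cdot>\<^sub>m g \<in> unitary_group n"
  unfolding unitary_group_iff_columns
proof (intro conjI allI impI)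
  fix i j assume ij: "i < n" "j < n"
  have "cnj c * c = 1" using c complex_norm_square[of c] by (simp add: mult.commute)
  hence "cnj (c * x) * (c * y) = cnj x * y" for x y
    by (metis (no_types, opaque_lifting) complex_cnj_mult mult.assoc mult.commute mult_1)
  hence "(\<Sum>k<n. cnj ((c \<cdot>\<^sub>m g) $$ (k, i)) * (c \<cdot>\<^sub>m g) $$ (k, j)) = (\<Sum>k<n. cnj (g $$ (k, i)) * g $$ (k, j))"
    using ij unitary_group_carrier[OF g] by (intro sum.cong) auto
  thus "(\<Sum>k<n. cnj ((c \<cdot>\<^sub>m g) $$ (k, i)) * (c \<cdot>\<^sub>m g) $$ (k, j)) = (if i = j then 1 else 0)"
    using unitary_cols[OF g ij] by simp
qed (use g in \<open>auto simp: unitary_group_carrier\<close>)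

lemma one_unitary: "1\<^sub>m n \<in> unitary_group n"
  unfolding unitary_group_iff_columns by (auto simp: if_distrib cong: if_cong)

lemma measurable_det_one_minus_scaled:
  fixes r :: complex
  shows "(\<lambda>g. \<Prod>z\<in>#eigs g. 1 - r * z) \<in> borel_measurable (unitary_borel n)"
proof -
  have "(\<lambda>g. det (mat n n (\<lambda>(i, j). (if i = j then 1 else 0) - r * g $$ (i, j))))
      \<in> borel_measurable (unitary_borel n)"
    using measurable_unitary_entry[of _ n] by (intro borel_measurable_det[where n = n]) auto
  moreover have "?this \<longleftrightarrow> ?thesis"
    using det_one_minus_scaled_eigs by (intro measurable_cong)
        (simp add: space_unitary_borel unitary_group_carrier)
  ultimately show ?thesis by simp
qed

lemma scaled_eig_iff: "(\<exists>z\<in>#M. r * z = 1) \<longleftrightarrow> (\<Prod>z\<in>#M. 1 - r * z) = (0 :: complex)"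
  by (force simp: prod_mset_zero_iff image_iff)

lemma one_eig_iff: "1 \<in># eigs g \<longleftrightarrow> (\<Prod>z\<in>#eigs g. 1 - 1 * z) = 0"
  using scaled_eig_iff[of "eigs g" 1] by auto

lemma sets_one_eig [measurable]: "{g \<in> unitary_group n. 1 \<in># eigs g} \<in> sets (unitary_borel n)"
proof -
  have "{g \<in> space (unitary_borel n). (\<Prod>z\<in>#eigs g. 1 - 1 * z) = 0} \<in> sets (unitary_borel n)"
    using measurable_det_one_minus_scaled[of 1 n] by measurable
  thus ?thesis by (simp only: one_eig_iff[symmetric] space_unitary_borel)
qed

lemma pred_one_eig: "Measurable.pred (unitary_borel n) (\<lambda>g. 1 \<in># eigs g)"
  using sets_one_eig[of n] unfolding pred_def by (simp add: space_unitary_borel)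

lemma card_set_mset_le_size: "card (set_mset M) \<le> size M"
  by (induction M) (auto simp: card_insert_if)

text \<open>By left invariance under scalars \<open>c\<close> of modulus \<open>1\<close>, every point of the circle is an eigenvalue of
\<open>g\<close> with the same probability \<open>p\<close>. Taking the \<open>K\<close>-th roots of unity, \<open>K p\<close> is an expected number
of distinct eigenvalues, hence at most \<open>n\<close>, for every \<open>K\<close>.\<close>

lemma haar_no_eigenvalue_one:
  assumes H: "haar_unitary n \<mu>"
  shows "AE g in \<mu>. 1 \<notin># eigs g"
proof -
  interpret prob_space \<mu> by (rule haar_prob[OF H])
  have sp: "space \<mu> = unitary_group n" by (rule haar_space[OF H])
  define E where "E c = {g \<in> unitary_group n. \<exists>z\<in>#eigs g. c * z = 1}" for c :: complex
  have E1: "E 1 = {g \<in> unitary_group n. 1 \<in># eigs g}" by (auto simp: E_def)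
  have Em: "E c \<in> sets \<mu>" for c
  proof -
    have "{g \<in> space (unitary_borel n). (\<Prod>z\<in>#eigs g. 1 - c * z) = 0} \<in> sets (unitary_borel n)"
      using measurable_det_one_minus_scaled[of c n] by measurable
    thus ?thesis by (simp add: E_def scaled_eig_iff space_unitary_borel haar_sets[OF H])
  qed
  have Ec: "prob (E c) = prob (E 1)" if c: "cmod c = 1" for c
  proof -
    have U: "c \<cdot>\<^sub>m 1\<^sub>m n \<in> unitary_group n" by (rule smult_unitary[OF one_unitary c])
    have m: "(\<lambda>g. (c \<cdot>\<^sub>m 1\<^sub>m n) * g) \<in> measurable \<mu> \<mu>"
      using measurable_unitary_mult_left[OF U] by (simp add: haar_measurable_cong[OF H])
    have c0: "c \<noteq> 0" using c by auto
    have "(c \<cdot>\<^sub>m 1\<^sub>m n) * g \<in> E 1 \<longleftrightarrow> g \<in> E c" if g: "g \<in> unitary_group n" for g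
    proof -
      have gc: "g \<in> carrier_mat n n" using g by (rule unitary_group_carrier)
      have e: "(c \<cdot>\<^sub>m 1\<^sub>m n) * g = c \<cdot>\<^sub>m g" using gc mult_smult_assoc_mat[of "1\<^sub>m n" n n g n c] by simp
      have "1 \<in># eigs (c \<cdot>\<^sub>m g) \<longleftrightarrow> (\<exists>z\<in>#eigs g. c * z = 1)"
        unfolding eigs_smult[OF gc c0] by (auto simp: image_iff intro: sym)
      thus ?thesis using g smult_unitary[OF g c] unfolding e E1 by (simp add: E_def)
    qed
    moreover have "E c \<subseteq> unitary_group n" by (auto simp: E_def)
    ultimately have "(\<lambda>g. (c \<cdot>\<^sub>m 1\<^sub>m n) * g) -` E 1 \<inter> space \<mu> = E c"
      unfolding sp by blast
    thus ?thesis using measure_distr[OF m Em[of 1]] haar_left[OF H U] by simp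
  qed
  have bound: "real K * prob (E 1) \<le> real n" if K: "K > 0" for K :: nat
  proof -
    define c where "c j = cis (2 * pi * real j / real K)" for j
    have inj: "inj_on c {..<K}"
    proof -
      have "bij_betw (\<lambda>k. cis (2 * pi * real k / real K)) {..<K} {z. z ^ K = 1}"
        by (rule Complex.bij_betw_roots_unity[OF K])
      thus ?thesis by (simp add: bij_betw_def c_def[abs_def])
    qed
    have pc: "prob (E (c j)) = prob (E 1)" for j by (rule Ec) (simp add: c_def)
    have "real K * prob (E 1) = (\<Sum>j<K. prob (E (c j)))" by (simp add: pc)
    also have "\<dots> = (\<Sum>j<K. expectation (indicator (E (c j))))" using Em by simp
    also have "\<dots> = expectation (\<lambda>g. \<Sum>j<K. indicator (E (c j)) g)"
      using Em by (subst Bochner_Integration.integral_sum)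
          (auto intro!: integrable_real_indicator simp: emeasure_eq_measure)
    also have "\<dots> \<le> expectation (\<lambda>g. real n)"
    proof (rule integral_mono)
      show "integrable \<mu> (\<lambda>g. \<Sum>j<K. indicator (E (c j)) g :: real)"
        using Em by (intro Bochner_Integration.integrable_sum integrable_real_indicator)
            (auto simp: emeasure_eq_measure)
      fix g assume "g \<in> space \<mu>"
      hence g: "g \<in> unitary_group n" by (simp add: sp)
      have "(\<Sum>j<K. indicator (E (c j)) g :: real) = real (card {j\<in>{..<K}. g \<in> E (c j)})"
        by (simp add: indicator_def sum.If_cases Int_def)
      also have "card {j\<in>{..<K}. g \<in> E (c j)} = card (c ` {j\<in>{..<K}. g \<in> E (c j)})"
        by (rule card_image[symmetric], rule inj_on_subset[OF inj]) auto
      also have "\<dots> \<le> card (inverse ` set_mset (eigs g))"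
      proof (rule card_mono)
        show "c ` {j \<in> {..<K}. g \<in> E (c j)} \<subseteq> inverse ` set_mset (eigs g)"
        proof safe
          fix j assume "g \<in> E (c j)"
          then obtain z where z: "z \<in># eigs g" "c j * z = 1" by (auto simp: E_def)
          hence "c j = inverse z" by (metis inverse_unique mult.commute)
          thus "c j \<in> inverse ` set_mset (eigs g)" using z by blast
        qed
      qed simp
      also have "\<dots> \<le> card (set_mset (eigs g))" by (rule card_image_le) simp
      also have "\<dots> \<le> size (eigs g)" by (rule card_set_mset_le_size) 
      also have "\<dots> = n" using size_eigs[OF unitary_group_carrier[OF g]] .
      finally show "(\<Sum>j<K. indicator (E (c j)) g) \<le> real n" by simp
    qed simp
    also have "\<dots> = real n" by (simp add: prob_space)
    finally show ?thesis .
  qed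
  have "prob (E 1) = 0"
  proof (rule ccontr)
    assume "prob (E 1) \<noteq> 0"
    hence p: "prob (E 1) > 0" by (simp add: zero_less_measure_iff)
    obtain K :: nat where "real n / prob (E 1) < real K" using reals_Archimedean2 by blast
    hence "real n < real K * prob (E 1)" using p by (simp add: field_simps)
    moreover from this have "K > 0" by (cases K) auto
    ultimately show False using bound[of K] by simp
  qed
  hence "E 1 \<in> null_sets \<mu>" using Em by (simp add: null_sets_def emeasure_eq_measure)
  hence "AE g in \<mu>. g \<notin> E 1" by (rule AE_not_in)
  thus ?thesis using AE_space by eventually_elim (auto simp: E1 sp)
qed

text \<open>If the corner entry is \<open>1\<close>, the rest of the first row is \<open>0\<close> and \<open>1 - g\<close> has a zero row.\<close>

lemma no_eigenvalue_one_corner: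
  assumes g: "g \<in> unitary_group (Suc m)" and inv: "1 \<notin># eigs g"
  shows "g $$ (0, 0) \<noteq> 1"
proof
  assume 1: "g $$ (0, 0) = 1"
  have gc: "g \<in> carrier_mat (Suc m) (Suc m)" using g by (rule unitary_group_carrier)
  have "(\<Sum>k<m. (cmod (g $$ (0, Suc k)))\<^sup>2) = 0"
    using unitary_row_norm[OF g, of 0] 1 by (simp add: sum.lessThan_Suc_shift)
  hence z: "g $$ (0, Suc k) = 0" if "k < m" for k
    using that by (subst (asm) sum_nonneg_eq_0_iff) auto
  let ?A = "mat (Suc m) (Suc m) (\<lambda>(i, j). (if i = j then 1 else 0) - g $$ (i, j))"
  have Ac: "?A \<in> carrier_mat (Suc m) (Suc m)" by simp
  have "det ?A = (\<Sum>j<Suc m. ?A $$ (0, j) * cofactor ?A 0 j)"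
    by (rule laplace_expansion_row[OF Ac]) simp
  also have "\<dots> = 0"
  proof (rule sum.neutral, safe)
    fix j assume "j < Suc m"
    thus "?A $$ (0, j) * cofactor ?A 0 j = 0" using z 1 by (cases j) auto
  qed
  finally have "(\<Prod>z\<in>#eigs g. 1 - z) = 0" using det_shift_eigs[OF gc, of 1] by simp
  thus False using inv by (auto simp: prod_mset_zero_iff)
qed

section \<open>Measurability of the logarithm\<close>

lemma measurable_schur_reduce:
  "schur_reduce m \<in> measurable (unitary_borel (Suc m)) (unitary_borel m)"
proof (rule measurable_into_unitary)
  fix g assume "g \<in> space (unitary_borel (Suc m))"
  thus "schur_reduce m g \<in> unitary_group m"
    using schur_reduce_unitary[of g m] one_unitary
    by (cases "g $$ (0, 0) = 1") (auto simp: space_unitary_borel schur_reduce_def)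
next
  fix i j assume ij: "i < m" "j < m"
  note e = measurable_unitary_entry[of _ "Suc m"]
  have [measurable]: "(\<lambda>g. g $$ (0, 0)) \<in> borel_measurable (unitary_borel (Suc m))"
    "(\<lambda>g. g $$ (Suc i, Suc j)) \<in> borel_measurable (unitary_borel (Suc m))"
    "(\<lambda>g. g $$ (Suc i, 0)) \<in> borel_measurable (unitary_borel (Suc m))"
    "(\<lambda>g. g $$ (0, Suc j)) \<in> borel_measurable (unitary_borel (Suc m))"
    using ij by (auto intro!: e)
  have "schur_reduce m g $$ (i, j) = (if g $$ (0, 0) = 1 then 1\<^sub>m m $$ (i, j) else
     g $$ (Suc i, Suc j) + g $$ (Suc i, 0) * g $$ (0, Suc j) / (1 - g $$ (0, 0)))" for g
    using ij by (simp add: schur_reduce_def)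
  thus "(\<lambda>g. schur_reduce m g $$ (i, j)) \<in> borel_measurable (unitary_borel (Suc m))"
    by (simp only:) measurable
qed

lemma no_eigenvalue_one_schur_reduce:
  assumes g: "g \<in> unitary_group (Suc m)" and inv: "1 \<notin># eigs g"
  shows "1 \<notin># eigs (schur_reduce m g)"
proof -
  have "(\<Prod>z\<in>#eigs (schur_reduce m g). of_real 1 - z) \<noteq> 0"
    by (rule eigs_schur_ratio(1)[OF g no_eigenvalue_one_corner[OF g inv] _ inv]) simp
  thus ?thesis by (auto simp: prod_mset_zero_iff)
qed

lemma borel_measurable_Ln [measurable]: "Ln \<in> borel_measurable borel"
proof -
  have neg: "(\<lambda>z. complex_of_real (ln (- Re z)) + \<i> * of_real pi) \<in> borel_measurable borel"
    by measurable
  have "continuous_on (- \<real>\<^sub>\<le>\<^sub>0) Ln" by (intro continuous_intros) auto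
  hence pos: "(\<lambda>z. if z \<in> \<real>\<^sub>\<le>\<^sub>0 then 0 else Ln z) \<in> borel_measurable borel"
    by (intro borel_measurable_continuous_on_if) (auto simp: closed_nonpos_Reals_complex)
  have "(\<lambda>z. if z = 0 then Ln 0 else if z \<in> \<real>\<^sub>\<le>\<^sub>0 then complex_of_real (ln (- Re z)) + \<i> * of_real pi
      else (if z \<in> \<real>\<^sub>\<le>\<^sub>0 then 0 else Ln z)) \<in> borel_measurable borel"
    by (intro measurable_If neg pos borel_measurable_const)
        (auto simp: closed_nonpos_Reals_complex pred_def[symmetric])
  moreover have "Ln z = of_real (ln (- Re z)) + \<i> * of_real pi" if "z \<noteq> 0" "z \<in> \<real>\<^sub>\<le>\<^sub>0" for z
  proof -
    from that have z: "Im z = 0" "Re z < 0"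
      by (auto simp: complex_nonpos_Reals_iff complex_eq_iff less_le)
    hence "z = - of_real (- Re z)" by (simp add: complex_eq_iff)
    also have "Ln \<dots> = Ln (of_real (- Re z)) + \<i> * of_real pi"
      using z by (subst Ln_minus) auto
    also have "Ln (of_real (- Re z)) = of_real (ln (- Re z))"
      using z by (intro Ln_of_real) auto
    finally show ?thesis .
  qed
  hence "(\<lambda>z. if z = 0 then Ln 0 else if z \<in> \<real>\<^sub>\<le>\<^sub>0 then complex_of_real (ln (- Re z)) + \<i> * of_real pi
      else (if z \<in> \<real>\<^sub>\<le>\<^sub>0 then 0 else Ln z)) = Ln"
    by (intro ext) auto
  ultimately show ?thesis by simp
qed

text \<open>Off the eigenvalue \<open>1\<close>, the Schur reduction gives the logarithm by recursion on the size.\<close>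

lemma measurable_logdet_regular:
  "(\<lambda>g. if 1 \<in># eigs g then 0 else logdet_one_minus g) \<in> borel_measurable (unitary_borel n)"
proof (induction n)
  case 0
  have "eigs g = {#}" if "g \<in> unitary_group 0" for g
    using size_eigs[OF unitary_group_carrier[OF that]] by simp
  hence "(\<lambda>g. if 1 \<in># eigs g then 0 else logdet_one_minus g) \<in> borel_measurable (unitary_borel 0) \<longleftrightarrow>
    (\<lambda>g. 0 :: complex) \<in> borel_measurable (unitary_borel 0)"
    by (intro measurable_cong) (simp add: space_unitary_borel logdet_one_minus_def eigs_def)
  thus ?case by simp
next
  case (Suc m)
  let ?L = "\<lambda>g. if 1 \<in># eigs g then 0 else logdet_one_minus g"
  have [measurable]: "(\<lambda>g. g $$ (0, 0)) \<in> borel_measurable (unitary_borel (Suc m))"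
    by (rule measurable_unitary_entry) auto
  have [measurable]: "(\<lambda>g. ?L (schur_reduce m g)) \<in> borel_measurable (unitary_borel (Suc m))"
    by (rule measurable_compose[OF measurable_schur_reduce Suc])
  have [measurable]: "(\<lambda>g. Ln (1 - g $$ (0, 0))) \<in> borel_measurable (unitary_borel (Suc m))"
    by measurable
  note [measurable] = sets_one_eig[of "Suc m"]
  have [measurable]: "Measurable.pred (unitary_borel (Suc m)) (\<lambda>g. 1 \<in># eigs g)" by (rule pred_one_eig)
  have "(\<lambda>g. if 1 \<in># eigs g then 0 else Ln (1 - g $$ (0, 0)) + ?L (schur_reduce m g))
      \<in> borel_measurable (unitary_borel (Suc m))"
    using pred_one_eig[of "Suc m"]
    by (intro measurable_If borel_measurable_add borel_measurable_const \<open>(\<lambda>g. ?L (schur_reduce m g)) \<in> _\<close>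
      \<open>(\<lambda>g. Ln (1 - g $$ (0, 0))) \<in> _\<close>) (simp add: pred_def)
  moreover have "?L g = (if 1 \<in># eigs g then 0 else Ln (1 - g $$ (0, 0)) + ?L (schur_reduce m g))"
    if "g \<in> space (unitary_borel (Suc m))" for g
    using that logdet_schur_reduce[of g m] no_eigenvalue_one_corner[of g m]
      no_eigenvalue_one_schur_reduce[of g m] by (simp add: space_unitary_borel)
  ultimately show ?case by (subst measurable_cong) auto
qed

text \<open>The multiplicity of the eigenvalue \<open>1\<close> is the order of vanishing of the determinant at \<open>r = 1\<close>.\<close>

lemma count_one_limit:
  assumes "\<And>z. z \<in># M \<Longrightarrow> cmod z = 1"
  shows "(\<lambda>j. ln (cmod (\<Prod>z\<in>#M. 1 - of_real (1 - 1 / real (j + 2)) * z)) / ln (1 / real (j + 2)))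
           \<longlonglongrightarrow> real (count M 1)"
  using assms
proof (induction M)
  case (add x M)
  define r where "r j = 1 - 1 / real (j + 2)" for j
  have r: "0 < r j" "r j < 1" for j by (auto simp: r_def)
  have nz: "1 - of_real (r j) * z \<noteq> 0" if "cmod z = 1" for j z
  proof
    assume "1 - of_real (r j) * z = 0"
    hence "cmod (of_real (r j) * z) = 1" by simp
    thus False using r[of j] that by (simp add: norm_mult)
  qed
  have nzM: "(\<Prod>z\<in>#M. 1 - of_real (r j) * z) \<noteq> 0" for j
    using nz[of _ j] add.prems by (auto simp: prod_mset_zero_iff)
  have lim_r: "r \<longlonglongrightarrow> 1" unfolding r_def by real_asymp
  have x: "(\<lambda>j. ln (cmod (1 - of_real (r j) * x)) / ln (1 / real (j + 2))) \<longlonglongrightarrow> (if x = 1 then 1 else 0)"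
  proof (cases "x = 1")
    case True
    have "cmod (1 - of_real (r j) * x) = 1 / real (j + 2)" for j
    proof -
      have "1 - of_real (r j) * x = of_real (1 / real (j + 2))" using True by (simp add: r_def)
      thus ?thesis by (simp only: norm_of_real) simp
    qed
    thus ?thesis using True by simp
  next
    case False
    have "(\<lambda>j. ln (cmod (1 - of_real (r j) * x))) \<longlonglongrightarrow> ln (cmod (1 - of_real 1 * x))"
      using False by (intro tendsto_intros lim_r) auto
    moreover have "filterlim (\<lambda>j. ln (1 / real (j + 2))) at_bot sequentially" by real_asymp
    ultimately have "(\<lambda>j. ln (cmod (1 - of_real (r j) * x)) / ln (1 / real (j + 2))) \<longlonglongrightarrow> 0"
      by (intro tendsto_divide_0[where c = "ln (cmod (1 - of_real 1 * x))"] filterlim_at_bot_imp_at_infinity)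
    thus ?thesis using False by simp
  qed
  have "(\<lambda>j. ln (cmod (1 - of_real (r j) * x)) / ln (1 / real (j + 2)) +
      ln (cmod (\<Prod>z\<in>#M. 1 - of_real (r j) * z)) / ln (1 / real (j + 2)))
     \<longlonglongrightarrow> (if x = 1 then 1 else 0) + real (count M 1)"
    using add by (intro tendsto_add x) (auto simp: r_def)
  moreover have "ln (cmod (\<Prod>z\<in>#add_mset x M. 1 - of_real (r j) * z))
     = ln (cmod (1 - of_real (r j) * x)) + ln (cmod (\<Prod>z\<in>#M. 1 - of_real (r j) * z))" for j
    using nz[of x j] nzM[of j] add.prems by (simp add: norm_mult ln_mult)
  ultimately show ?case by (simp add: r_def add_divide_distrib add.commute split: if_splits)
qed simp

lemma measurable_count_one: "(\<lambda>g. real (count (eigs g) 1)) \<in> borel_measurable (unitary_borel n)"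
proof (rule borel_measurable_LIMSEQ_real)
  fix g assume "g \<in> space (unitary_borel n)"
  thus "(\<lambda>j. ln (cmod (\<Prod>z\<in>#eigs g. 1 - of_real (1 - 1 / real (j + 2)) * z)) / ln (1 / real (j + 2)))
           \<longlonglongrightarrow> real (count (eigs g) 1)"
    using eigs_unitary_norm by (intro count_one_limit) (auto simp: space_unitary_borel)
next
  fix j
  note [measurable] = measurable_det_one_minus_scaled[of "of_real (1 - 1 / real (j + 2))" n]
  show "(\<lambda>g. ln (cmod (\<Prod>z\<in>#eigs g. 1 - of_real (1 - 1 / real (j + 2)) * z)) / ln (1 / real (j + 2)))
    \<in> borel_measurable (unitary_borel n)" by measurable
qed

text \<open>On the matrices with eigenvalue \<open>1\<close> the logarithm is recovered from rotated matrices. The terms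
\<open>Ln (1 - c)\<close> that come from the eigenvalue \<open>1\<close> diverge as \<open>c\<close> tends to \<open>1\<close> and have to be exchanged
for \<open>Ln 0\<close>, as many times as the multiplicity of that eigenvalue.\<close>

lemma logdet_rotation_limit:
  assumes "\<And>z. z \<in># M \<Longrightarrow> cmod z = 1" and c: "c \<longlonglongrightarrow> 1"
  shows "(\<lambda>j. (\<Sum>z\<in>#M. Ln (1 - c j * z)) - of_nat (count M 1) * (Ln (1 - c j) - Ln 0)) \<longlonglongrightarrow> (\<Sum>z\<in>#M. Ln (1 - z))"
  using assms(1)
proof (induction M)
  case (add x M)
  have IH: "(\<lambda>j. (\<Sum>z\<in>#M. Ln (1 - c j * z)) - of_nat (count M 1) * (Ln (1 - c j) - Ln 0))
      \<longlonglongrightarrow> (\<Sum>z\<in>#M. Ln (1 - z))"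
    using add by auto
  show ?case
  proof (cases "x = 1")
    case True
    thus ?thesis using tendsto_add[OF tendsto_const[of "Ln 0"] IH] by (simp add: algebra_simps)
  next
    case False
    have "Re (1 - x) > 0" using Re_less_1_of_unit_disc[of x] add.prems[of x] False by simp
    hence "(\<lambda>j. Ln (1 - c j * x)) \<longlonglongrightarrow> Ln (1 - 1 * x)"
      using c by (intro tendsto_intros) (auto simp: complex_nonpos_Reals_iff)
    from tendsto_add[OF this IH] show ?thesis using False by (simp add: algebra_simps)
  qed
qed simp

lemma measurable_logdet: "logdet_one_minus \<in> borel_measurable (unitary_borel n)"
proof -
  define c where "c j = cis (1 / real (Suc j))" for j
  have c1: "cmod (c j) = 1" for j by (simp add: c_def)
  have c_inj: "inj c"
  proof (rule injI)
    fix i j assume eq: "c i = c j"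
    have "1 / real (Suc k) \<in> {-pi<..pi}" for k
    proof -
      have "0 < 1 / real (Suc k)" "1 / real (Suc k) \<le> 1" by simp_all
      thus ?thesis unfolding greaterThanAtMost_iff using pi_gt3 by linarith
    qed
    hence "Arg (c k) = 1 / real (Suc k)" for k
      unfolding c_def by (intro Arg_cis) auto
    with eq have "1 / real (Suc i) = 1 / real (Suc j)" by metis
    thus "i = j" by simp
  qed
  have clim: "c \<longlonglongrightarrow> 1"
  proof -
    have "(\<lambda>j. cis (1 / real (Suc j))) \<longlonglongrightarrow> cis 0"
      by (intro tendsto_cis) (rule LIMSEQ_inverse_real_of_nat[unfolded inverse_eq_divide])
    thus ?thesis by (simp add: c_def[abs_def])
  qed
  let ?L = "\<lambda>g. if 1 \<in># eigs g then 0 else logdet_one_minus g"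
  have mL: "(\<lambda>g. ?L (c j \<cdot>\<^sub>m g)) \<in> borel_measurable (unitary_borel n)" for j
  proof -
    have U: "c j \<cdot>\<^sub>m 1\<^sub>m n \<in> unitary_group n" by (rule smult_unitary[OF one_unitary c1])
    have "(\<lambda>g. ?L ((c j \<cdot>\<^sub>m 1\<^sub>m n) * g)) \<in> borel_measurable (unitary_borel n)"
      by (rule measurable_compose[OF measurable_unitary_mult_left[OF U] measurable_logdet_regular])
    moreover have "(c j \<cdot>\<^sub>m 1\<^sub>m n) * g = c j \<cdot>\<^sub>m g" if "g \<in> space (unitary_borel n)" for g
      using that unitary_group_carrier[of g n] mult_smult_assoc_mat[of "1\<^sub>m n" n n g n "c j"]
      by (simp add: space_unitary_borel)
    ultimately show ?thesis by (subst (asm) measurable_cong[where g = "\<lambda>g. ?L (c j \<cdot>\<^sub>m g)"]) auto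
  qed
  note [measurable] = mL measurable_count_one[of n]
  show ?thesis
  proof (rule borel_measurable_LIMSEQ_metric)
    show "(\<lambda>g. ?L (c j \<cdot>\<^sub>m g) - of_real (real (count (eigs g) 1)) * (Ln (1 - c j) - Ln 0))
        \<in> borel_measurable (unitary_borel n)" for j
      by measurable
    fix g assume "g \<in> space (unitary_borel n)"
    hence g: "g \<in> unitary_group n" by (simp add: space_unitary_borel)
    hence gc: "g \<in> carrier_mat n n" by (rule unitary_group_carrier)
    have fin: "finite {j. \<exists>z\<in>#eigs g. c j * z = 1}"
    proof (rule finite_subset)
      show "{j. \<exists>z\<in>#eigs g. c j * z = 1} \<subseteq> c -` (inverse ` set_mset (eigs g))"
      proof safe
        fix j z assume z: "z \<in># eigs g" "c j * z = 1"
        hence "c j = inverse z" by (metis inverse_unique mult.commute)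
        thus "j \<in> c -` (inverse ` set_mset (eigs g))" using z by blast
      qed
      show "finite (c -` (inverse ` set_mset (eigs g)))"
        by (rule finite_vimageI[OF _ c_inj]) simp
    qed
    have "\<forall>\<^sub>F j in sequentially. \<not> (\<exists>z\<in>#eigs g. c j * z = 1)"
      using fin unfolding cofinite_eq_sequentially[symmetric] eventually_cofinite by simp
    hence "\<forall>\<^sub>F j in sequentially. (\<Sum>z\<in>#eigs g. Ln (1 - c j * z)) - of_nat (count (eigs g) 1)
        * (Ln (1 - c j) - Ln 0)
       = ?L (c j \<cdot>\<^sub>m g) - of_real (real (count (eigs g) 1)) * (Ln (1 - c j) - Ln 0)"
    proof eventually_elim
      case (elim j)
      have cj: "c j \<noteq> 0" using c1[of j] by auto
      have "1 \<notin># eigs (c j \<cdot>\<^sub>m g)" using elim unfolding eigs_smult[OF gc cj] by force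
      moreover have "logdet_one_minus (c j \<cdot>\<^sub>m g) = (\<Sum>z\<in>#eigs g. Ln (1 - c j * z))"
        by (simp add: logdet_one_minus_def eigs_def[symmetric] eigs_smult[OF gc cj]
            image_mset.compositionality o_def)
      ultimately show ?case by simp
    qed
    moreover have "(\<lambda>j. (\<Sum>z\<in>#eigs g. Ln (1 - c j * z)) - of_nat (count (eigs g) 1)
        * (Ln (1 - c j) - Ln 0)) \<longlonglongrightarrow> logdet_one_minus g"
      unfolding logdet_one_minus_def eigs_def[symmetric]
      by (rule logdet_rotation_limit[OF eigs_unitary_norm[OF g] clim])
    ultimately show "(\<lambda>j. ?L (c j \<cdot>\<^sub>m g) - of_real (real (count (eigs g) 1)) * (Ln (1 - c j) - Ln 0))
        \<longlonglongrightarrow> logdet_one_minus g"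
      using Lim_transform_eventually by fast
  qed
qed

section \<open>Rotation-invariant variables in the unit disc\<close>

lemma borel_measurable_cis [measurable]: "cis \<in> borel_measurable borel"
  by (intro borel_measurable_continuous_onI continuous_intros)

lemma borel_measurable_cnj [measurable]: "cnj \<in> borel_measurable borel"
  by (intro borel_measurable_continuous_onI continuous_intros)

locale rotation_invariant_disc = prob_space D for D :: "complex measure" +
  assumes sets_D [measurable_cong]: "sets D = sets borel"
    and disc: "AE z in D. cmod z \<le> 1"
    and rotation: "\<And>c. cmod c = 1 \<Longrightarrow> distr D borel (\<lambda>z. c * z) = D"
begin

lemma integral_rotate:
  fixes f :: "complex \<Rightarrow> complex"
  assumes c: "cmod c = 1" and f: "f \<in> borel_measurable borel"
  shows "(\<integral>z. f (c * z) \<partial>D) = (\<integral>z. f z \<partial>D)"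
proof -
  have "(\<lambda>z. c * z) \<in> measurable D borel" by measurable
  from integral_distr[OF this f] show ?thesis by (simp only: rotation[OF c])
qed

lemma integrable_monomial: "integrable D (\<lambda>z. z ^ j * cnj z ^ l)"
proof (rule integrable_const_bound[where B = 1])
  show "AE z in D. cmod (z ^ j * cnj z ^ l) \<le> 1"
    using disc by eventually_elim (simp add: norm_mult norm_power mult_le_one power_le_one)
qed measurable

lemma moment_off_diagonal:
  assumes "j \<noteq> l"
  shows "(\<integral>z. z ^ j * cnj z ^ l \<partial>D) = 0"
proof -
  \<comment> \<open>the rotation for which the moment changes its sign\<close>
  define c where "c = cis (pi / (real j - real l))"
  have c1: "cmod c = 1" by (simp add: c_def)
  have "c ^ j * cnj c ^ l = cis (real j * (pi / (real j - real l)) - real l * (pi / (real j - real l)))"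
    by (simp add: c_def Complex.DeMoivre cis_cnj cis_mult)
  also have "real j * (pi / (real j - real l)) - real l * (pi / (real j - real l)) = pi"
    unfolding left_diff_distrib[symmetric] using assms by simp
  finally have c: "c ^ j * cnj c ^ l = -1" by simp
  have "(\<integral>z. z ^ j * cnj z ^ l \<partial>D) = (\<integral>z. (c * z) ^ j * cnj (c * z) ^ l \<partial>D)"
    by (rule integral_rotate[OF c1, symmetric]) measurable
  also have "\<dots> = (\<integral>z. (c ^ j * cnj c ^ l) * (z ^ j * cnj z ^ l) \<partial>D)"
    by (simp add: power_mult_distrib mult_ac)
  also have "\<dots> = - (\<integral>z. z ^ j * cnj z ^ l \<partial>D)" unfolding c by simp
  finally show ?thesis by simp
qed

lemma integrable_norm_power: "integrable D (\<lambda>z. cmod z ^ k)"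
proof (rule integrable_const_bound[where B = 1])
  show "AE z in D. norm (cmod z ^ k) \<le> 1"
    using disc by eventually_elim (simp add: power_le_one)
qed measurable

lemma moment_holomorphic: "j > 0 \<Longrightarrow> (\<integral>z. z ^ j \<partial>D) = 0"
  using moment_off_diagonal[of j 0] by simp

text \<open>The monomials are orthogonal, because a rotation multiplies the off-diagonal moments by \<open>-1\<close>.\<close>

lemma parseval:
  assumes A: "finite A"
  shows "(\<integral>z. (cmod (\<Sum>j\<in>A. a j * z ^ j))\<^sup>2 \<partial>D) = (\<Sum>j\<in>A. (cmod (a j))\<^sup>2 * (\<integral>z. cmod z ^ (2 * j) \<partial>D))"
proof -
  have int: "integrable D (\<lambda>z. a j * cnj (a l) * (z ^ j * cnj z ^ l))" for j l
    using integrable_monomial by simp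
  have "complex_of_real (\<integral>z. (cmod (\<Sum>j\<in>A. a j * z ^ j))\<^sup>2 \<partial>D)
      = (\<integral>z. complex_of_real ((cmod (\<Sum>j\<in>A. a j * z ^ j))\<^sup>2) \<partial>D)"
    by (rule integral_complex_of_real[symmetric])
  also have "\<dots> = (\<integral>z. (\<Sum>j\<in>A. \<Sum>l\<in>A. a j * cnj (a l) * (z ^ j * cnj z ^ l)) \<partial>D)"
    by (intro Bochner_Integration.integral_cong refl)
       (simp only: complex_norm_square cnj_sum complex_cnj_mult complex_cnj_power sum_product, simp
           only: mult_ac)
  also have "\<dots> = (\<Sum>j\<in>A. \<Sum>l\<in>A. a j * cnj (a l) * (\<integral>z. z ^ j * cnj z ^ l \<partial>D))"
    using int by (simp add: Bochner_Integration.integral_sum Bochner_Integration.integrable_sum)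
  also have "\<dots> = (\<Sum>j\<in>A. \<Sum>l\<in>A. if l = j then a j * cnj (a j) * (\<integral>z. z ^ j * cnj z ^ j \<partial>D) else 0)"
    using moment_off_diagonal by (intro sum.cong refl) auto
  also have "\<dots> = (\<Sum>j\<in>A. a j * cnj (a j) * (\<integral>z. z ^ j * cnj z ^ j \<partial>D))"
    using A by simp
  also have "(\<integral>z. z ^ j * cnj z ^ j \<partial>D) = complex_of_real (\<integral>z. cmod z ^ (2 * j) \<partial>D)" for j
  proof -
    have "z ^ j * cnj z ^ j = complex_of_real (cmod z ^ (2 * j))" for z
      using complex_norm_square[of z] by (simp add: power_mult power_mult_distrib[symmetric])
    thus ?thesis by (simp only: integral_complex_of_real)
  qed
  hence "(\<Sum>j\<in>A. a j * cnj (a j) * (\<integral>z. z ^ j * cnj z ^ j \<partial>D))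
      = complex_of_real (\<Sum>j\<in>A. (cmod (a j))\<^sup>2 * (\<integral>z. cmod z ^ (2 * j) \<partial>D))"
    by (simp add: complex_norm_square del: of_real_power)
  finally show ?thesis using of_real_eq_iff by blast
qed

text \<open>The averages of \<open>z ^ j\<close> over \<open>j < N\<close> equal \<open>1\<close> at \<open>z = 1\<close>, while their mean square is at most
\<open>1 / N\<close> by orthogonality.\<close>

lemma no_atom_at_one: "AE z in D. z \<noteq> 1"
proof -
  have bound: "prob {1} \<le> 1 / real N" if N: "N > 0" for N :: nat
  proof -
    have N0: "real N > 0" using N by simp
    have "prob {1} = (\<integral>z. indicator {1} z \<partial>D)" by (simp add: sets_D)
    also have "\<dots> \<le> (\<integral>z. (cmod (\<Sum>j<N. 1 / of_nat N * z ^ j))\<^sup>2 \<partial>D)"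
    proof (rule integral_mono_AE')
      show "integrable D (\<lambda>z. (cmod (\<Sum>j<N. 1 / of_nat N * z ^ j))\<^sup>2)"
      proof (rule integrable_const_bound[where B = 1])
        show "AE z in D. norm ((cmod (\<Sum>j<N. 1 / of_nat N * z ^ j))\<^sup>2) \<le> 1"
          using disc
        proof eventually_elim
          case (elim z)
          have "cmod (\<Sum>j<N. 1 / of_nat N * z ^ j) \<le> (\<Sum>j<N. cmod (1 / of_nat N * z ^ j))"
            by (rule norm_sum)
          also have "\<dots> \<le> (\<Sum>j<N. 1 / real N)"
            using elim N by (intro sum_mono)
                (simp add: norm_mult norm_divide norm_power power_le_one divide_le_cancel)
          also have "\<dots> = 1" using N by simp
          finally show ?case by (simp add: power_le_one)
        qed
      qed measurable
      show "AE z in D. indicator {1} z \<le> (cmod (\<Sum>j<N. 1 / of_nat N * z ^ j))\<^sup>2"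
        using N by (intro AE_I2) (auto simp: indicator_def)
    qed auto
    also have "\<dots> = (\<Sum>j<N. (cmod (1 / of_nat N))\<^sup>2 * (\<integral>z. cmod z ^ (2 * j) \<partial>D))"
      by (rule parseval) simp
    also have "\<dots> \<le> (\<Sum>j<N. (1 / real N)\<^sup>2 * 1)"
    proof (intro sum_mono mult_mono)
      fix j
      have "(\<integral>z. cmod z ^ (2 * j) \<partial>D) \<le> (\<integral>z. 1 \<partial>D)"
        by (rule integral_mono_AE[OF integrable_norm_power]) (use disc in \<open>auto simp: power_le_one\<close>)
      thus "(\<integral>z. cmod z ^ (2 * j) \<partial>D) \<le> 1" by (simp add: prob_space)
    qed (auto simp: norm_divide)
    also have "\<dots> = 1 / real N" using N by (simp add: power2_eq_square)
    finally show ?thesis .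
  qed
  have "prob {1} \<le> 0"
  proof (rule ccontr)
    assume "\<not> prob {1} \<le> 0"
    hence p: "prob {1} > 0" by simp
    then obtain N :: nat where N: "N > 0" "inverse (real N) < prob {1}"
      using ex_inverse_of_nat_less by blast
    thus False using bound[of N] by (simp add: inverse_eq_divide)
  qed
  hence "prob {1} = 0" using measure_nonneg[of D "{1}"] by linarith
  hence "{1} \<in> null_sets D" by (auto simp: null_sets_def emeasure_eq_measure sets_D)
  from AE_not_in[OF this] show ?thesis by simp
qed

end

lemma (in sigma_finite_measure) nn_integral_fatou_bound:
  fixes f :: "nat \<Rightarrow> 'a \<Rightarrow> ennreal"
  assumes [measurable]: "\<And>n. f n \<in> borel_measurable M" 
    and lim: "AE x in M. (\<lambda>n. f n x) \<longlonglongrightarrow> g x"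
    and bound: "\<And>n. (\<integral>\<^sup>+x. f n x \<partial>M) \<le> C"
  shows "(\<integral>\<^sup>+x. g x \<partial>M) \<le> C"
proof -
  have "(\<integral>\<^sup>+x. g x \<partial>M) = (\<integral>\<^sup>+x. liminf (\<lambda>n. f n x) \<partial>M)"
  proof (rule nn_integral_cong_AE)
    show "AE x in M. g x = liminf (\<lambda>n. f n x)"
      using lim by eventually_elim (simp add: lim_imp_Liminf)
  qed
  also have "\<dots> \<le> liminf (\<lambda>n. \<integral>\<^sup>+x. f n x \<partial>M)"
    by (rule nn_integral_liminf) fact
  also have "\<dots> \<le> limsup (\<lambda>n. \<integral>\<^sup>+x. f n x \<partial>M)"
    by (rule Liminf_le_Limsup) simp
  also have "\<dots> \<le> C" by (intro Limsup_bounded always_eventually allI bound)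
  finally show ?thesis .
qed

text \<open>The remainder of the power series of \<open>- Ln (1 - z)\<close> from degree \<open>m\<close> on. It is written with \<open>Ln\<close>
so that it makes sense on the unit circle, where the series need not converge absolutely.\<close>

definition log_tail :: "nat \<Rightarrow> complex \<Rightarrow> complex" where
  "log_tail m z = - Ln (1 - z) - (\<Sum>j=1..<m. z ^ j / of_nat j)"

lemma measurable_log_tail [measurable]: "log_tail m \<in> borel_measurable borel"
proof -
  have "(\<lambda>z. - Ln (1 - z) - (\<Sum>j=1..<m. z ^ j / of_nat j)) \<in> borel_measurable borel" by measurable
  thus ?thesis by (simp add: log_tail_def[abs_def])
qed

lemma log_tail_series:
  assumes z: "cmod z < 1" and m: "m \<ge> 1"
  shows "(\<lambda>N. \<Sum>j=m..<N. z ^ j / of_nat j) \<longlonglongrightarrow> log_tail m z"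
proof -
  have "(\<lambda>n. - ((z ^ n) / of_nat n)) sums Ln (1 - z)"
    using Ln_series'[of "- z"] z by simp
  hence "(\<lambda>n. z ^ n / of_nat n) sums (- Ln (1 - z))"
    using sums_minus by fastforce
  hence "(\<lambda>N. (\<Sum>n<N. z ^ n / of_nat n)) \<longlonglongrightarrow> - Ln (1 - z)" by (simp add: sums_def)
  from tendsto_diff[OF this tendsto_const[of "\<Sum>j=1..<m. z ^ j / of_nat j"]]
  have "(\<lambda>N. (\<Sum>n<N. z ^ n / of_nat n) - (\<Sum>j=1..<m. z ^ j / of_nat j)) \<longlonglongrightarrow> log_tail m z"
    by (simp add: log_tail_def)
  moreover have "\<forall>\<^sub>F N in sequentially. (\<Sum>n<N. z ^ n / of_nat n) - (\<Sum>j=1..<m. z ^ j / of_nat j)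
      = (\<Sum>j=m..<N. z ^ j / of_nat j)"
    using eventually_ge_at_top[of m]
  proof eventually_elim
    case (elim N)
    have "(\<Sum>n<N. z ^ n / of_nat n) = (\<Sum>n=0..<m. z ^ n / of_nat n) + (\<Sum>n=m..<N. z ^ n / of_nat n)"
      using elim by (simp add: lessThan_atLeast0 sum.atLeastLessThan_concat)
    also have "(\<Sum>n=0..<m. z ^ n / of_nat n) = (\<Sum>n=1..<m. z ^ n / of_nat n)"
      using m by (subst sum.atLeast_Suc_lessThan) auto
    finally show ?case by simp
  qed
  ultimately show ?thesis using Lim_transform_eventually by fast
qed

lemma log_tail_radial_limit:
  assumes z: "cmod z \<le> 1" "z \<noteq> 1"
  shows "(\<lambda>k. log_tail m (of_real (1 - 1 / real (k + 2)) * z)) \<longlonglongrightarrow> log_tail m z"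
proof -
  have "(\<lambda>k. 1 - 1 / real (k + 2)) \<longlonglongrightarrow> 1" by real_asymp
  hence "(\<lambda>k. complex_of_real (1 - 1 / real (k + 2)) * z) \<longlonglongrightarrow> of_real 1 * z"
    by (intro tendsto_intros)
  moreover have "isCont (log_tail m) z"
    unfolding log_tail_def using Re_less_1_of_unit_disc[OF z]
    by (intro continuous_intros) (auto simp: complex_nonpos_Reals_iff)
  ultimately show ?thesis using isCont_tendsto_compose by fastforce
qed

lemma sum_inverse_squares_le:
  assumes "m \<ge> 2"
  shows "(\<Sum>j=m..<N. 1 / (real j)\<^sup>2) \<le> 1 / (real m - 1)"
proof (cases "m \<le> N")
  case True
  have "(\<Sum>j=m..<N. 1 / (real j)\<^sup>2) \<le> 1 / (real m - 1) - 1 / (real N - 1)"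
    using True
  proof (induction N rule: dec_induct)
    case (step N)
    have N: "real N \<ge> 2" using step assms by simp
    have "1 / (real N)\<^sup>2 \<le> 1 / (real N - 1) - 1 / (real (Suc N) - 1)"
      using N by (simp add: field_simps power2_eq_square)
    thus ?case using step by simp
  qed simp
  also have "\<dots> \<le> 1 / (real m - 1)" using True assms by simp
  finally show ?thesis .
qed (use assms in auto)

context rotation_invariant_disc
begin

text \<open>Inside the disc the second moment follows from orthogonality, and each \<open>E |z| ^ (2 j)\<close> with \<open>j \<ge> 2\<close>
is at most \<open>E |z| ^ 4\<close>. Fatou's lemma is applied twice: to pass from the partial sums at radius
\<open>r < 1\<close> to the function at that radius, and to let \<open>r\<close> tend to \<open>1\<close>.\<close>

lemma log_tail_square_bound:
  assumes m: "m \<ge> 2"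
  shows "(\<integral>\<^sup>+z. ennreal ((cmod (log_tail m z))\<^sup>2) \<partial>D) \<le> ennreal ((\<integral>z. cmod z ^ 4 \<partial>D) / (real m - 1))"
proof (rule nn_integral_fatou_bound)
  let ?\<beta> = "\<integral>z. cmod z ^ 4 \<partial>D"
  define r where "r k = 1 - 1 / real (k + 2)" for k
  have r: "0 < r k" "r k < 1" for k by (auto simp: r_def)
  show "AE z in D. (\<lambda>k. ennreal ((cmod (log_tail m (of_real (r k) * z)))\<^sup>2))
      \<longlonglongrightarrow> ennreal ((cmod (log_tail m z))\<^sup>2)"
    using disc no_atom_at_one unfolding r_def
    by eventually_elim (intro tendsto_intros log_tail_radial_limit)
  show "(\<integral>\<^sup>+z. ennreal ((cmod (log_tail m (of_real (r k) * z)))\<^sup>2) \<partial>D) \<le> ennreal (?\<beta> / (real m - 1))" for k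
  proof (rule nn_integral_fatou_bound)
    show "AE z in D. (\<lambda>N. ennreal ((cmod (\<Sum>j=m..<N. (of_real (r k) * z) ^ j / of_nat j))\<^sup>2))
       \<longlonglongrightarrow> ennreal ((cmod (log_tail m (of_real (r k) * z)))\<^sup>2)"
      using disc
    proof eventually_elim
      case (elim z)
      have "r k * cmod z \<le> r k * 1" using elim r[of k] by (intro mult_left_mono) auto
      moreover have "cmod (of_real (r k) * z) = r k * cmod z" using r[of k] by (simp add: norm_mult)
      ultimately have "cmod (of_real (r k) * z) < 1" using r[of k] by linarith
      thus ?case using m by (intro tendsto_intros log_tail_series) auto
    qed
    show "(\<integral>\<^sup>+z. ennreal ((cmod (\<Sum>j=m..<N. (of_real (r k) * z) ^ j / of_nat j))\<^sup>2) \<partial>D)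
        \<le> ennreal (?\<beta> / (real m - 1))" for N
    proof -
      have eq: "(\<Sum>j=m..<N. (of_real (r k) * z) ^ j / of_nat j)
          = (\<Sum>j\<in>{m..<N}. (of_real (r k) ^ j / of_nat j) * z ^ j)" for z :: complex
        by (intro sum.cong) (auto simp: power_mult_distrib)
      have "integrable D (\<lambda>z. (cmod (\<Sum>j\<in>{m..<N}. (of_real (r k) ^ j / of_nat j) * z ^ j))\<^sup>2)"
      proof (rule integrable_const_bound[where B = "(\<Sum>j\<in>{m..<N}. cmod (of_real (r k) ^ j / of_nat j))\<^sup>2"])
        show "AE z in D. norm ((cmod (\<Sum>j\<in>{m..<N}. (of_real (r k) ^ j / of_nat j) * z ^ j))\<^sup>2)
            \<le> (\<Sum>j\<in>{m..<N}. cmod (of_real (r k) ^ j / of_nat j))\<^sup>2"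
          using disc
        proof eventually_elim
          case (elim z)
          have "cmod (\<Sum>j\<in>{m..<N}. (of_real (r k) ^ j / of_nat j) * z ^ j)
             \<le> (\<Sum>j\<in>{m..<N}. cmod ((of_real (r k) ^ j / of_nat j) * z ^ j))" by (rule norm_sum)
          also have "\<dots> \<le> (\<Sum>j\<in>{m..<N}. cmod (of_real (r k) ^ j / of_nat j) * 1)"
            using elim unfolding norm_mult by (intro sum_mono mult_left_mono)
                (auto simp: norm_power power_le_one)
          finally show ?case by (simp add: power_mono)
        qed
      qed measurable
      hence "(\<integral>\<^sup>+z. ennreal ((cmod (\<Sum>j=m..<N. (of_real (r k) * z) ^ j / of_nat j))\<^sup>2) \<partial>D)
         = ennreal (\<integral>z. (cmod (\<Sum>j\<in>{m..<N}. (of_real (r k) ^ j / of_nat j) * z ^ j))\<^sup>2 \<partial>D)"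
        unfolding eq by (intro nn_integral_eq_integral) auto
      also have "(\<integral>z. (cmod (\<Sum>j\<in>{m..<N}. (of_real (r k) ^ j / of_nat j) * z ^ j))\<^sup>2 \<partial>D)
         = (\<Sum>j\<in>{m..<N}. (cmod (of_real (r k) ^ j / of_nat j))\<^sup>2 * (\<integral>z. cmod z ^ (2 * j) \<partial>D))"
        by (rule parseval) simp
      also have "\<dots> \<le> (\<Sum>j\<in>{m..<N}. 1 / (real j)\<^sup>2 * ?\<beta>)"
      proof (intro sum_mono mult_mono)
        fix j assume j: "j \<in> {m..<N}"
        have "cmod (of_real (r k) ^ j / of_nat j) \<le> 1 / real j"
          using r[of k] by (simp add: norm_divide norm_power power_le_one divide_right_mono)
        hence "(cmod (of_real (r k) ^ j / of_nat j))\<^sup>2 \<le> (1 / real j)\<^sup>2"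
          by (intro power_mono) auto
        thus "(cmod (of_real (r k) ^ j / of_nat j))\<^sup>2 \<le> 1 / (real j)\<^sup>2"
          by (simp only: power_divide power_one)
        show "(\<integral>z. cmod z ^ (2 * j) \<partial>D) \<le> ?\<beta>"
        proof (rule integral_mono_AE[OF integrable_norm_power integrable_norm_power])
          show "AE z in D. cmod z ^ (2 * j) \<le> cmod z ^ 4"
            using disc by eventually_elim (use j m in \<open>intro power_decreasing, auto\<close>)
        qed
      qed (auto intro!: integral_nonneg_AE)
      also have "\<dots> = (\<Sum>j\<in>{m..<N}. 1 / (real j)\<^sup>2) * ?\<beta>" by (simp add: sum_distrib_right)
      also have "\<dots> \<le> 1 / (real m - 1) * ?\<beta>"
        by (intro mult_right_mono sum_inverse_squares_le m) (auto intro!: integral_nonneg_AE)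
      finally show ?thesis by (simp add: ennreal_leI)
    qed
  qed measurable
qed measurable

lemma integrable_log_tail_square:
  assumes m: "m \<ge> 2"
  shows "integrable D (\<lambda>z. (cmod (log_tail m z))\<^sup>2)"
    and "(\<integral>z. (cmod (log_tail m z))\<^sup>2 \<partial>D) \<le> (\<integral>z. cmod z ^ 4 \<partial>D) / (real m - 1)"
proof -
  have nn: "0 \<le> (\<integral>z. cmod z ^ 4 \<partial>D) / (real m - 1)"
    using m by (intro divide_nonneg_nonneg integral_nonneg_AE) auto
  show int: "integrable D (\<lambda>z. (cmod (log_tail m z))\<^sup>2)"
    using log_tail_square_bound[OF m] by (intro integrableI_bounded)
        (auto simp: less_top[symmetric] top_unique)
  have "ennreal (\<integral>z. (cmod (log_tail m z))\<^sup>2 \<partial>D) \<le> ennreal ((\<integral>z. cmod z ^ 4 \<partial>D) / (real m - 1))"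
    using log_tail_square_bound[OF m] nn_integral_eq_integral[OF int] by simp
  thus "(\<integral>z. (cmod (log_tail m z))\<^sup>2 \<partial>D) \<le> (\<integral>z. cmod z ^ 4 \<partial>D) / (real m - 1)"
    using nn by (subst (asm) ennreal_le_iff) auto
qed

lemma integrable_log_tail:
  assumes m: "m \<ge> 2"
  shows "integrable D (log_tail m)"
proof (rule Bochner_Integration.integrable_bound)
  show "integrable D (\<lambda>z. 1 + (cmod (log_tail m z))\<^sup>2)"
    using integrable_log_tail_square[OF m] by simp
  have "x \<le> 1 + x\<^sup>2" for x :: real
    using zero_le_power2[of "x - 1 / 2"] by (simp add: power2_eq_square algebra_simps)
  thus "AE z in D. norm (log_tail m z) \<le> norm (1 + (cmod (log_tail m z))\<^sup>2)" by (intro AE_I2) simp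
qed measurable

text \<open>The polynomials obtained by truncation have mean \<open>0\<close>, and what is cut off tends to \<open>0\<close> in mean square.\<close>

lemma log_tail_mean: "(\<integral>z. log_tail 2 z \<partial>D) = 0"
proof -
  let ?\<beta> = "\<integral>z. cmod z ^ 4 \<partial>D"
  have bound: "cmod (\<integral>z. log_tail 2 z \<partial>D) \<le> \<epsilon> + ?\<beta> / (real m - 1) / \<epsilon>" if m: "m \<ge> 2" and e: "\<epsilon> > 0" for m \<epsilon>
  proof -
    have split: "log_tail 2 z = (\<Sum>j=2..<m. z ^ j / of_nat j) + log_tail m z" for z
    proof -
      have "(\<Sum>j=1..<m. z ^ j / of_nat j) = (\<Sum>j=1..<2. z ^ j / of_nat j) + (\<Sum>j=2..<m. z ^ j / of_nat j)"
        using m by (intro sum.atLeastLessThan_concat[symmetric]) auto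
      thus ?thesis unfolding log_tail_def by (simp only: algebra_simps)
    qed
    have i1: "integrable D (\<lambda>z. z ^ j / of_nat j)" for j
      using integrable_monomial[of j 0] by simp
    have "(\<integral>z. log_tail 2 z \<partial>D) = (\<integral>z. (\<Sum>j=2..<m. z ^ j / of_nat j) \<partial>D) + (\<integral>z. log_tail m z \<partial>D)"
      unfolding split using i1 integrable_log_tail[OF m]
      by (intro Bochner_Integration.integral_add Bochner_Integration.integrable_sum)
    also have "(\<integral>z. (\<Sum>j=2..<m. z ^ j / of_nat j) \<partial>D) = 0"
      using i1 moment_holomorphic by (subst Bochner_Integration.integral_sum) auto
    finally have "cmod (\<integral>z. log_tail 2 z \<partial>D) \<le> (\<integral>z. cmod (log_tail m z) \<partial>D)" by simp
    also have "\<dots> \<le> (\<integral>z. \<epsilon> + (cmod (log_tail m z))\<^sup>2 / \<epsilon> \<partial>D)"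
    proof (rule integral_mono)
      show "integrable D (\<lambda>z. cmod (log_tail m z))" using integrable_log_tail[OF m] by simp
      show "integrable D (\<lambda>z. \<epsilon> + (cmod (log_tail m z))\<^sup>2 / \<epsilon>)" using integrable_log_tail_square[OF m] by simp
      have "x \<le> \<epsilon> + x\<^sup>2 / \<epsilon>" for x :: real
      proof -
        have "x * \<epsilon> \<le> \<epsilon>\<^sup>2 + x\<^sup>2"
        proof -
          have "(x - \<epsilon> / 2)\<^sup>2 = x\<^sup>2 - x * \<epsilon> + \<epsilon>\<^sup>2 / 4"
            by (simp add: power2_eq_square algebra_simps)
          thus ?thesis using zero_le_power2[of "x - \<epsilon> / 2"] zero_le_power2[of \<epsilon>] by linarith
        qed
        thus ?thesis using e by (simp add: field_simps power2_eq_square)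
      qed
      thus "cmod (log_tail m z) \<le> \<epsilon> + (cmod (log_tail m z))\<^sup>2 / \<epsilon>" for z .
    qed
    also have "\<dots> = \<epsilon> + (\<integral>z. (cmod (log_tail m z))\<^sup>2 \<partial>D) / \<epsilon>"
      using integrable_log_tail_square(1)[OF m] by (simp add: prob_space)
    also have "\<dots> \<le> \<epsilon> + ?\<beta> / (real m - 1) / \<epsilon>"
      using integrable_log_tail_square(2)[OF m] e by (intro add_left_mono divide_right_mono) auto
    finally show ?thesis .
  qed
  have small: "cmod (\<integral>z. log_tail 2 z \<partial>D) \<le> \<epsilon>" if e: "\<epsilon> > 0" for \<epsilon>
  proof (rule tendsto_lowerbound)
    have "(\<lambda>m. 1 / (real m - 1)) \<longlonglongrightarrow> 0" by real_asymp
    hence "(\<lambda>m. \<epsilon> + ?\<beta> * (1 / (real m - 1)) / \<epsilon>) \<longlonglongrightarrow> \<epsilon> + ?\<beta> * 0 / \<epsilon>"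
      using e by (intro tendsto_intros) auto
    thus "(\<lambda>m. \<epsilon> + ?\<beta> / (real m - 1) / \<epsilon>) \<longlonglongrightarrow> \<epsilon>" by simp
    show "\<forall>\<^sub>F m in sequentially. cmod (\<integral>z. log_tail 2 z \<partial>D) \<le> \<epsilon> + ?\<beta> / (real m - 1) / \<epsilon>"
      using eventually_ge_at_top[of 2] by eventually_elim (use bound e in auto)
  qed simp
  have "cmod (\<integral>z. log_tail 2 z \<partial>D) \<le> 0"
  proof (rule field_le_epsilon)
    fix e :: real assume "0 < e"
    from small[OF this] show "cmod (\<integral>z. log_tail 2 z \<partial>D) \<le> 0 + e" by (simp only: add_0_left)
  qed
  thus ?thesis by simp
qed

text \<open>Write \<open>Ln (1 - z) = - z - T\<close> with \<open>T = log_tail 2 z\<close>. The terms linear in \<open>z\<close> or in \<open>T\<close> have mean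
\<open>0\<close>, and the term quadratic in \<open>z\<close> has mean \<open>|t|^2 \<alpha> / 4\<close>. Three remainders are left:
\<open>R0\<close>, of third order in \<open>z\<close>; \<open>R1\<close>, a product of \<open>z\<close> and \<open>T\<close>; and \<open>R2\<close>, quadratic in \<open>T\<close>. The
parameter \<open>\<kappa>\<close> is the weight in the inequality \<open>2 x y \<le> \<kappa> x^2 + y^2 / \<kappa>\<close>, which reduces everything
to second and fourth moments.\<close>

lemma charfun_log_estimate:
  fixes t :: complex
  assumes l: "\<kappa> > 0"
  defines "\<alpha> \<equiv> \<integral>z. (cmod z)\<^sup>2 \<partial>D" and "\<beta> \<equiv> \<integral>z. cmod z ^ 4 \<partial>D"
  shows "cmod ((\<integral>z. cis (t \<bullet> Ln (1 - z)) \<partial>D) - of_real (1 - (cmod t)\<^sup>2 * \<alpha> / 4))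
     \<le> (cmod t)\<^sup>2 * \<beta> / 2 + ((cmod t)\<^sup>2 / 2 + (cmod t) ^ 3 / 12) * (\<kappa> * \<alpha> + \<beta> / \<kappa>)"
proof -
  let ?T = "log_tail 2"
  define R0 where "R0 z = cis (- (t \<bullet> z)) - (1 - \<i> * of_real (t \<bullet> z) - of_real ((t \<bullet> z)\<^sup>2) / 2)" for z
  define R1 where "R1 z = \<i> * of_real (t \<bullet> ?T z) * (cis (- (t \<bullet> z)) - 1)" for z
  define R2 where "R2 z = cis (- (t \<bullet> z)) * (cis (- (t \<bullet> ?T z)) - 1 + \<i> * of_real (t \<bullet> ?T z))" for z
  have cis_exp: "cis x = iexp x" for x by (simp add: cis_conv_exp)
  have c0: "cmod (cis x - 1) \<le> \<bar>x\<bar>" for x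
    using iexp_approx1[of x 0] by (simp add: cis_exp)
  have c1: "cmod (cis x - 1 - \<i> * of_real x) \<le> x\<^sup>2 / 2" for x
    using iexp_approx1[of x 1] by (simp add: cis_exp algebra_simps numeral_2_eq_2)
  have c2: "cmod (cis x - (1 + \<i> * of_real x - of_real (x\<^sup>2) / 2)) \<le> \<bar>x\<bar> ^ 3 / 6" for x
    using iexp_approx1[of x 2] by (simp add: cis_exp algebra_simps numeral_2_eq_2 numeral_3_eq_3
        power2_eq_square)
  have CS: "\<bar>t \<bullet> z\<bar> \<le> cmod t * cmod z" for z by (rule Cauchy_Schwarz_ineq2)
  have young: "x * y \<le> (\<kappa> * x\<^sup>2 + y\<^sup>2 / \<kappa>) / 2" for x y :: real
  proof -
    have "0 \<le> (\<kappa> * x - y)\<^sup>2 / \<kappa>" using l by simp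
    also have "\<dots> = \<kappa> * x\<^sup>2 + y\<^sup>2 / \<kappa> - 2 * (x * y)"
      using l by (simp add: field_simps power2_eq_square)
    finally show ?thesis by simp
  qed
  have [measurable]: "R0 \<in> borel_measurable borel" "R1 \<in> borel_measurable borel" "R2 \<in> borel_measurable borel"
    unfolding R0_def[abs_def] R1_def[abs_def] R2_def[abs_def] by measurable
  note i2 = integrable_norm_power[of 2] and i4 = integrable_norm_power[of 4]
  note iT = integrable_log_tail_square(1)[of 2, simplified] and iT1 = integrable_log_tail[of 2, simplified]
  have T2: "(\<integral>z. (cmod (?T z))\<^sup>2 \<partial>D) \<le> \<beta>"
    using integrable_log_tail_square(2)[of 2] by (simp add: \<beta>_def)
  have b0: "cmod (R0 z) \<le> cmod t ^ 3 / 12 * (\<kappa> * (cmod z)\<^sup>2 + cmod z ^ 4 / \<kappa>)" for z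
  proof -
    have "cmod (R0 z) \<le> \<bar>t \<bullet> z\<bar> ^ 3 / 6" using c2[of "- (t \<bullet> z)"] by (simp add: R0_def)
    also have "\<dots> \<le> (cmod t * cmod z) ^ 3 / 6" using CS[of z] by (intro divide_right_mono power_mono) auto
    also have "\<dots> = cmod t ^ 3 / 6 * (cmod z * (cmod z)\<^sup>2)" by
        (simp add: power_mult_distrib power3_eq_cube power2_eq_square)
    also have "\<dots> \<le> cmod t ^ 3 / 6 * ((\<kappa> * (cmod z)\<^sup>2 + ((cmod z)\<^sup>2)\<^sup>2 / \<kappa>) / 2)"
      by (intro mult_left_mono young) auto
    also have "\<dots> = cmod t ^ 3 / 12 * (\<kappa> * (cmod z)\<^sup>2 + cmod z ^ 4 / \<kappa>)" by (simp add: power_mult[symmetric])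
    finally show ?thesis .
  qed
  have b1: "cmod (R1 z) \<le> (cmod t)\<^sup>2 / 2 * (\<kappa> * (cmod z)\<^sup>2 + (cmod (?T z))\<^sup>2 / \<kappa>)" for z
  proof -
    have "cmod (R1 z) = \<bar>t \<bullet> ?T z\<bar> * cmod (cis (- (t \<bullet> z)) - 1)" by (simp add: R1_def norm_mult)
    also have "\<dots> \<le> (cmod t * cmod (?T z)) * (cmod t * cmod z)"
      using c0[of "- (t \<bullet> z)"] CS[of z] CS[of "?T z"] by (intro mult_mono) auto
    also have "\<dots> = (cmod t)\<^sup>2 * (cmod z * cmod (?T z))" by (simp add: power2_eq_square)
    also have "\<dots> \<le> (cmod t)\<^sup>2 * ((\<kappa> * (cmod z)\<^sup>2 + (cmod (?T z))\<^sup>2 / \<kappa>) / 2)"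
      by (intro mult_left_mono young) auto
    finally show ?thesis by simp
  qed
  have b2: "cmod (R2 z) \<le> (cmod t)\<^sup>2 / 2 * (cmod (?T z))\<^sup>2" for z
  proof -
    have "cmod (R2 z) \<le> (t \<bullet> ?T z)\<^sup>2 / 2" using c1[of "- (t \<bullet> ?T z)"] by (simp add: R2_def norm_mult)
    also have "(t \<bullet> ?T z)\<^sup>2 \<le> (cmod t * cmod (?T z))\<^sup>2"
      using CS[of "?T z"] by (simp add: abs_le_square_iff[symmetric])
    finally show ?thesis by (simp add: power_mult_distrib)
  qed
  have dominated: "integrable D R" if "integrable D f" "R \<in> borel_measurable borel" "\<And>z. cmod (R z) \<le> f z"
    for R :: "complex \<Rightarrow> complex" and f :: "complex \<Rightarrow> real"
    by (rule Bochner_Integration.integrable_bound[OF that(1)])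
       (use that in \<open>auto intro!: AE_I2 order.trans[OF that(3) abs_ge_self] simp:
           measurable_cong_sets[OF sets_D refl]\<close>)
  have j0: "integrable D R0" by (rule dominated[OF _ _ b0]) (use i2 i4 in auto)
  have j1: "integrable D R1" by (rule dominated[OF _ _ b1]) (use i2 iT in auto)
  have j2: "integrable D R2" by (rule dominated[OF _ _ b2]) (use iT in auto)
  have n0: "cmod (\<integral>z. R0 z \<partial>D) \<le> cmod t ^ 3 / 12 * (\<kappa> * \<alpha> + \<beta> / \<kappa>)"
  proof -
    have "cmod (\<integral>z. R0 z \<partial>D) \<le> (\<integral>z. cmod t ^ 3 / 12 * (\<kappa> * (cmod z)\<^sup>2 + cmod z ^ 4 / \<kappa>) \<partial>D)"
      using i2 i4 by (intro Bochner_Integration.integral_norm_bound_integral j0 b0) auto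
    thus ?thesis using i2 i4 by (simp add: \<alpha>_def \<beta>_def)
  qed
  have n1: "cmod (\<integral>z. R1 z \<partial>D) \<le> (cmod t)\<^sup>2 / 2 * (\<kappa> * \<alpha> + \<beta> / \<kappa>)"
  proof -
    have "cmod (\<integral>z. R1 z \<partial>D) \<le> (\<integral>z. (cmod t)\<^sup>2 / 2 * (\<kappa> * (cmod z)\<^sup>2 + (cmod (?T z))\<^sup>2 / \<kappa>) \<partial>D)"
      using i2 iT by (intro Bochner_Integration.integral_norm_bound_integral j1 b1) auto
    also have "\<dots> = (cmod t)\<^sup>2 / 2 * (\<kappa> * \<alpha> + (\<integral>z. (cmod (?T z))\<^sup>2 \<partial>D) / \<kappa>)"
      using i2 iT by (simp add: \<alpha>_def)
    also have "\<dots> \<le> (cmod t)\<^sup>2 / 2 * (\<kappa> * \<alpha> + \<beta> / \<kappa>)"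
      using T2 l by (intro mult_left_mono add_left_mono divide_right_mono) auto
    finally show ?thesis .
  qed
  have n2: "cmod (\<integral>z. R2 z \<partial>D) \<le> (cmod t)\<^sup>2 * \<beta> / 2"
  proof -
    have "cmod (\<integral>z. R2 z \<partial>D) \<le> (\<integral>z. (cmod t)\<^sup>2 / 2 * (cmod (?T z))\<^sup>2 \<partial>D)"
      using iT by (intro Bochner_Integration.integral_norm_bound_integral j2 b2) auto
    also have "\<dots> = (cmod t)\<^sup>2 / 2 * (\<integral>z. (cmod (?T z))\<^sup>2 \<partial>D)" by simp
    also have "\<dots> \<le> (cmod t)\<^sup>2 / 2 * \<beta>" using T2 by (intro mult_left_mono) auto
    finally show ?thesis by simp
  qed
  have iz: "integrable D (\<lambda>z. z)" using integrable_monomial[of 1 0] by simp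
  have m1: "(\<integral>z. z \<partial>D) = 0" using moment_holomorphic[of 1] by simp
  have k1: "integrable D (\<lambda>z. \<i> * of_real (t \<bullet> z))" using iz by simp
  have q1: "(\<integral>z. t \<bullet> z \<partial>D) = 0"
    using integral_inner_right[OF iz, of t] m1 by simp
  have k3: "integrable D (\<lambda>z. \<i> * of_real (t \<bullet> ?T z))" using iT1 by simp
  have q3: "(\<integral>z. t \<bullet> ?T z \<partial>D) = 0"
    using integral_inner_right[OF iT1, of t] log_tail_mean by simp
  have sq: "(t \<bullet> z)\<^sup>2 = ((cmod t)\<^sup>2 * (cmod z)\<^sup>2 + Re ((cnj t)\<^sup>2 * z\<^sup>2)) / 2" for z
    unfolding cmod_power2 by (simp add: inner_complex_def power2_eq_square algebra_simps)
  have iz2: "integrable D (\<lambda>z. z\<^sup>2)" using integrable_monomial[of 2 0] by simp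
  have k2: "integrable D (\<lambda>z. (t \<bullet> z)\<^sup>2)"
    unfolding sq using i2 iz2 by (intro Bochner_Integration.integrable_divide
        Bochner_Integration.integrable_add integrable_Re) auto
  have q2: "(\<integral>z. (t \<bullet> z)\<^sup>2 \<partial>D) = (cmod t)\<^sup>2 * \<alpha> / 2"
  proof -
    have "(\<integral>z. Re ((cnj t)\<^sup>2 * z\<^sup>2) \<partial>D) = Re (\<integral>z. (cnj t)\<^sup>2 * z\<^sup>2 \<partial>D)"
      using iz2 by (intro integral_Re) auto
    also have "\<dots> = 0" using moment_holomorphic[of 2] by simp
    finally show ?thesis unfolding sq using i2 iz2 by (simp add: \<alpha>_def)
  qed
  have k2': "integrable D (\<lambda>z. complex_of_real ((t \<bullet> z)\<^sup>2) / 2)"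
    using k2 by (intro Bochner_Integration.integrable_divide integrable_of_real) auto
  have q2c: "(\<integral>z. (complex_of_real (t \<bullet> z))\<^sup>2 \<partial>D) = of_real ((cmod t)\<^sup>2 * \<alpha> / 2)"
    by (simp only: of_real_power[symmetric] integral_complex_of_real q2)
  have eq: "cis (t \<bullet> Ln (1 - z)) = 1 - \<i> * of_real (t \<bullet> z) - of_real ((t \<bullet> z)\<^sup>2) / 2 + R0 z
      - \<i> * of_real (t \<bullet> ?T z) - R1 z + R2 z" for z
  proof -
    have "Ln (1 - z) = - z - ?T z" by (simp add: log_tail_def numeral_2_eq_2)
    hence "cis (t \<bullet> Ln (1 - z)) = cis (- (t \<bullet> z)) * cis (- (t \<bullet> ?T z))"
      by (simp add: cis_mult inner_diff_right inner_minus_right)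
    thus ?thesis by (simp add: R0_def R1_def R2_def algebra_simps)
  qed
  have "(\<integral>z. cis (t \<bullet> Ln (1 - z)) \<partial>D) = 1 - of_real ((cmod t)\<^sup>2 * \<alpha> / 4)
      + (\<integral>z. R0 z \<partial>D) - (\<integral>z. R1 z \<partial>D) + (\<integral>z. R2 z \<partial>D)"
    unfolding eq
    using k2'
    by (simp add: j0 j1 j2 k1 k3 q1 q2c q3 prob_space)
  hence "(\<integral>z. cis (t \<bullet> Ln (1 - z)) \<partial>D) - of_real (1 - (cmod t)\<^sup>2 * \<alpha> / 4)
     = (\<integral>z. R0 z \<partial>D) - (\<integral>z. R1 z \<partial>D) + (\<integral>z. R2 z \<partial>D)" by (simp add: algebra_simps)
  hence "cmod ((\<integral>z. cis (t \<bullet> Ln (1 - z)) \<partial>D) - of_real (1 - (cmod t)\<^sup>2 * \<alpha> / 4))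
     = cmod ((\<integral>z. R0 z \<partial>D) - (\<integral>z. R1 z \<partial>D) + (\<integral>z. R2 z \<partial>D))" by (simp only:)
  also have "\<dots> \<le> cmod (\<integral>z. R0 z \<partial>D) + cmod (\<integral>z. R1 z \<partial>D) + cmod (\<integral>z. R2 z \<partial>D)"
    by (meson add_right_mono norm_triangle_ineq norm_triangle_ineq4 order_trans)
  also have "\<dots> \<le> cmod t ^ 3 / 12 * (\<kappa> * \<alpha> + \<beta> / \<kappa>) + (cmod t)\<^sup>2 / 2 * (\<kappa> * \<alpha> + \<beta> / \<kappa>) + (cmod t)\<^sup>2 * \<beta> / 2"
    using n0 n1 n2 by linarith
  also have "\<dots> = (cmod t)\<^sup>2 * \<beta> / 2 + ((cmod t)\<^sup>2 / 2 + (cmod t) ^ 3 / 12) * (\<kappa> * \<alpha> + \<beta> / \<kappa>)"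
    by (simp add: distrib_right)
  finally show ?thesis .
qed

end

section \<open>Moments of the corner entry\<close>

lemma haar_integral_left:
  fixes f :: "complex mat \<Rightarrow> 'b :: {banach, second_countable_topology}"
  assumes H: "haar_unitary n \<mu>" and h: "h \<in> unitary_group n"
    and f: "f \<in> borel_measurable (unitary_borel n)"
  shows "(\<integral>g. f (h * g) \<partial>\<mu>) = (\<integral>g. f g \<partial>\<mu>)"
proof -
  have "(\<integral>g. f g \<partial>\<mu>) = (\<integral>g. f g \<partial>distr \<mu> \<mu> (\<lambda>g. h * g))"
    using haar_left[OF H h] by simp
  also have "\<dots> = (\<integral>g. f (h * g) \<partial>\<mu>)"
    using f measurable_unitary_mult_left[OF h]
    by (intro integral_distr) (auto simp: haar_measurable_cong[OF H])
  finally show ?thesis ..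
qed

lemma haar_integral_right:
  fixes f :: "complex mat \<Rightarrow> 'b :: {banach, second_countable_topology}"
  assumes H: "haar_unitary n \<mu>" and h: "h \<in> unitary_group n"
    and f: "f \<in> borel_measurable (unitary_borel n)"
  shows "(\<integral>g. f (g * h) \<partial>\<mu>) = (\<integral>g. f g \<partial>\<mu>)"
proof -
  have "(\<integral>g. f g \<partial>\<mu>) = (\<integral>g. f g \<partial>distr \<mu> \<mu> (\<lambda>g. g * h))"
    using haar_right[OF H h] by simp
  also have "\<dots> = (\<integral>g. f (g * h) \<partial>\<mu>)"
    using f measurable_unitary_mult_right[OF h]
    by (intro integral_distr) (auto simp: haar_measurable_cong[OF H])
  finally show ?thesis ..
qed

lemma haar_measurable_entry:
  assumes "haar_unitary n \<mu>" "i < n" "j < n"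
  shows "(\<lambda>g. g $$ (i, j)) \<in> borel_measurable \<mu>"
  using measurable_unitary_entry[OF assms(2,3)] by (simp add: haar_measurable_cong[OF assms(1)])

lemma haar_corner_rotation_invariant:
  assumes H: "haar_unitary n \<mu>" and n: "n \<ge> 1"
  shows "rotation_invariant_disc (distr \<mu> borel (\<lambda>g. g $$ (0, 0)))"
proof -
  interpret \<mu>: prob_space \<mu> by (rule haar_prob[OF H])
  have e [measurable]: "(\<lambda>g. g $$ (0, 0)) \<in> borel_measurable \<mu>"
    using n by (intro haar_measurable_entry[OF H]) auto
  interpret prob_space "distr \<mu> borel (\<lambda>g. g $$ (0, 0))" by (rule \<mu>.prob_space_distr) measurable
  show ?thesis
  proof
    show "AE z in distr \<mu> borel (\<lambda>g. g $$ (0, 0)). cmod z \<le> 1"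
      using n unitary_entry_le_1[of _ n 0 0] by (subst AE_distr_iff)
          (auto intro!: AE_I2 simp: haar_space[OF H])
    fix c :: complex assume c: "cmod c = 1"
    have U: "c \<cdot>\<^sub>m 1\<^sub>m n \<in> unitary_group n" by (rule smult_unitary[OF one_unitary c])
    have m: "(\<lambda>g. (c \<cdot>\<^sub>m 1\<^sub>m n) * g) \<in> measurable \<mu> \<mu>"
      using measurable_unitary_mult_left[OF U] by (simp add: haar_measurable_cong[OF H])
    have "distr \<mu> borel (\<lambda>g. g $$ (0, 0)) = distr (distr \<mu> \<mu> (\<lambda>g. (c \<cdot>\<^sub>m 1\<^sub>m n) * g)) borel (\<lambda>g. g $$ (0, 0))"
      using haar_left[OF H U] by simp
    also have "\<dots> = distr \<mu> borel (\<lambda>g. ((c \<cdot>\<^sub>m 1\<^sub>m n) * g) $$ (0, 0))"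
      using m by (subst distr_distr) (auto simp: o_def)
    also have "\<dots> = distr \<mu> borel (\<lambda>g. c * g $$ (0, 0))"
    proof (rule distr_cong)
      fix g assume "g \<in> space \<mu>"
      hence "g \<in> carrier_mat n n" using haar_space[OF H] unitary_group_carrier by auto
      thus "((c \<cdot>\<^sub>m 1\<^sub>m n) * g) $$ (0, 0) = c * g $$ (0, 0)"
        using mult_smult_assoc_mat[of "1\<^sub>m n" n n g n c] n by simp
    qed auto
    also have "\<dots> = distr (distr \<mu> borel (\<lambda>g. g $$ (0, 0))) borel (\<lambda>z. c * z)"
      by (subst distr_distr) (auto simp: o_def)
    finally show "distr (distr \<mu> borel (\<lambda>g. g $$ (0, 0))) borel (\<lambda>z. c * z)
        = distr \<mu> borel (\<lambda>g. g $$ (0, 0))" ..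
  qed simp
qed

text \<open>The witness is a complex reflection: with \<open>b = e\<^sub>0 - u\<close>, it multiplies the complex conjugate of
\<open>b\<close> by a number and fixes its orthogonal complement. That number has modulus \<open>1\<close> because
\<open>|b|^2 = 2 Re b\<^sub>0\<close> for a unit vector \<open>u\<close>.\<close>

lemma unitary_with_first_row:
  assumes n: "n \<ge> 1" and u: "(\<Sum>j<n. (cmod (u j))\<^sup>2) = 1" and u0: "u 0 \<noteq> 1"
  obtains Q where "Q \<in> unitary_group n" "\<And>j. j < n \<Longrightarrow> Q $$ (0, j) = u j"
proof -
  define b where "b j = (if j = 0 then 1 else 0) - u j" for j :: nat
  define Q where "Q = mat n n (\<lambda>(i, j). (if i = j then 1 else 0) - cnj (b i) * b j / cnj (b 0))"
  have b0: "b 0 \<noteq> 0" using u0 by (simp add: b_def)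
  obtain m where m: "n = Suc m" using n by (cases n) auto
  have "(\<Sum>j<n. cnj (b j) * b j) = b 0 + cnj (b 0)"
  proof -
    have "(\<Sum>j<n. (cmod (b j))\<^sup>2) = (cmod (1 - u 0))\<^sup>2 + (\<Sum>j<m. (cmod (u (Suc j)))\<^sup>2)"
      by (simp add: m sum.lessThan_Suc_shift b_def)
    also have "(\<Sum>j<m. (cmod (u (Suc j)))\<^sup>2) = 1 - (cmod (u 0))\<^sup>2"
      using u by (simp add: m sum.lessThan_Suc_shift)
    also have "(cmod (1 - u 0))\<^sup>2 + \<dots> = 2 * Re (b 0)"
      unfolding cmod_power2 by (simp add: b_def power2_eq_square algebra_simps)
    finally have "complex_of_real (\<Sum>j<n. (cmod (b j))\<^sup>2) = of_real (2 * Re (b 0))" by simp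
    thus ?thesis using complex_add_cnj[of "b 0"]
      by (simp add: complex_norm_square mult.commute del: of_real_power)
  qed
  note bb = this
  have "Q \<in> unitary_group n"
    unfolding unitary_group_iff_columns
  proof (intro conjI allI impI)
    fix i j assume ij: "i < n" "j < n"
    have "(\<Sum>k<n. cnj (Q $$ (k, i)) * Q $$ (k, j))
       = (\<Sum>k<n. ((if k = i then 1 else 0) - b k * cnj (b i) / b 0) * ((if k
           = j then 1 else 0) - cnj (b k) * b j / cnj (b 0)))"
      using ij by (intro sum.cong) (auto simp: Q_def)
    also have "\<dots> = (\<Sum>k<n. (if k = i then (if i = j then 1 else 0) else 0)
        - (if k = i then cnj (b i) * b j / cnj (b 0) else 0) - (if k = j then b j * cnj (b i) / b 0 else 0)
        + cnj (b i) * b j / (b 0 * cnj (b 0)) * (cnj (b k) * b k))"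
      by (intro sum.cong refl) (simp add: algebra_simps)
    also have "\<dots> = (if i = j then 1 else 0) - cnj (b i) * b j / cnj (b 0) - b j * cnj (b i) / b 0
        + cnj (b i) * b j / (b 0 * cnj (b 0)) * (\<Sum>k<n. cnj (b k) * b k)"
      using ij by (simp add: sum.distrib sum_subtractf sum_distrib_left)
    also have "\<dots> = (if i = j then 1 else 0)"
      unfolding bb using b0 by (simp add: field_simps)
    finally show "(\<Sum>k<n. cnj (Q $$ (k, i)) * Q $$ (k, j)) = (if i = j then 1 else 0)" .
  qed (simp add: Q_def)
  moreover have "Q $$ (0, j) = u j" if "j < n" for j
    using that b0 n by (auto simp: Q_def b_def)
  ultimately show ?thesis using that by blast
qed

text \<open>Left invariance under a unitary matrix with first row \<open>u\<close>.\<close>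

lemma haar_column_combination:
  fixes f :: "complex \<Rightarrow> real"
  assumes H: "haar_unitary n \<mu>" and n: "n \<ge> 1"
    and u: "(\<Sum>j<n. (cmod (u j))\<^sup>2) = 1" and u0: "u 0 \<noteq> 1" and f: "f \<in> borel_measurable borel"
  shows "(\<integral>g. f (\<Sum>j<n. u j * g $$ (j, 0)) \<partial>\<mu>) = (\<integral>g. f (g $$ (0, 0)) \<partial>\<mu>)"
proof -
  obtain Q where Q: "Q \<in> unitary_group n" "\<And>j. j < n \<Longrightarrow> Q $$ (0, j) = u j"
    using unitary_with_first_row[OF n u u0] by blast
  have "(\<integral>g. f (g $$ (0, 0)) \<partial>\<mu>) = (\<integral>g. f ((Q * g) $$ (0, 0)) \<partial>\<mu>)"
    using n by (intro haar_integral_left[OF H Q(1), symmetric] measurable_compose[OF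
        measurable_unitary_entry f]) auto
  also have "\<dots> = (\<integral>g. f (\<Sum>j<n. u j * g $$ (j, 0)) \<partial>\<mu>)"
  proof (intro Bochner_Integration.integral_cong refl)
    fix g assume "g \<in> space \<mu>"
    hence "g \<in> carrier_mat n n" using haar_space[OF H] unitary_group_carrier by auto
    thus "f ((Q * g) $$ (0, 0)) = f (\<Sum>j<n. u j * g $$ (j, 0))"
      using Q(2) n by (subst mat_mult_index[OF unitary_group_carrier[OF Q(1)]]) auto
  qed
  finally show ?thesis ..
qed

lemma haar_integrable_bounded:
  fixes f :: "complex mat \<Rightarrow> 'b :: {banach, second_countable_topology}"
  assumes H: "haar_unitary n \<mu>" and f: "f \<in> borel_measurable \<mu>"
    and b: "\<And>g. g \<in> unitary_group n \<Longrightarrow> norm (f g) \<le> B"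
  shows "integrable \<mu> f"
proof -
  interpret prob_space \<mu> by (rule haar_prob[OF H])
  show ?thesis using f b by (intro integrable_const_bound[where B = B]) (auto simp: haar_space[OF H])
qed

lemma haar_column_power:
  assumes H: "haar_unitary n \<mu>" and j: "j < n"
  shows "(\<integral>g. cmod (g $$ (j, 0)) ^ p \<partial>\<mu>) = (\<integral>g. cmod (g $$ (0, 0)) ^ p \<partial>\<mu>)"
proof (cases "j = 0")
  case False
  define u where "u i = (if i = j then 1 else 0 :: complex)" for i
  have "(\<Sum>i<n. (cmod (u i))\<^sup>2) = (\<Sum>i<n. if i = j then 1 else 0)" by (intro sum.cong) (auto simp: u_def)
  hence "(\<Sum>i<n. (cmod (u i))\<^sup>2) = 1" using j by simp
  moreover have "u 0 \<noteq> 1" using False by (simp add: u_def)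
  moreover have "(\<lambda>z. cmod z ^ p) \<in> borel_measurable borel" by measurable
  ultimately have "(\<integral>g. cmod (\<Sum>i<n. u i * g $$ (i, 0)) ^ p \<partial>\<mu>) = (\<integral>g. cmod (g $$ (0, 0)) ^ p \<partial>\<mu>)"
    using j by (intro haar_column_combination[OF H]) auto
  moreover have "(\<Sum>i<n. u i * x i) = x j" for x
  proof -
    have "(\<Sum>i<n. u i * x i) = (\<Sum>i<n. if i = j then x i else 0)" by (intro sum.cong) (auto simp: u_def)
    thus ?thesis using j by simp
  qed
  ultimately show ?thesis by simp
qed simp

lemma haar_corner_second_moment:
  assumes H: "haar_unitary n \<mu>" and n: "n \<ge> 1"
  shows "(\<integral>g. (cmod (g $$ (0, 0)))\<^sup>2 \<partial>\<mu>) = 1 / real n"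
proof -
  interpret prob_space \<mu> by (rule haar_prob[OF H])
  note [measurable] = haar_measurable_entry[OF H]
  have int: "integrable \<mu> (\<lambda>g. (cmod (g $$ (j, 0)))\<^sup>2)" if "j < n" for j
    using that n unitary_entry_le_1[of _ n j 0]
    by (intro haar_integrable_bounded[OF H, where B = 1]) (auto simp: power_le_one)
  have "real n * (\<integral>g. (cmod (g $$ (0, 0)))\<^sup>2 \<partial>\<mu>) = (\<Sum>j<n. \<integral>g. (cmod (g $$ (j, 0)))\<^sup>2 \<partial>\<mu>)"
  proof -
    have "(\<Sum>j<n. \<integral>g. (cmod (g $$ (j, 0)))\<^sup>2 \<partial>\<mu>) = (\<Sum>j<n. \<integral>g. (cmod (g $$ (0, 0)))\<^sup>2 \<partial>\<mu>)"
      by (intro sum.cong refl haar_column_power[OF H]) auto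
    thus ?thesis by simp
  qed
  also have "\<dots> = (\<integral>g. (\<Sum>j<n. (cmod (g $$ (j, 0)))\<^sup>2) \<partial>\<mu>)"
    using int by (intro Bochner_Integration.integral_sum[symmetric]) auto
  also have "\<dots> = (\<integral>g. 1 \<partial>\<mu>)"
    using n unitary_col_norm[of _ n 0] by (intro Bochner_Integration.integral_cong)
        (auto simp: haar_space[OF H])
  finally show ?thesis using n by (simp add: prob_space field_simps)
qed

lemma fourth_power_phase_average:
  fixes a b :: complex
  shows "cmod (a + b) ^ 4 + cmod (a - b) ^ 4 + cmod (a + \<i> * b) ^ 4 + cmod (a - \<i> * b) ^ 4
     = 4 * (cmod a ^ 4 + cmod b ^ 4 + 4 * (cmod a)\<^sup>2 * (cmod b)\<^sup>2)"
proof -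
  have four: "cmod z ^ 4 = ((Re z)\<^sup>2 + (Im z)\<^sup>2)\<^sup>2" for z
    by (simp add: cmod_power2[symmetric])
  show ?thesis unfolding four cmod_power2 by (simp add: power2_eq_square algebra_simps)
qed

text \<open>Apply the invariance to \<open>u = (e\<^sub>0 + c e\<^sub>j) / sqrt 2\<close> for the four phases \<open>c\<close> with \<open>c ^ 4 = 1\<close> and
average: only the moments of even order in both entries survive.\<close>

lemma haar_column_mixed_moment:
  assumes H: "haar_unitary n \<mu>" and j: "j < n" "j \<noteq> 0"
  shows "(\<integral>g. cmod (g $$ (0, 0)) ^ 4 \<partial>\<mu>) = 2 * (\<integral>g. (cmod (g $$ (0, 0)))\<^sup>2 * (cmod (g $$ (j, 0)))\<^sup>2 \<partial>\<mu>)"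
proof -
  let ?\<beta> = "\<integral>g. cmod (g $$ (0, 0)) ^ 4 \<partial>\<mu>"
  interpret prob_space \<mu> by (rule haar_prob[OF H])
  have n: "n \<ge> 1" "0 < n" using j by auto
  have [measurable]: "(\<lambda>g. g $$ (0, 0)) \<in> borel_measurable \<mu>" "(\<lambda>g. g $$ (j, 0)) \<in> borel_measurable \<mu>"
    using n j haar_measurable_entry[OF H] by auto
  have le1: "cmod (g $$ (0, 0)) \<le> 1" "cmod (g $$ (j, 0)) \<le> 1" if "g \<in> unitary_group n" for g
    using that n j unitary_entry_le_1 by auto
  have phase: "(\<integral>g. cmod (g $$ (0, 0) + c * g $$ (j, 0)) ^ 4 \<partial>\<mu>) = 4 * ?\<beta>" if c: "cmod c = 1" for c
  proof -
    define u where "u i = (if i = 0 then 1 / sqrt 2 else if i = j then c / sqrt 2 else 0 :: complex)" for i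
    have sum: "(\<Sum>i<n. F i) = F 0 + F j" if "\<And>i. i \<noteq> 0 \<Longrightarrow> i \<noteq> j \<Longrightarrow> F i = 0"
        for F :: "nat \<Rightarrow> 'x :: comm_monoid_add"
    proof -
      have "(\<Sum>i<n. F i) = (\<Sum>i\<in>{0, j}. F i)"
        using j that by (intro sum.mono_neutral_right) auto
      thus ?thesis using j by simp
    qed
    have "(\<Sum>i<n. (cmod (u i))\<^sup>2) = (cmod (u 0))\<^sup>2 + (cmod (u j))\<^sup>2" by (rule sum) (simp add: u_def)
    also have "\<dots> = 1" using c j by (simp add: u_def norm_divide power_divide)
    finally have 1: "(\<Sum>i<n. (cmod (u i))\<^sup>2) = 1" .
    have 2: "u 0 \<noteq> 1" by (simp add: u_def complex_eq_iff)
    have "?\<beta> = (\<integral>g. cmod (\<Sum>i<n. u i * g $$ (i, 0)) ^ 4 \<partial>\<mu>)"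
      by (rule haar_column_combination[OF H n(1) 1 2, symmetric]) measurable
    also have "\<dots> = (\<integral>g. cmod (g $$ (0, 0) + c * g $$ (j, 0)) ^ 4 / 4 \<partial>\<mu>)"
    proof (intro Bochner_Integration.integral_cong refl)
      fix g :: "complex mat"
      have "(\<Sum>i<n. u i * g $$ (i, 0)) = u 0 * g $$ (0, 0) + u j * g $$ (j, 0)"
        by (rule sum) (simp add: u_def)
      also have "\<dots> = (g $$ (0, 0) + c * g $$ (j, 0)) / of_real (sqrt 2)"
        using j by (simp add: u_def add_divide_distrib)
      finally have "cmod (\<Sum>i<n. u i * g $$ (i, 0)) = cmod (g $$ (0, 0) + c * g $$ (j, 0)) / sqrt 2"
        by (simp add: norm_divide)
      moreover have "sqrt 2 ^ 4 = (4 :: real)"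
        using power_mult[of "sqrt 2" 2 2] by simp
      ultimately show "cmod (\<Sum>i<n. u i * g $$ (i, 0)) ^ 4 = cmod (g $$ (0, 0) + c * g $$ (j, 0)) ^ 4 / 4"
        by (simp add: power_divide)
    qed
    finally show ?thesis by simp
  qed
  have intc: "integrable \<mu> (\<lambda>g. cmod (g $$ (0, 0) + c * g $$ (j, 0)) ^ 4)" if "cmod c = 1" for c
  proof (rule haar_integrable_bounded[OF H, where B = "2 ^ 4"])
    fix g assume g: "g \<in> unitary_group n"
    have "cmod (g $$ (0, 0) + c * g $$ (j, 0)) \<le> cmod (g $$ (0, 0)) + cmod (c * g $$ (j, 0))"
        by (rule norm_triangle_ineq)
    also have "\<dots> \<le> 2" using le1[OF g] that by (simp add: norm_mult)
    finally have "cmod (g $$ (0, 0) + c * g $$ (j, 0)) ^ 4 \<le> 2 ^ 4" by (intro power_mono) auto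
    thus "norm (cmod (g $$ (0, 0) + c * g $$ (j, 0)) ^ 4) \<le> 2 ^ 4" by simp
  qed measurable
  have i1: "integrable \<mu> (\<lambda>g. cmod (g $$ (0, 0)) ^ 4)" "integrable \<mu> (\<lambda>g. cmod (g $$ (j, 0)) ^ 4)"
    "integrable \<mu> (\<lambda>g. (cmod (g $$ (0, 0)))\<^sup>2 * (cmod (g $$ (j, 0)))\<^sup>2)"
    using le1 by (auto intro!: haar_integrable_bounded[OF H, where B = 1] mult_le_one simp: power_le_one)
  have "16 * ?\<beta> = (\<integral>g. cmod (g $$ (0, 0) + 1 * g $$ (j, 0)) ^ 4 \<partial>\<mu>) + (\<integral>g. cmod (g $$ (0, 0) + (-1)
      * g $$ (j, 0)) ^ 4 \<partial>\<mu>)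
     + (\<integral>g. cmod (g $$ (0, 0) + \<i> * g $$ (j, 0)) ^ 4 \<partial>\<mu>) + (\<integral>g. cmod (g $$ (0, 0) + (-\<i>)
         * g $$ (j, 0)) ^ 4 \<partial>\<mu>)"
    using phase[of 1] phase[of "-1"] phase[of \<i>] phase[of "-\<i>"] by simp
  also have "\<dots> = (\<integral>g. cmod (g $$ (0, 0) + 1 * g $$ (j, 0)) ^ 4 + cmod (g $$ (0, 0) + (-1) * g $$ (j, 0)) ^ 4
     + cmod (g $$ (0, 0) + \<i> * g $$ (j, 0)) ^ 4 + cmod (g $$ (0, 0) + (-\<i>) * g $$ (j, 0)) ^ 4 \<partial>\<mu>)"
    using intc[of 1] intc[of "-1"] intc[of \<i>] intc[of "-\<i>"]
    by (simp only: Bochner_Integration.integral_add Bochner_Integration.integrable_add norm_one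
        norm_minus_cancel norm_ii simp_thms)
  also have "\<dots> = (\<integral>g. 4 * (cmod (g $$ (0, 0)) ^ 4 + cmod (g $$ (j, 0)) ^ 4 + 4 * ((cmod (g $$ (0, 0)))\<^sup>2
      * (cmod (g $$ (j, 0)))\<^sup>2)) \<partial>\<mu>)"
    using fourth_power_phase_average by (intro Bochner_Integration.integral_cong refl) (simp add: mult.assoc)
  also have "\<dots> = 4 * (?\<beta> + (\<integral>g. cmod (g $$ (j, 0)) ^ 4 \<partial>\<mu>)
      + 4 * (\<integral>g. (cmod (g $$ (0, 0)))\<^sup>2 * (cmod (g $$ (j, 0)))\<^sup>2 \<partial>\<mu>))"
    using i1 by simp
  also have "(\<integral>g. cmod (g $$ (j, 0)) ^ 4 \<partial>\<mu>) = ?\<beta>" by (rule haar_column_power[OF H j(1)])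
  finally show ?thesis by simp
qed

text \<open>Sum the mixed moments over \<open>j\<close>; as the column is a unit vector, they add up to
\<open>E |g\<^sub>0\<^sub>0|^2 - E |g\<^sub>0\<^sub>0|^4\<close>.\<close>

lemma haar_corner_fourth_moment:
  assumes H: "haar_unitary n \<mu>" and n: "n \<ge> 1"
  shows "(\<integral>g. cmod (g $$ (0, 0)) ^ 4 \<partial>\<mu>) = 2 / (real n * (real n + 1))"
proof -
  let ?\<beta> = "\<integral>g. cmod (g $$ (0, 0)) ^ 4 \<partial>\<mu>"
  interpret prob_space \<mu> by (rule haar_prob[OF H])
  obtain m where m: "n = Suc m" using n by (cases n) auto
  have [measurable]: "(\<lambda>g. g $$ (j, 0)) \<in> borel_measurable \<mu>" if "j < n" for j
    using n that haar_measurable_entry[OF H] by auto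
  have le1: "cmod (g $$ (j, 0)) \<le> 1" if "g \<in> unitary_group n" "j < n" for g j
    using that n unitary_entry_le_1[of g n j 0] by auto
  have i1: "integrable \<mu> (\<lambda>g. (cmod (g $$ (0, 0)))\<^sup>2 * (cmod (g $$ (j, 0)))\<^sup>2)" if "j < n" for j
    using le1[of _ 0] le1[OF _ that] n that
    by (intro haar_integrable_bounded[OF H, where B = 1]) (auto intro!: mult_le_one simp: power_le_one m)
  have i2: "integrable \<mu> (\<lambda>g. (cmod (g $$ (0, 0)))\<^sup>2)" "integrable \<mu> (\<lambda>g. cmod (g $$ (0, 0)) ^ 4)"
    using le1[of _ 0] by (auto intro!: haar_integrable_bounded[OF H, where B = 1] simp: power_le_one m)
  have "real m * ?\<beta> = (\<Sum>j<m. 2 * (\<integral>g. (cmod (g $$ (0, 0)))\<^sup>2 * (cmod (g $$ (Suc j, 0)))\<^sup>2 \<partial>\<mu>))"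
  proof -
    have "2 * (\<integral>g. (cmod (g $$ (0, 0)))\<^sup>2 * (cmod (g $$ (Suc j, 0)))\<^sup>2 \<partial>\<mu>) = ?\<beta>" if "j < m" for j
      using haar_column_mixed_moment[OF H, of "Suc j"] that by (simp add: m)
    thus ?thesis by simp
  qed
  also have "\<dots> = 2 * (\<integral>g. (\<Sum>j<m. (cmod (g $$ (0, 0)))\<^sup>2 * (cmod (g $$ (Suc j, 0)))\<^sup>2) \<partial>\<mu>)"
    using i1 by (subst Bochner_Integration.integral_sum) (auto simp: m sum_distrib_left)
  also have "(\<integral>g. (\<Sum>j<m. (cmod (g $$ (0, 0)))\<^sup>2 * (cmod (g $$ (Suc j, 0)))\<^sup>2) \<partial>\<mu>)
     = (\<integral>g. (cmod (g $$ (0, 0)))\<^sup>2 - cmod (g $$ (0, 0)) ^ 4 \<partial>\<mu>)"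
  proof (intro Bochner_Integration.integral_cong refl)
    fix g assume "g \<in> space \<mu>"
    hence "(cmod (g $$ (0, 0)))\<^sup>2 + (\<Sum>j<m. (cmod (g $$ (Suc j, 0)))\<^sup>2) = 1"
      using unitary_col_norm[of g n 0] by (simp add: haar_space[OF H] m sum.lessThan_Suc_shift)
    hence s: "(\<Sum>j<m. (cmod (g $$ (Suc j, 0)))\<^sup>2) = 1 - (cmod (g $$ (0, 0)))\<^sup>2" by simp
    have "(\<Sum>j<m. (cmod (g $$ (0, 0)))\<^sup>2 * (cmod (g $$ (Suc j, 0)))\<^sup>2) = (cmod (g $$ (0, 0)))\<^sup>2
        * (1 - (cmod (g $$ (0, 0)))\<^sup>2)"
      by (simp only: s sum_distrib_left[symmetric])
    thus "(\<Sum>j<m. (cmod (g $$ (0, 0)))\<^sup>2 * (cmod (g $$ (Suc j, 0)))\<^sup>2)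
        = (cmod (g $$ (0, 0)))\<^sup>2 - cmod (g $$ (0, 0)) ^ 4"
      by (simp add: right_diff_distrib power2_eq_square power4_eq_xxxx mult.assoc)
  qed
  also have "\<dots> = 1 / real n - ?\<beta>"
    using i2 haar_corner_second_moment[OF H n] by simp
  finally have "(real n + 1) * ?\<beta> = 2 / real n" by (simp add: m algebra_simps)
  hence "?\<beta> = 2 / real n / (real n + 1)"
    using n by (subst nonzero_eq_divide_eq) (auto simp: mult.commute)
  thus ?thesis by simp
qed

section \<open>The product formula\<close>

text \<open>By equivariance the integral does not change if the reduced matrix \<open>h\<close> is replaced by \<open>k h\<close>.
Averaging over a Haar distributed \<open>k\<close> and using right invariance for fixed \<open>h\<close> decouples the two
factors.\<close>

lemma haar_corner_reduce_independent:
  fixes a :: "complex \<Rightarrow> complex" and b :: "complex mat \<Rightarrow> complex"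
  assumes H: "haar_unitary (Suc m) \<mu>" and H': "haar_unitary m \<nu>"
    and a: "a \<in> borel_measurable borel" "\<And>z. cmod (a z) \<le> 1"
    and b: "b \<in> borel_measurable (unitary_borel m)" "\<And>h. cmod (b h) \<le> 1"
  shows "(\<integral>g. a (g $$ (0, 0)) * b (schur_reduce m g) \<partial>\<mu>)
     = (\<integral>g. a (g $$ (0, 0)) \<partial>\<mu>) * (\<integral>h. b h \<partial>\<nu>)"
proof -
  interpret \<mu>: prob_space \<mu> by (rule haar_prob[OF H])
  interpret \<nu>: prob_space \<nu> by (rule haar_prob[OF H'])
  interpret P: pair_prob_space \<nu> \<mu> ..
  let ?h = "schur_reduce m"
  have mh: "?h \<in> measurable (unitary_borel (Suc m)) (unitary_borel m)" by (rule measurable_schur_reduce)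
  have e0: "(\<lambda>g. g $$ (0, 0)) \<in> borel_measurable (unitary_borel (Suc m))"
    by (rule measurable_unitary_entry) auto
  have F: "(\<lambda>g. a (g $$ (0, 0)) * b (?h g)) \<in> borel_measurable (unitary_borel (Suc m))"
    by (intro borel_measurable_times measurable_compose[OF e0 a(1)] measurable_compose[OF mh b(1)])
  have AE1: "AE g in \<mu>. g $$ (0, 0) \<noteq> 1"
    using haar_no_eigenvalue_one[OF H] AE_space
    by eventually_elim (use no_eigenvalue_one_corner haar_space[OF H] in auto)
  have shift: "(\<integral>g. a (g $$ (0, 0)) * b (?h g) \<partial>\<mu>) = (\<integral>g. a (g $$ (0, 0)) * b (k * ?h g) \<partial>\<mu>)"
    if k: "k \<in> unitary_group m" for k
  proof -
    have mk: "(\<lambda>g. b (k * ?h g)) \<in> borel_measurable \<mu>"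
      using measurable_compose[OF measurable_compose[OF mh measurable_unitary_mult_left[OF k]] b(1)]
      by (simp add: haar_measurable_cong[OF H])
    have "(\<integral>g. a (g $$ (0, 0)) * b (?h g) \<partial>\<mu>)
        = (\<integral>g. a ((unitary_extend m k * g) $$ (0, 0)) * b (?h (unitary_extend m k * g)) \<partial>\<mu>)"
      by (rule haar_integral_left[OF H unitary_extend_unitary[OF k] F, symmetric])
    also have "\<dots> = (\<integral>g. a (g $$ (0, 0)) * b (k * ?h g) \<partial>\<mu>)"
    proof (rule integral_cong_AE)
      show "(\<lambda>g. a ((unitary_extend m k * g) $$ (0, 0)) * b (?h (unitary_extend m k * g)))
          \<in> borel_measurable \<mu>"
        using measurable_compose[OF measurable_unitary_mult_left[OF unitary_extend_unitary[OF k]] F]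
        by (simp add: haar_measurable_cong[OF H])
      show "(\<lambda>g. a (g $$ (0, 0)) * b (k * ?h g)) \<in> borel_measurable \<mu>"
        using measurable_compose[OF e0 a(1)] mk by (intro borel_measurable_times)
            (auto simp: haar_measurable_cong[OF H])
      show "AE g in \<mu>. a ((unitary_extend m k * g) $$ (0, 0)) * b (?h (unitary_extend m k * g))
          = a (g $$ (0, 0)) * b (k * ?h g)"
        using AE1 AE_space
      proof eventually_elim
        case (elim g)
        hence "g \<in> carrier_mat (Suc m) (Suc m)" using haar_space[OF H] unitary_group_carrier by auto
        thus ?case using elim unitary_extend_mult(1)[of g m 0 k] schur_reduce_extend_mult[of g m k]
            unitary_group_carrier[OF k]
          by simp
      qed
    qed
    finally show ?thesis .
  qed
  have mP: "(\<lambda>(k, g). a (g $$ (0, 0)) * b (k * ?h g)) \<in> borel_measurable (\<nu> \<Otimes>\<^sub>M \<mu>)"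
  proof -
    have f: "fst \<in> measurable (\<nu> \<Otimes>\<^sub>M \<mu>) (unitary_borel m)"
      using measurable_fst[of \<nu> \<mu>] by (simp add: haar_measurable_cong[OF H'])
    have s: "snd \<in> measurable (\<nu> \<Otimes>\<^sub>M \<mu>) (unitary_borel (Suc m))"
      using measurable_snd[of \<nu> \<mu>] by (simp add: haar_measurable_cong[OF H])
    show ?thesis unfolding case_prod_beta
      by (intro borel_measurable_times measurable_compose[OF measurable_compose[OF s e0] a(1)]
         measurable_compose[OF measurable_unitary_mult[OF f measurable_compose[OF s mh]] b(1)])
  qed
  have intP: "integrable (\<nu> \<Otimes>\<^sub>M \<mu>) (\<lambda>(k, g). a (g $$ (0, 0)) * b (k * ?h g))"
  proof (rule P.integrable_const_bound[where B = 1, OF _ mP], rule AE_I2)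
    have "cmod (a x * b y) \<le> 1" for x y using a(2)[of x] b(2)[of y] by (simp add: norm_mult mult_le_one)
    thus "cmod (case x of (k, g) \<Rightarrow> a (g $$ (0, 0)) * b (k * ?h g)) \<le> 1" for x by (simp only: split_beta)
  qed
  have "(\<integral>g. a (g $$ (0, 0)) * b (?h g) \<partial>\<mu>) = (\<integral>k. (\<integral>g. a (g $$ (0, 0)) * b (?h g) \<partial>\<mu>) \<partial>\<nu>)"
    by (simp add: \<nu>.prob_space)
  also have "\<dots> = (\<integral>k. (\<integral>g. a (g $$ (0, 0)) * b (k * ?h g) \<partial>\<mu>) \<partial>\<nu>)"
    by (rule Bochner_Integration.integral_cong[OF refl], rule shift) (simp add: haar_space[OF H'])
  also have "\<dots> = (\<integral>g. (\<integral>k. a (g $$ (0, 0)) * b (k * ?h g) \<partial>\<nu>) \<partial>\<mu>)"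
    using P.Fubini_integral[OF intP] by simp
  also have "\<dots> = (\<integral>g. a (g $$ (0, 0)) * (\<integral>h. b h \<partial>\<nu>) \<partial>\<mu>)"
  proof (intro Bochner_Integration.integral_cong refl)
    fix g assume "g \<in> space \<mu>"
    hence U: "?h g \<in> unitary_group m"
      using measurable_unitary_in[OF mh, of g] by (simp add: haar_space[OF H] space_unitary_borel)
    show "(\<integral>k. a (g $$ (0, 0)) * b (k * ?h g) \<partial>\<nu>) = a (g $$ (0, 0)) * (\<integral>h. b h \<partial>\<nu>)"
      by (simp only: integral_mult_right_zero haar_integral_right[OF H' U b(1)])
  qed
  finally show ?thesis by simp
qed

definition corner_charfun :: "complex mat measure \<Rightarrow> complex \<Rightarrow> complex" where
  "corner_charfun \<mu> t = (\<integral>g. cis (t \<bullet> Ln (1 - g $$ (0, 0))) \<partial>\<mu>)"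

definition logdet_charfun :: "complex mat measure \<Rightarrow> complex \<Rightarrow> complex" where
  "logdet_charfun \<mu> t = (\<integral>g. cis (t \<bullet> logdet_one_minus g) \<partial>\<mu>)"

lemma logdet_charfun_eq_corner_reduce:
  assumes H: "haar_unitary (Suc m) \<mu>"
  shows "logdet_charfun \<mu> t = (\<integral>g. cis (t \<bullet> Ln (1 - g $$ (0, 0))) *
     cis (t \<bullet> logdet_one_minus (schur_reduce m g)) \<partial>\<mu>)"
  unfolding logdet_charfun_def
proof (rule integral_cong_AE)
  have e0 [measurable]: "(\<lambda>g. g $$ (0, 0)) \<in> borel_measurable (unitary_borel (Suc m))"
    by (rule measurable_unitary_entry) auto
  have [measurable]: "(\<lambda>g. logdet_one_minus (schur_reduce m g)) \<in> borel_measurable (unitary_borel (Suc m))"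
    by (rule measurable_compose[OF measurable_schur_reduce measurable_logdet])
  have [measurable]: "logdet_one_minus \<in> borel_measurable (unitary_borel (Suc m))" by (rule measurable_logdet)
  show "(\<lambda>g. cis (t \<bullet> logdet_one_minus g)) \<in> borel_measurable \<mu>"
    unfolding haar_measurable_cong[OF H] by measurable
  show "(\<lambda>g. cis (t \<bullet> Ln (1 - g $$ (0, 0))) *
     cis (t \<bullet> logdet_one_minus (schur_reduce m g))) \<in> borel_measurable \<mu>"
    unfolding haar_measurable_cong[OF H] by measurable
  show "AE g in \<mu>. cis (t \<bullet> logdet_one_minus g) = cis (t \<bullet> Ln (1 - g $$ (0, 0))) *
     cis (t \<bullet> logdet_one_minus (schur_reduce m g))"
    using haar_no_eigenvalue_one[OF H] AE_space
  proof eventually_elim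
    case (elim g)
    hence g: "g \<in> unitary_group (Suc m)" by (simp add: haar_space[OF H])
    have ne: "g $$ (0, 0) \<noteq> 1" by (rule no_eigenvalue_one_corner[OF g elim(1)])
    show ?case using ne logdet_schur_reduce[OF g elim(1) ne] by (simp add: cis_mult inner_add_right)
  qed
qed

lemma logdet_charfun_Suc:
  assumes H: "haar_unitary (Suc m) \<mu>" and H': "haar_unitary m \<nu>"
  shows "logdet_charfun \<mu> t = corner_charfun \<mu> t * logdet_charfun \<nu> t"
proof -
  have [measurable]: "logdet_one_minus \<in> borel_measurable (unitary_borel m)" by (rule measurable_logdet)
  show ?thesis
    unfolding logdet_charfun_eq_corner_reduce[OF H] corner_charfun_def
    unfolding logdet_charfun_def
    by (rule haar_corner_reduce_independent[OF H H', where a = "\<lambda>z. cis (t \<bullet> Ln (1 - z))" and b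
        = "\<lambda>h. cis (t \<bullet> logdet_one_minus h)"])
       auto
qed

lemma logdet_charfun_1:
  assumes H: "haar_unitary (Suc 0) \<mu>"
  shows "logdet_charfun \<mu> t = corner_charfun \<mu> t"
proof -
  have "eigs h = {#}" if "h \<in> carrier_mat 0 0" for h using size_eigs[OF that] by simp
  hence "logdet_one_minus h = 0" if "h \<in> carrier_mat 0 0" for h
    using that by (simp add: logdet_one_minus_def eigs_def)
  thus ?thesis
    using logdet_charfun_eq_corner_reduce[of 0 \<mu> t] H by (simp add: corner_charfun_def)
qed

lemma logdet_charfun_prod:
  assumes H: "\<And>n. n \<ge> 1 \<Longrightarrow> haar_unitary n (\<mu> n)" and n: "n \<ge> 1"
  shows "logdet_charfun (\<mu> n) t = (\<Prod>k=1..n. corner_charfun (\<mu> k) t)"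
  using n
proof (induction n rule: dec_induct)
  case base
  show ?case using logdet_charfun_1[of "\<mu> 1" t] H[of 1] by simp
next
  case (step n)
  thus ?case using logdet_charfun_Suc[OF H[of "Suc n"] H[of n]] by (simp add: mult.commute)
qed

text \<open>The general estimate with weight \<open>1 / sqrt n\<close>, which balances the second moment \<open>1 / n\<close> against the
fourth moment of order \<open>1 / n^2\<close>.\<close>

lemma corner_charfun_estimate:
  assumes H: "haar_unitary n \<mu>" and n: "n \<ge> 1"
  shows "cmod (corner_charfun \<mu> t - of_real (1 - (cmod t)\<^sup>2 / (4 * real n)))
     \<le> 3 * (cmod t)\<^sup>2 * (1 + cmod t) / (real n * sqrt (real n))"
proof -
  let ?D = "distr \<mu> borel (\<lambda>g. g $$ (0, 0))"
  interpret D: rotation_invariant_disc ?D by (rule haar_corner_rotation_invariant[OF H n])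
  have [measurable]: "(\<lambda>g. g $$ (0, 0)) \<in> borel_measurable \<mu>"
    using n by (intro haar_measurable_entry[OF H]) auto
  have 0: "(\<integral>z. cis (t \<bullet> Ln (1 - z)) \<partial>?D) = corner_charfun \<mu> t"
    unfolding corner_charfun_def by (rule integral_distr) measurable
  have 1: "(\<integral>z. (cmod z)\<^sup>2 \<partial>?D) = 1 / real n"
    using haar_corner_second_moment[OF H n] by (subst integral_distr) auto
  have 2: "(\<integral>z. cmod z ^ 4 \<partial>?D) = 2 / (real n * (real n + 1))"
    using haar_corner_fourth_moment[OF H n] by (subst integral_distr) auto
  define s where "s = sqrt (real n)"
  have s: "s \<ge> 1" "real n = s * s" using n by (auto simp: s_def)
  define \<beta> where "\<beta> = 2 / (real n * (real n + 1))"
  define T where "T = cmod t"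
  have T0: "T \<ge> 0" by (simp add: T_def)
  have "\<beta> \<le> 2 / (real n * real n)" unfolding \<beta>_def using n by (intro divide_left_mono mult_left_mono) auto
  also have "\<dots> = 2 / (s * s * s) / s" by (simp add: s(2) mult.assoc)
  finally have b1: "\<beta> * s \<le> 2 / (s * s * s)" using s(1) by (simp add: field_simps)
  have "\<beta> * 1 \<le> \<beta> * s" using s(1) by (intro mult_left_mono) (auto simp: \<beta>_def)
  with b1 have b2: "\<beta> \<le> 2 / (s * s * s)" by simp
  have b3: "1 / s * (1 / real n) + \<beta> / (1 / s) \<le> 3 / (s * s * s)"
    using b1 by (simp add: s(2) mult.assoc)
  have "cmod (corner_charfun \<mu> t - of_real (1 - (cmod t)\<^sup>2 / (4 * real n)))
      \<le> T\<^sup>2 * \<beta> / 2 + (T\<^sup>2 / 2 + T ^ 3 / 12) * (1 / s * (1 / real n) + \<beta> / (1 / s))"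
    using D.charfun_log_estimate[of "1 / s" t] s(1) unfolding 0 1 2 \<beta>_def T_def by (simp add: mult.commute)
  also have "\<dots> \<le> T\<^sup>2 * (2 / (s * s * s)) / 2 + (T\<^sup>2 / 2 + T ^ 3 / 12) * (3 / (s * s * s))"
    using b2 b3 T0 by (intro add_mono divide_right_mono mult_left_mono) auto
  also have "\<dots> = (5 / 2 * T\<^sup>2 + T ^ 3 / 4) / (s * s * s)" by (simp add: add_divide_distrib algebra_simps)
  also have "\<dots> \<le> (3 * T\<^sup>2 * (1 + T)) / (s * s * s)"
  proof (rule divide_right_mono)
    have "0 \<le> T\<^sup>2" "0 \<le> T ^ 3" using T0 by simp_all
    moreover have "3 * T\<^sup>2 * (1 + T) = 3 * T\<^sup>2 + 3 * T ^ 3"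
      by (simp add: power2_eq_square power3_eq_cube algebra_simps)
    ultimately show "5 / 2 * T\<^sup>2 + T ^ 3 / 4 \<le> 3 * T\<^sup>2 * (1 + T)" by linarith
  qed (use s(1) in simp)
  finally show ?thesis by (simp add: T_def s(2)[symmetric] s_def[symmetric])
qed

section \<open>Products of nearly Gaussian factors\<close>

lemma summable_inverse_three_halves: "summable (\<lambda>k. 1 / (real k * sqrt (real k)))"
proof -
  have "summable (\<lambda>k. real k powr (- 3 / 2))" by (subst summable_real_powr_iff) simp
  moreover have "real k powr (- 3 / 2) = 1 / (real k * sqrt (real k))" for k
  proof (cases "k = 0")
    case False
    have "real k powr (3 / 2) = real k powr 1 * real k powr (1 / 2)"
      using powr_add[of "real k" 1 "1 / 2"] by simp
    also have "\<dots> = real k * sqrt (real k)" using False by (simp add: powr_half_sqrt)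
    finally show ?thesis using powr_minus_divide[of "real k" "3 / 2"] by simp
  qed simp
  ultimately show ?thesis by simp
qed

lemma ln_quotient_le_harmonic_sum:
  assumes "1 \<le> m" "m \<le> n"
  shows "ln (real n / real m) \<le> (\<Sum>k=m..n. 1 / real k)"
proof -
  have "ln (real (Suc n) / real m) \<le> (\<Sum>k=m..n. 1 / real k)"
    using assms(2)
  proof (induction n rule: dec_induct)
    case base
    have "ln (real (Suc m) / real m) = ln (1 + 1 / real m)" using assms(1) by (simp add: field_simps)
    also have "\<dots> \<le> 1 / real m" by (rule ln_add_one_self_le_self) simp
    finally show ?case by simp
  next
    case (step n)
    have n0: "real (Suc n) > 0" by simp
    have "ln (real (Suc (Suc n)) / real m) = ln (real (Suc n) / real m * (1 + 1 / real (Suc n)))"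
    proof -
      have "real (Suc (Suc n)) = real (Suc n) * (1 + 1 / real (Suc n))" using n0 by (simp add: distrib_left)
      thus ?thesis by (simp only: times_divide_eq_left)
    qed
    also have "\<dots> = ln (real (Suc n) / real m) + ln (1 + 1 / real (Suc n))"
      using assms(1) n0 by (intro ln_mult_pos divide_pos_pos add_pos_pos) auto
    also have "\<dots> \<le> (\<Sum>k=m..n. 1 / real k) + 1 / real (Suc n)"
      by (intro add_mono step ln_add_one_self_le_self) auto
    also have "\<dots> = (\<Sum>k=m..Suc n. 1 / real k)" using step by simp
    finally show ?case .
  qed
  moreover have "ln (real n / real m) \<le> ln (real (Suc n) / real m)"
    using assms by (intro ln_mono divide_right_mono divide_pos_pos) auto
  ultimately show ?thesis by linarith
qed

locale near_gaussian_product =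
  fixes \<psi> :: "nat \<Rightarrow> complex \<Rightarrow> complex"
  assumes le_one: "\<And>k t. k \<ge> 1 \<Longrightarrow> cmod (\<psi> k t) \<le> 1"
    and approx: "\<And>k t. k \<ge> 1 \<Longrightarrow> cmod (\<psi> k t - of_real (1 - (cmod t)\<^sup>2 / (4 * real k)))
        \<le> 3 * (cmod t)\<^sup>2 * (1 + cmod t) / (real k * sqrt (real k))"
begin

text \<open>Compare the product with the product of \<open>exp (- T^2 / (4 k))\<close>, where \<open>T = |u| / sqrt (ln n / 2)\<close>
tends to \<open>0\<close>. All factors are bounded by \<open>1\<close>, so the difference is at most the sum of the
differences of the factors, which is \<open>O(T^2)\<close>. The second product is the exponential of
\<open>- T^2 / 4\<close> times a harmonic number.\<close>

lemma product_limit: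
  "(\<lambda>n. \<Prod>k=1..n. \<psi> k (u / of_real (sqrt (ln (real n) / 2)))) \<longlonglongrightarrow> of_real (exp (- (cmod u)\<^sup>2 / 2))"
proof -
  define T where "T n = cmod u / sqrt (ln (real n) / 2)" for n :: nat
  define S where "S = (\<Sum>k. 1 / (real k * sqrt (real k)))"
  have T_lim: "T \<longlonglongrightarrow> 0"
  proof -
    have "(\<lambda>n. 1 / sqrt (ln (real n) / 2)) \<longlonglongrightarrow> 0" by real_asymp
    from tendsto_mult[OF tendsto_const[of "cmod u"] this] show ?thesis by (simp add: T_def[abs_def])
  qed
  have diff: "cmod ((\<Prod>k=1..n. \<psi> k (u / of_real (sqrt (ln (real n) / 2)))) - of_real (\<Prod>k=1..n. exp (- ((T
      n)\<^sup>2 / (4 * real k)))))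
      \<le> (3 * (T n)\<^sup>2 * (1 + T n) + (T n) ^ 4) * S" if n: "n \<ge> 2" for n
  proof -
    define t where "t = u / of_real (sqrt (ln (real n) / 2))"
    have T0: "T n \<ge> 0" using n by (simp add: T_def)
    have t: "cmod t = T n" using n by (simp add: t_def T_def norm_divide)
    have "cmod ((\<Prod>k=1..n. \<psi> k t) - (\<Prod>k=1..n. of_real (exp (- ((T n)\<^sup>2 / (4 * real k))))))
        \<le> (\<Sum>k=1..n. cmod (\<psi> k t - of_real (exp (- ((T n)\<^sup>2 / (4 * real k))))))"
      using le_one by (intro norm_prod_diff) auto
    also have "\<dots> \<le> (\<Sum>k=1..n. (3 * (T n)\<^sup>2 * (1 + T n) + (T n) ^ 4) * (1 / (real k * sqrt (real k))))"
    proof (rule sum_mono)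
      fix k assume "k \<in> {1..n}"
      hence k: "k \<ge> 1" by simp
      define x where "x = (T n)\<^sup>2 / (4 * real k)"
      have x0: "x \<ge> 0" by (simp add: x_def)
      have "\<bar>exp (- x) - (1 - x)\<bar> \<le> x\<^sup>2"
      proof -
        have "1 - x \<le> exp (- x)" using exp_ge_add_one_self[of "- x"] by simp
        moreover have "exp (- x) \<le> 1 - x + x\<^sup>2"
        proof -
          have "exp (- x) * (1 + x) \<le> 1" using exp_ge_add_one_self[of x] 
            by (simp add: exp_minus field_simps)
          hence "exp (- x) \<le> 1 / (1 + x)" using x0 by (simp add: field_simps)
          also have "\<dots> \<le> 1 - x + x\<^sup>2"
          proof -
            have "(1 - x + x\<^sup>2) * (1 + x) = 1 + x ^ 3" by
                (simp add: power2_eq_square power3_eq_cube algebra_simps)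
            thus ?thesis using x0 by (simp add: divide_le_eq)
          qed
          finally show ?thesis .
        qed
        ultimately show ?thesis by simp
      qed
      hence e: "cmod (of_real (1 - x) - of_real (exp (- x))) \<le> x\<^sup>2"
        unfolding of_real_diff[symmetric] norm_of_real by (simp add: abs_minus_commute)
      have "sqrt (real k) \<le> real k" using k by (intro real_le_lsqrt) (auto simp: power2_eq_square)
      hence "real k * sqrt (real k) \<le> real k * real k" by (intro mult_left_mono) auto
      also have "\<dots> \<le> 16 * (real k * real k)" by simp
      finally have "real k * sqrt (real k) \<le> 16 * (real k * real k)" .
      hence "(T n) ^ 4 / (16 * (real k * real k)) \<le> (T n) ^ 4 / (real k * sqrt (real k))"
        using k by (intro divide_left_mono) auto
      moreover have "x\<^sup>2 = (T n) ^ 4 / (16 * (real k * real k))"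
        by (simp add: x_def power_divide power2_eq_square power4_eq_xxxx mult.assoc)
      ultimately have e2: "cmod (of_real (1 - x) - of_real (exp (- x))) \<le> (T n) ^ 4 / (real k
          * sqrt (real k))"
        using e by linarith
      have "cmod (\<psi> k t - of_real (exp (- x))) \<le> cmod (\<psi> k t - of_real (1 - x))
          + cmod (of_real (1 - x) - of_real (exp (- x)))"
        using norm_triangle_ineq[of "\<psi> k t - of_real (1 - x)" "of_real (1 - x) - of_real (exp (- x))"] by simp
      also have "\<dots> \<le> 3 * (T n)\<^sup>2 * (1 + T n) / (real k * sqrt (real k)) + (T n) ^ 4 / (real k
          * sqrt (real k))"
        using approx[OF k, of t] e2 unfolding t x_def by linarith
      finally show "cmod (\<psi> k t - of_real (exp (- ((T n)\<^sup>2 / (4 * real k)))))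
          \<le> (3 * (T n)\<^sup>2 * (1 + T n) + (T n) ^ 4) * (1 / (real k * sqrt (real k)))"
        by (simp add: x_def add_divide_distrib)
    qed
    also have "\<dots> = (3 * (T n)\<^sup>2 * (1 + T n) + (T n) ^ 4) * (\<Sum>k=1..n. 1 / (real k * sqrt (real k)))"
      by (simp only: sum_distrib_left)
    also have "\<dots> \<le> (3 * (T n)\<^sup>2 * (1 + T n) + (T n) ^ 4) * S"
      unfolding S_def using T0 
      by (intro mult_left_mono sum_le_suminf summable_inverse_three_halves) auto
    finally show ?thesis by (simp add: t_def)
  qed
  have "(\<lambda>n. (3 * (T n)\<^sup>2 * (1 + T n) + (T n) ^ 4) * S) \<longlonglongrightarrow> (3 * 0\<^sup>2 * (1 + 0) + 0 ^ 4) * S"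
    by (intro tendsto_intros T_lim)
  hence bound_lim: "(\<lambda>n. (3 * (T n)\<^sup>2 * (1 + T n) + (T n) ^ 4) * S) \<longlonglongrightarrow> 0" by simp
  have "(\<lambda>n. (\<Prod>k=1..n. \<psi> k (u / of_real (sqrt (ln (real n) / 2)))) - of_real (\<Prod>k=1..n. exp (- ((T n)\<^sup>2 /
      (4 * real k))))) \<longlonglongrightarrow> 0"
    by (rule Lim_null_comparison[OF _ bound_lim])
       (use eventually_ge_at_top[of 2] in eventually_elim, rule diff)
  moreover have "(\<lambda>n. complex_of_real (\<Prod>k=1..n. exp (- ((T n)\<^sup>2 / (4 * real k)))))
      \<longlonglongrightarrow> of_real (exp (- (cmod u)\<^sup>2 / 2))"
  proof (intro tendsto_of_real)
    have "(\<lambda>n. (harm n - ln (real n)) * (1 / ln (real n))) \<longlonglongrightarrow> euler_mascheroni * 0"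
      by (intro tendsto_mult euler_mascheroni_LIMSEQ) real_asymp
    from tendsto_add[OF tendsto_const[of "1 :: real"] this]
    have "(\<lambda>n. 1 + (harm n - ln (real n)) * (1 / ln (real n))) \<longlonglongrightarrow> 1 + (0 :: real)"
      by (simp only: mult_zero_right)
    moreover have "\<forall>\<^sub>F n in sequentially. 1 + (harm n - ln (real n)) * (1 / ln (real n))
        = harm n / ln (real n)"
      using eventually_ge_at_top[of 2]
    proof eventually_elim
      case (elim n)
      have "ln (real n) > 0" using elim by simp
      thus ?case by (simp add: diff_divide_distrib)
    qed
    ultimately have "(\<lambda>n. harm n / ln (real n)) \<longlonglongrightarrow> 1 + (0::real)" by (rule Lim_transform_eventually)
    from tendsto_exp[OF tendsto_mult[OF tendsto_const[of "- ((cmod u)\<^sup>2 / 2)"] this]]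
    have "(\<lambda>n. exp (- ((cmod u)\<^sup>2 / 2) * (harm n / ln (real n)))) \<longlonglongrightarrow> exp (- ((cmod u)\<^sup>2 / 2) * (1 + 0))" .
    moreover have "\<forall>\<^sub>F n in sequentially. exp (- ((cmod u)\<^sup>2 / 2) * (harm n / ln (real n)))
        = (\<Prod>k=1..n. exp (- ((T n)\<^sup>2 / (4 * real k))))"
      using eventually_ge_at_top[of 2]
    proof eventually_elim
      case (elim n)
      have l: "ln (real n) > 0" using elim by simp
      have T2: "(T n)\<^sup>2 = 2 * (cmod u)\<^sup>2 / ln (real n)" using l by (simp add: T_def power_divide)
      have "(\<Prod>k=1..n. exp (- ((T n)\<^sup>2 / (4 * real k)))) = exp (\<Sum>k=1..n. - ((T n)\<^sup>2 / 4) * inverse (real k))"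
        unfolding exp_sum[OF finite_atLeastAtMost] by (intro prod.cong refl arg_cong[where f = exp])
            (simp add: field_simps)
      also have "\<dots> = exp (- ((T n)\<^sup>2 / 4) * harm n)" by (simp only: sum_distrib_left harm_def)
      finally show ?case by (simp add: T2)
    qed
    ultimately have "(\<lambda>n. \<Prod>k=1..n. exp (- ((T n)\<^sup>2 / (4 * real k)))) \<longlonglongrightarrow> exp (- ((cmod u)\<^sup>2 / 2) * (1 + 0))"
      by (rule Lim_transform_eventually)
    thus "(\<lambda>n. \<Prod>k=1..n. exp (- ((T n)\<^sup>2 / (4 * real k)))) \<longlonglongrightarrow> exp (- (cmod u)\<^sup>2 / 2)" by simp
  qed
  ultimately have "(\<lambda>n. (\<Prod>k=1..n. \<psi> k (u / of_real (sqrt (ln (real n) / 2)))) - of_real (\<Prod>k=1..n. exp (-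
      ((T n)\<^sup>2 / (4 * real k))))
      + of_real (\<Prod>k=1..n. exp (- ((T n)\<^sup>2 / (4 * real k))))) \<longlonglongrightarrow> 0 + of_real (exp (- (cmod u)\<^sup>2 / 2))"
    by (rule tendsto_add)
  thus ?thesis by (simp only: diff_add_cancel add_0_left)
qed

text \<open>For \<open>k\<close> this large the error is at most half of the Gaussian term \<open>|t|^2 / (4 k)\<close>.\<close>

lemma factor_decay:
  assumes k: "k \<ge> 1" and large: "24 * (1 + cmod t) \<le> sqrt (real k)"
  shows "cmod (\<psi> k t) \<le> exp (- ((cmod t)\<^sup>2 / (8 * real k)))"
proof -
  define T where "T = cmod t"
  have T0: "T \<ge> 0" by (simp add: T_def)
  have k0: "real k > 0" using k by simp
  have "T \<le> 24 * (1 + T)" using T0 by simp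
  also have "\<dots> \<le> sqrt (real k)" using large by (simp only: T_def)
  finally have "T \<le> sqrt (real k)" .
  hence "T\<^sup>2 \<le> (sqrt (real k))\<^sup>2" using T0 by (intro power_mono) auto
  hence "T\<^sup>2 \<le> real k" by simp
  hence sm: "T\<^sup>2 / (4 * real k) \<le> 1" using k0 by simp
  have "3 * T\<^sup>2 * (1 + T) / (real k * sqrt (real k)) = T\<^sup>2 / (8 * real k) * (24 * (1 + T) / sqrt (real k))"
    using k0 by (simp add: field_simps)
  also have "\<dots> \<le> T\<^sup>2 / (8 * real k) * 1"
    using large k0 by (intro mult_left_mono) (auto simp: T_def)
  finally have a: "cmod (\<psi> k t - of_real (1 - T\<^sup>2 / (4 * real k))) \<le> T\<^sup>2 / (8 * real k)"
    using approx[OF k, of t] by (simp add: T_def)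
  have "cmod (\<psi> k t) \<le> cmod (\<psi> k t - of_real (1 - T\<^sup>2 / (4 * real k))) + cmod (of_real (1 - T\<^sup>2 / (4
      * real k)))"
    using norm_triangle_sub[of "\<psi> k t"] by (simp add: add.commute)
  also have "cmod (of_real (1 - T\<^sup>2 / (4 * real k))) = 1 - T\<^sup>2 / (4 * real k)"
    unfolding norm_of_real using sm by simp
  also have "cmod (\<psi> k t - of_real (1 - T\<^sup>2 / (4 * real k))) + (1 - T\<^sup>2 / (4 * real k)) \<le> 1
      + - (T\<^sup>2 / (8 * real k))"
    using a by simp
  also have "\<dots> \<le> exp (- (T\<^sup>2 / (8 * real k)))" by (rule exp_ge_add_one_self)
  finally show ?thesis by (simp add: T_def)
qed

text \<open>Only the factors with \<open>k \<ge> sqrt n\<close> are used. For these \<open>t\<close> they all decay, and the sum of \<open>1 / k\<close>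
over them is still about half of \<open>ln n\<close>.\<close>

lemma product_decay:
  assumes n: "n \<ge> 16" and t: "24 * (1 + cmod t) \<le> sqrt (sqrt (real n))"
  shows "cmod (\<Prod>k=1..n. \<psi> k t) \<le> exp (- ((cmod t)\<^sup>2 * ln (real n) / 32))"
proof -
  \<comment> \<open>the first factor that is used; the hypothesis on \<open>t\<close> makes it and all later factors decay\<close>
  define m where "m = nat \<lceil>sqrt (real n)\<rceil>"
  have sn: "sqrt (real n) \<ge> 4" using n by (intro real_le_rsqrt) auto
  have m1: "sqrt (real n) \<le> real m" "real m \<le> sqrt (real n) + 1" using sn by (auto simp: m_def)
  have m2: "m \<ge> 1" using m1 sn by (simp add: Suc_le_eq)
  have "sqrt (real n) * 4 \<le> sqrt (real n) * sqrt (real n)" using sn by (intro mult_left_mono) auto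
  hence "sqrt (real n) * 4 \<le> real n" by simp
  hence mn: "m \<le> n" using m1 sn by linarith
  have "cmod (\<Prod>k=1..n. \<psi> k t) = (\<Prod>k=1..n. cmod (\<psi> k t))" by (simp add: prod_norm)
  also have "\<dots> = (\<Prod>k\<in>{1..n} - {m..n}. cmod (\<psi> k t)) * (\<Prod>k=m..n. cmod (\<psi> k t))"
    using m2 by (subst prod.subset_diff[of "{m..n}"]) auto
  also have "\<dots> \<le> 1 * (\<Prod>k=m..n. exp (- ((cmod t)\<^sup>2 / (8 * real k))))"
  proof (intro mult_mono prod_le_1 prod_mono conjI)
    fix k assume k: "k \<in> {m..n}"
    hence "sqrt (sqrt (real n)) \<le> sqrt (real k)" using m1 by simp
    hence "24 * (1 + cmod t) \<le> sqrt (real k)" using t by linarith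
    thus "cmod (\<psi> k t) \<le> exp (- ((cmod t)\<^sup>2 / (8 * real k)))" using k m2 by (intro factor_decay) auto
  qed (use le_one in \<open>auto intro!: prod_nonneg\<close>)
  also have "\<dots> = exp (- ((cmod t)\<^sup>2 / 8) * (\<Sum>k=m..n. 1 / real k))"
    by (simp add: exp_sum[symmetric] sum_distrib_left sum_negf)
  also have "\<dots> \<le> exp (- ((cmod t)\<^sup>2 / 8) * (ln (real n) / 4))"
  proof -
    have "ln (real n) / 4 \<le> (\<Sum>k=m..n. 1 / real k)"
    proof -
      have "ln 2 \<le> ln (real n) / 4"
      proof -
        have "4 * ln 2 = ln (2 ^ 4 :: real)" by (subst ln_realpow) auto
        also have "\<dots> \<le> ln (real n)" using n by simp
        finally show ?thesis by simp
      qed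
      moreover have "ln (real m) \<le> ln (2 * sqrt (real n))"
      proof -
        have "real m \<le> 2 * sqrt (real n)" using m1 sn by linarith
        thus ?thesis using m2 by (intro ln_mono) auto
      qed
      moreover have "ln (2 * sqrt (real n)) = ln 2 + ln (real n) / 2" using n by (simp add: ln_mult ln_sqrt)
      moreover have "ln (real n / real m) = ln (real n) - ln (real m)" using n m2 by
          (intro ln_divide_pos) auto
      ultimately show ?thesis using ln_quotient_le_harmonic_sum[OF m2 mn] by linarith
    qed
    hence "(cmod t)\<^sup>2 / 8 * (ln (real n) / 4) \<le> (cmod t)\<^sup>2 / 8 * (\<Sum>k=m..n. 1 / real k)"
      by (intro mult_left_mono) auto
    thus ?thesis by simp
  qed
  finally show ?thesis by simp
qed

text \<open>As long as \<open>T = |u| / sqrt N\<close> is below a small power of \<open>n\<close>, the product itself decays like a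
Gaussian. For larger \<open>T\<close>, where the product is only known to be bounded, the kernel supplies the
decay: then \<open>N \<le> T\<close>, so that \<open>|u|^2 \<le> T^3\<close>, and any power of \<open>T\<close> is absorbed.\<close>

lemma product_domination:
  assumes d: "\<delta> > 0"
  shows "\<forall>\<^sub>F n in sequentially. \<forall>u. cmod (\<Prod>k=1..n. \<psi> k (u / of_real (sqrt (ln (real n) / 2))))
      * exp (- (\<delta>\<^sup>2 * (cmod u)\<^sup>2 / (2 * (ln (real n) / 2)))) \<le> exp (- (cmod u)\<^sup>2 / 16) + 1 / (1
          + (cmod u)\<^sup>2)\<^sup>2"
proof -
  have "((\<lambda>T. exp (- (\<delta>\<^sup>2 / 2 * T\<^sup>2)) * (1 + T ^ 3)\<^sup>2) \<longlongrightarrow> 0) at_top"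
    using d by real_asymp
  hence "\<forall>\<^sub>F T in at_top. exp (- (\<delta>\<^sup>2 / 2 * T\<^sup>2)) * (1 + T ^ 3)\<^sup>2 < 1"
    by (rule order_tendstoD(2)) simp
  then obtain T0 where T0: "\<And>T. T \<ge> T0 \<Longrightarrow> exp (- (\<delta>\<^sup>2 / 2 * T\<^sup>2)) * (1 + T ^ 3)\<^sup>2 < 1"
    by (auto simp: eventually_at_top_linorder)
  have "filterlim (\<lambda>n. sqrt (sqrt (real n)) / 24 - 1) at_top sequentially" by real_asymp
  hence "\<forall>\<^sub>F n in sequentially. T0 \<le> sqrt (sqrt (real n)) / 24 - 1" by (simp add: filterlim_at_top)
  moreover have "\<forall>\<^sub>F n in sequentially. ln (real n) / 2 \<le> sqrt (sqrt (real n)) / 24 - 1" by real_asymp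
  ultimately show ?thesis using eventually_ge_at_top[of 16]
  proof eventually_elim
    case (elim n)
    define N where "N = ln (real n) / 2"
    have N: "N > 0" using elim by (simp add: N_def)
    show ?case
    proof
      fix u :: complex
      define T where "T = cmod u / sqrt N"
      define t where "t = u / of_real (sqrt N)"
      have t: "cmod t = T" using N by (simp add: t_def T_def norm_divide)
      have T00: "T \<ge> 0" using N by (simp add: T_def)
      have T2: "T\<^sup>2 = (cmod u)\<^sup>2 / N" using N by (simp add: T_def power_divide)
      have "cmod (\<Prod>k=1..n. \<psi> k t) * exp (- (\<delta>\<^sup>2 * (cmod u)\<^sup>2 / (2 * N)))
          \<le> exp (- (cmod u)\<^sup>2 / 16) + 1 / (1 + (cmod u)\<^sup>2)\<^sup>2"
      proof (cases "24 * (1 + T) \<le> sqrt (sqrt (real n))")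
        case True
        have "cmod (\<Prod>k=1..n. \<psi> k t) * exp (- (\<delta>\<^sup>2 * (cmod u)\<^sup>2 / (2 * N))) \<le> exp (- ((cmod t)\<^sup>2
            * ln (real n) / 32)) * 1"
          using True elim t N by (intro mult_mono product_decay) auto
        also have "(cmod t)\<^sup>2 * ln (real n) / 32 = (cmod u)\<^sup>2 / 16"
          using N by (simp add: t T2) (simp add: N_def)
        finally show ?thesis by (simp add: add_increasing2)
      next
        case False
        hence TN: "T > sqrt (sqrt (real n)) / 24 - 1" by simp
        hence "T \<ge> T0" "N \<le> T" using elim by (auto simp: N_def)
        have "cmod (\<Prod>k=1..n. \<psi> k t) = (\<Prod>k=1..n. cmod (\<psi> k t))" by (simp add: prod_norm)
        also have "\<dots> \<le> 1" using le_one by (intro prod_le_1) auto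
        finally have "cmod (\<Prod>k=1..n. \<psi> k t) * exp (- (\<delta>\<^sup>2 / 2 * T\<^sup>2)) \<le> 1 * exp (- (\<delta>\<^sup>2 / 2 * T\<^sup>2))"
          by (intro mult_right_mono) auto
        also have "1 * exp (- (\<delta>\<^sup>2 / 2 * T\<^sup>2)) \<le> 1 / (1 + T ^ 3)\<^sup>2"
        proof -
          have "0 < 1 + T ^ 3" using T00 by (intro add_pos_nonneg) auto
          hence "0 < (1 + T ^ 3)\<^sup>2" by (rule zero_less_power)
          thus ?thesis using T0[OF \<open>T \<ge> T0\<close>] by (simp add: pos_le_divide_eq)
        qed
        also have "\<dots> \<le> 1 / (1 + (cmod u)\<^sup>2)\<^sup>2"
        proof -
          have "(cmod u)\<^sup>2 = T\<^sup>2 * N" using N by (simp add: T2)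
          also have "\<dots> \<le> T\<^sup>2 * T" using \<open>N \<le> T\<close> by (intro mult_left_mono) auto
          finally have "(cmod u)\<^sup>2 \<le> T ^ 3" by (simp add: power2_eq_square power3_eq_cube)
          hence "(1 + (cmod u)\<^sup>2)\<^sup>2 \<le> (1 + T ^ 3)\<^sup>2" by (intro power_mono) auto
          moreover have "0 < (1 + (cmod u)\<^sup>2)\<^sup>2" by (intro zero_less_power add_pos_nonneg) auto
          ultimately show ?thesis by (intro divide_left_mono mult_pos_pos) auto
        qed
        finally have "cmod (\<Prod>k=1..n. \<psi> k t) * exp (- (\<delta>\<^sup>2 / 2 * T\<^sup>2)) \<le> 1 / (1 + (cmod u)\<^sup>2)\<^sup>2" .
        moreover have "\<delta>\<^sup>2 / 2 * T\<^sup>2 = \<delta>\<^sup>2 * (cmod u)\<^sup>2 / (2 * N)" by (simp add: T2)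
        ultimately have "cmod (\<Prod>k=1..n. \<psi> k t) * exp (- (\<delta>\<^sup>2 * (cmod u)\<^sup>2 / (2 * N))) \<le> 1 / (1
            + (cmod u)\<^sup>2)\<^sup>2"
          by (simp only:)
        thus ?thesis using exp_ge_zero[of "- (cmod u)\<^sup>2 / 16"] by linarith
      qed
      thus "cmod (\<Prod>k=1..n. \<psi> k (u / of_real (sqrt (ln (real n) / 2))))
          * exp (- (\<delta>\<^sup>2 * (cmod u)\<^sup>2 / (2 * (ln (real n) / 2)))) \<le> exp (- (cmod u)\<^sup>2 / 16) + 1 / (1
              + (cmod u)\<^sup>2)\<^sup>2"
        by (simp only: t_def N_def)
    qed
  qed
qed

end

section \<open>Gaussian kernels on the complex plane\<close>

lemma lborel_complex_eq_distr:
  "(lborel :: complex measure) = distr (lborel \<Otimes>\<^sub>M lborel) borel (\<lambda>(x, y). Complex x y)"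
proof (rule lborel_eqI)
  have m: "(\<lambda>(x, y). Complex x y) \<in> measurable (lborel \<Otimes>\<^sub>M lborel) (borel :: complex measure)"
  proof -
    have "(\<lambda>z :: real \<times> real. complex_of_real (fst z) + \<i> * complex_of_real (snd z))
        \<in> measurable (lborel \<Otimes>\<^sub>M lborel) borel"
      by measurable
    thus ?thesis by (simp add: Complex_eq case_prod_beta)
  qed
  fix l u :: complex assume le: "\<And>b. b \<in> Basis \<Longrightarrow> l \<bullet> b \<le> u \<bullet> b"
  have le': "Re l \<le> Re u" "Im l \<le> Im u"
    using le[of 1] le[of \<i>] by (auto simp: Basis_complex_def inner_complex_def)
  have "(\<lambda>(x, y). Complex x y) -` box l u \<inter> space (lborel \<Otimes>\<^sub>M lborel) = {Re l<..<Re u} \<times> {Im l<..<Im u}"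
    by (auto simp: in_box_complex_iff space_pair_measure)
  hence "emeasure (distr (lborel \<Otimes>\<^sub>M lborel) borel (\<lambda>(x, y). Complex x y)) (box l u)
     = emeasure (lborel \<Otimes>\<^sub>M lborel) ({Re l<..<Re u} \<times> {Im l<..<Im u})"
    using m by (subst emeasure_distr) auto
  also have "\<dots> = ennreal (Re u - Re l) * ennreal (Im u - Im l)"
    using le' by (subst lborel.emeasure_pair_measure_Times) auto
  also have "\<dots> = ennreal (\<Prod>b\<in>Basis. (u - l) \<bullet> b)"
    using le' by (simp add: Basis_complex_def inner_complex_def ennreal_mult)
  finally show "emeasure (distr (lborel \<Otimes>\<^sub>M lborel) borel (\<lambda>(x, y). Complex x y)) (box l u)
     = ennreal (\<Prod>b\<in>Basis. (u - l) \<bullet> b)" .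
qed simp

lemma measurable_Complex_pair [measurable]:
  "(\<lambda>(x, y). Complex x y) \<in> measurable (lborel \<Otimes>\<^sub>M lborel) (borel :: complex measure)"
proof -
  have "(\<lambda>z :: real \<times> real. complex_of_real (fst z) + \<i> * complex_of_real (snd z))
      \<in> measurable (lborel \<Otimes>\<^sub>M lborel) borel"
    by measurable
  thus ?thesis by (simp add: Complex_eq case_prod_beta)
qed

lemma complex_product_integral:
  fixes f g :: "real \<Rightarrow> complex"
  assumes f: "integrable lborel f" and g: "integrable lborel g"
  shows "integrable lborel (\<lambda>z. f (Re z) * g (Im z))"
    and "(\<integral>z. f (Re z) * g (Im z) \<partial>lborel) = (\<integral>x. f x \<partial>lborel) * (\<integral>y. g y \<partial>lborel)"
proof -
  have [measurable]: "f \<in> borel_measurable borel" "g \<in> borel_measurable borel"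
    using f g by (auto dest: borel_measurable_integrable)
  have fg: "(\<lambda>z. f (Re z) * g (Im z)) \<in> borel_measurable borel" by measurable
  have int: "integrable (lborel \<Otimes>\<^sub>M lborel) (\<lambda>(x, y). f x * g y)"
  proof (rule lborel_pair.Fubini_integrable)
    show "(\<lambda>(x, y). f x * g y) \<in> borel_measurable (lborel \<Otimes>\<^sub>M lborel)" by measurable
    show "integrable lborel (\<lambda>x. \<integral>y. norm (case (x, y) of (x, y) \<Rightarrow> f x * g y) \<partial>lborel)"
      using f by (simp add: norm_mult)
    show "AE x in lborel. integrable lborel (\<lambda>y. case (x, y) of (x, y) \<Rightarrow> f x * g y)"
      using g by simp
  qed
  have e: "(\<lambda>p. f (Re (case p of (x, y) \<Rightarrow> Complex x y)) * g (Im (case p of (x, y) \<Rightarrow> Complex x y)))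
      = (\<lambda>(x, y). f x * g y)" by auto
  show "integrable lborel (\<lambda>z. f (Re z) * g (Im z))"
    unfolding lborel_complex_eq_distr
    using int by (subst integrable_distr_eq[OF measurable_Complex_pair fg]) (simp only: e)
  have "(\<integral>z. f (Re z) * g (Im z) \<partial>lborel) = (\<integral>p. (case p of (x, y) \<Rightarrow> f x * g y) \<partial>(lborel \<Otimes>\<^sub>M lborel))"
    unfolding lborel_complex_eq_distr
    by (subst integral_distr[OF measurable_Complex_pair fg]) (simp only: e)
  also have "\<dots> = (\<integral>x. (\<integral>y. f x * g y \<partial>lborel) \<partial>lborel)"
    using lborel_pair.integral_fst[OF int] by simp
  also have "\<dots> = (\<integral>x. f x \<partial>lborel) * (\<integral>y. g y \<partial>lborel)" by simp
  finally show "(\<integral>z. f (Re z) * g (Im z) \<partial>lborel) = (\<integral>x. f x \<partial>lborel) * (\<integral>y. g y \<partial>lborel)" .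
qed

lemma real_gaussian_fourier:
  assumes d: "\<delta> > 0"
  shows "integrable lborel (\<lambda>t. cis (t * x) * of_real (exp (- (\<delta>\<^sup>2 * t\<^sup>2 / 2))))"
    and "(\<integral>t. cis (t * x) * of_real (exp (- (\<delta>\<^sup>2 * t\<^sup>2 / 2))) \<partial>lborel)
        = of_real (sqrt (2 * pi) / \<delta> * exp (- (x\<^sup>2 / (2 * \<delta>\<^sup>2))))"
proof -
  have std: "integrable lborel (\<lambda>t. cis (t * x) * of_real (exp (- (t\<^sup>2 / 2))))"
    "(\<integral>t. cis (t * x) * of_real (exp (- (t\<^sup>2 / 2))) \<partial>lborel) = of_real (sqrt (2 * pi)
        * exp (- (x\<^sup>2 / 2)))" for x
  proof -
    have dens: "cis (t * x) * of_real (exp (- (t\<^sup>2 / 2))) = sqrt (2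
        * pi) *\<^sub>R (std_normal_density t *\<^sub>R cis (t * x))" for t
      by (simp add: std_normal_density_def scaleR_conv_of_real)
    have "integrable lborel (\<lambda>t. std_normal_density t *\<^sub>R cis (t * x))"
    proof (rule Bochner_Integration.integrable_bound)
      show "integrable lborel std_normal_density" by (rule integrable_normal_density) simp
    qed (auto simp: normal_density_nonneg)
    thus "integrable lborel (\<lambda>t. cis (t * x) * of_real (exp (- (t\<^sup>2 / 2))))"
      unfolding dens by (intro Bochner_Integration.integrable_scaleR_right) auto
    have "(\<integral>t. std_normal_density t *\<^sub>R cis (t * x) \<partial>lborel) = char std_normal_distribution x"
      unfolding char_def by (subst integral_density)
          (auto simp: normal_density_nonneg cis_conv_exp mult.commute)
    also have "\<dots> = of_real (exp (- (x\<^sup>2 / 2)))" by (simp add: char_std_normal_distribution)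
    finally show "(\<integral>t. cis (t * x) * of_real (exp (- (t\<^sup>2 / 2))) \<partial>lborel) = of_real (sqrt (2 * pi)
        * exp (- (x\<^sup>2 / 2)))"
      unfolding dens by (simp add: scaleR_conv_of_real)
  qed
  define f where "f t = cis (t * (x / \<delta>)) * complex_of_real (exp (- (t\<^sup>2 / 2)))" for t
  have fd: "f (0 + \<delta> * t) = cis (t * x) * of_real (exp (- (\<delta>\<^sup>2 * t\<^sup>2 / 2)))" for t
    using d by (simp add: f_def power_mult_distrib)
  have f: "integrable lborel f" "(\<integral>t. f t \<partial>lborel) = of_real (sqrt (2 * pi) * exp (- ((x / \<delta>)\<^sup>2 / 2)))"
    using std[of "x / \<delta>"] by (simp_all add: f_def[abs_def])
  show "integrable lborel (\<lambda>t. cis (t * x) * of_real (exp (- (\<delta>\<^sup>2 * t\<^sup>2 / 2))))"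
    using lborel_integrable_real_affine[OF f(1), of \<delta> 0] d unfolding fd by simp
  have "(\<integral>t. f t \<partial>lborel) = \<bar>\<delta>\<bar> *\<^sub>R (\<integral>t. f (0 + \<delta> * t) \<partial>lborel)"
    using d by (intro lborel_integral_real_affine) simp
  hence "of_real \<delta> * (\<integral>t. cis (t * x) * of_real (exp (- (\<delta>\<^sup>2 * t\<^sup>2 / 2))) \<partial>lborel) = of_real (sqrt (2
      * pi) * exp (- ((x / \<delta>)\<^sup>2 / 2)))"
    using d f(2) unfolding fd by (simp add: scaleR_conv_of_real)
  moreover have "(x / \<delta>)\<^sup>2 / 2 = x\<^sup>2 / (2 * \<delta>\<^sup>2)" by (simp add: power_divide)
  ultimately show "(\<integral>t. cis (t * x) * of_real (exp (- (\<delta>\<^sup>2 * t\<^sup>2 / 2))) \<partial>lborel)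
        = of_real (sqrt (2 * pi) / \<delta> * exp (- (x\<^sup>2 / (2 * \<delta>\<^sup>2))))"
    using d by (simp add: field_simps)
qed

lemma complex_gaussian_fourier:
  fixes z :: complex
  assumes d: "\<delta> > 0"
  shows "integrable lborel (\<lambda>t. cis (t \<bullet> z) * of_real (exp (- (\<delta>\<^sup>2 * (cmod t)\<^sup>2 / 2))))"
    and "(\<integral>t. cis (t \<bullet> z) * of_real (exp (- (\<delta>\<^sup>2 * (cmod t)\<^sup>2 / 2))) \<partial>lborel)
        = of_real (2 * pi / \<delta>\<^sup>2 * exp (- ((cmod z)\<^sup>2 / (2 * \<delta>\<^sup>2))))"
proof -
  define F where "F x t = cis (t * x) * complex_of_real (exp (- (\<delta>\<^sup>2 * t\<^sup>2 / 2)))" for x t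
  have eq: "cis (t \<bullet> z) * of_real (exp (- (\<delta>\<^sup>2 * (cmod t)\<^sup>2 / 2))) = F (Re z) (Re t) * F (Im z) (Im t)" for t
  proof -
    have "exp (- (\<delta>\<^sup>2 * (cmod t)\<^sup>2 / 2)) = exp (- (\<delta>\<^sup>2 * (Re t)\<^sup>2 / 2)) * exp (- (\<delta>\<^sup>2 * (Im t)\<^sup>2 / 2))"
      unfolding exp_add[symmetric] cmod_power2 by (intro arg_cong[where f = exp]) (simp add: field_simps)
    moreover have "cis (t \<bullet> z) = cis (Re t * Re z) * cis (Im t * Im z)"
      by (simp add: cis_mult inner_complex_def)
    ultimately show ?thesis by (simp add: F_def)
  qed
  have F: "integrable lborel (F x)" "(\<integral>t. F x t \<partial>lborel) = of_real (sqrt (2 * pi) / \<delta> * exp (- (x\<^sup>2 / (2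
      * \<delta>\<^sup>2))))" for x
    using real_gaussian_fourier[OF d, of x] by (simp_all add: F_def[abs_def])
  show "integrable lborel (\<lambda>t. cis (t \<bullet> z) * of_real (exp (- (\<delta>\<^sup>2 * (cmod t)\<^sup>2 / 2))))"
    unfolding eq by (rule complex_product_integral(1)[OF F(1) F(1)])
  have "(\<integral>t. cis (t \<bullet> z) * of_real (exp (- (\<delta>\<^sup>2 * (cmod t)\<^sup>2 / 2))) \<partial>lborel)
      = of_real (sqrt (2 * pi) / \<delta> * exp (- ((Re z)\<^sup>2 / (2 * \<delta>\<^sup>2))) * (sqrt (2 * pi) / \<delta>
          * exp (- ((Im z)\<^sup>2 / (2 * \<delta>\<^sup>2)))))"
    unfolding eq complex_product_integral(2)[OF F(1) F(1)] F(2) by simp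
  also have "sqrt (2 * pi) / \<delta> * exp (- ((Re z)\<^sup>2 / (2 * \<delta>\<^sup>2))) * (sqrt (2 * pi) / \<delta>
      * exp (- ((Im z)\<^sup>2 / (2 * \<delta>\<^sup>2))))
     = (sqrt (2 * pi) * sqrt (2 * pi)) / \<delta>\<^sup>2 * (exp (- ((Re z)\<^sup>2 / (2 * \<delta>\<^sup>2))) * exp (- ((Im z)\<^sup>2 / (2
         * \<delta>\<^sup>2))))"
    by (simp add: power2_eq_square)
  also have "exp (- ((Re z)\<^sup>2 / (2 * \<delta>\<^sup>2))) * exp (- ((Im z)\<^sup>2 / (2 * \<delta>\<^sup>2))) = exp (- ((cmod z)\<^sup>2 / (2
      * \<delta>\<^sup>2)))"
    unfolding exp_add[symmetric] cmod_power2 by (intro arg_cong[where f = exp]) (simp add: add_divide_distrib)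
  also have "sqrt (2 * pi) * sqrt (2 * pi) = 2 * pi" by simp
  finally show "(\<integral>t. cis (t \<bullet> z) * of_real (exp (- (\<delta>\<^sup>2 * (cmod t)\<^sup>2 / 2))) \<partial>lborel)
        = of_real (2 * pi / \<delta>\<^sup>2 * exp (- ((cmod z)\<^sup>2 / (2 * \<delta>\<^sup>2))))" .
qed

text \<open>The kernel is not normalized: its total mass is \<open>2 \<pi> \<delta>^2\<close>.\<close>

definition gauss :: "real \<Rightarrow> complex \<Rightarrow> real" where
  "gauss \<delta> z = exp (- ((cmod z)\<^sup>2 / (2 * \<delta>\<^sup>2)))"

lemma measurable_gauss [measurable]: "gauss \<delta> \<in> borel_measurable borel"
proof -
  have "(\<lambda>z. exp (- ((cmod z)\<^sup>2 / (2 * \<delta>\<^sup>2)))) \<in> borel_measurable borel" by measurable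
  thus ?thesis by (simp add: gauss_def[abs_def])
qed

lemma gauss_bounds: "0 < gauss \<delta> z" "gauss \<delta> z \<le> 1" by (auto simp: gauss_def)

lemma gauss_integral:
  assumes d: "\<delta> > 0"
  shows "integrable lborel (\<lambda>y. gauss \<delta> (x - y))" and "(\<integral>y. gauss \<delta> (x - y) \<partial>lborel) = 2 * pi * \<delta>\<^sup>2"
proof -
  have e: "cis (t \<bullet> 0) * of_real (exp (- ((1 / \<delta>)\<^sup>2 * (cmod t)\<^sup>2 / 2))) = complex_of_real (gauss \<delta> t)" for t
    by (simp add: gauss_def power_divide field_simps)
  have i0: "integrable lborel (gauss \<delta>)"
    using complex_gaussian_fourier(1)[of "1 / \<delta>" 0] d unfolding e by (simp add: complex_of_real_integrable_eq)
  have "complex_of_real (\<integral>t. gauss \<delta> t \<partial>lborel) = of_real (2 * pi * \<delta>\<^sup>2)"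
    using complex_gaussian_fourier(2)[of "1 / \<delta>" 0] d unfolding e integral_complex_of_real by
        (simp add: power_divide)
  hence v0: "(\<integral>t. gauss \<delta> t \<partial>lborel) = 2 * pi * \<delta>\<^sup>2" using of_real_eq_iff by blast
  have shift: "distr lborel borel (\<lambda>y. (- x) + y) = (lborel :: complex measure)"
    by (rule lborel_distr_plus)
  have g: "gauss \<delta> (x - y) = gauss \<delta> ((- x) + y)" for y by (simp add: gauss_def norm_minus_commute)
  show "integrable lborel (\<lambda>y. gauss \<delta> (x - y))"
    unfolding g using i0 by (subst integrable_distr_eq[where N = borel and g = "\<lambda>y. (- x)
        + y", symmetric]) (simp_all only: shift, measurable)
  have "(\<integral>y. gauss \<delta> (x - y) \<partial>lborel) = (\<integral>y. gauss \<delta> y \<partial>distr lborel borel (\<lambda>y. (- x) + y))"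
    unfolding g by (rule integral_distr[symmetric]) measurable
  thus "(\<integral>y. gauss \<delta> (x - y) \<partial>lborel) = 2 * pi * \<delta>\<^sup>2" using v0 by (simp only: shift)
qed

lemma complex_integral_scale:
  fixes f :: "complex \<Rightarrow> 'b :: {banach, second_countable_topology}"
  assumes c: "c > 0" and f: "f \<in> borel_measurable borel"
  shows "(\<integral>t. f t \<partial>lborel) = c\<^sup>2 *\<^sub>R (\<integral>u. f (c *\<^sub>R u) \<partial>lborel)"
proof -
  have "(\<integral>t. f t \<partial>lborel) = (\<integral>t. f t \<partial>density (distr lborel borel (\<lambda>x. 0
      + c *\<^sub>R x)) (\<lambda>_. \<bar>c\<bar> ^ DIM(complex)))"
    using c by (subst lborel_affine[of c 0]) auto
  also have "\<dots> = (\<integral>t. c\<^sup>2 *\<^sub>R f t \<partial>distr lborel borel (\<lambda>x. 0 + c *\<^sub>R x))"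
    using f c by (subst integral_density) auto
  also have "\<dots> = (\<integral>u. c\<^sup>2 *\<^sub>R f (0 + c *\<^sub>R u) \<partial>lborel)"
    using f by (subst integral_distr) auto
  finally show ?thesis by simp
qed

lemma integrable_gaussian_dominator:
  "integrable lborel (\<lambda>u :: complex. exp (- (cmod u)\<^sup>2 / 16) + 1 / (1 + (cmod u)\<^sup>2)\<^sup>2)"
proof (rule Bochner_Integration.integrable_add)
  have "integrable lborel (\<lambda>u :: complex. gauss (sqrt 8) (0 - u))" by (rule gauss_integral) simp
  thus "integrable lborel (\<lambda>u :: complex. exp (- (cmod u)\<^sup>2 / 16))" by (simp add: gauss_def)
  have i: "integrable lborel (\<lambda>x :: real. complex_of_real (inverse (1 + x\<^sup>2)))"
    using integrable_inverse_1_plus_square by (intro integrable_of_real) (simp add: set_integrable_def)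
  have "integrable lborel (\<lambda>u. complex_of_real (inverse (1 + (Re u)\<^sup>2)) * complex_of_real (inverse (1
      + (Im u)\<^sup>2)))"
    by (rule complex_product_integral(1)[OF i i])
  thus "integrable lborel (\<lambda>u :: complex. 1 / (1 + (cmod u)\<^sup>2)\<^sup>2)"
  proof (rule Bochner_Integration.integrable_bound)
    show "AE u :: complex in lborel. norm (1 / (1 + (cmod u)\<^sup>2)\<^sup>2) \<le> norm (complex_of_real (inverse (1
        + (Re u)\<^sup>2)) * complex_of_real (inverse (1 + (Im u)\<^sup>2)))"
    proof (rule AE_I2)
      fix u :: complex
      have p: "1 + (Re u)\<^sup>2 > 0" "1 + (Im u)\<^sup>2 > 0" by (auto intro: add_pos_nonneg)
      have "(1 + (Re u)\<^sup>2) * (1 + (Im u)\<^sup>2) \<le> (1 + (cmod u)\<^sup>2) * (1 + (cmod u)\<^sup>2)"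
        by (intro mult_mono) (auto simp: cmod_power2)
      hence "1 / ((1 + (cmod u)\<^sup>2) * (1 + (cmod u)\<^sup>2)) \<le> 1 / ((1 + (Re u)\<^sup>2) * (1 + (Im u)\<^sup>2))"
        using p by (intro divide_left_mono mult_pos_pos add_pos_nonneg) auto
      thus "norm (1 / (1 + (cmod u)\<^sup>2)\<^sup>2) \<le> norm (complex_of_real (inverse (1 + (Re u)\<^sup>2))
          * complex_of_real (inverse (1 + (Im u)\<^sup>2)))"
        using p unfolding of_real_mult[symmetric] norm_of_real
        by (simp add: power2_eq_square[of "1 + _"] inverse_eq_divide abs_mult)
    qed
  qed measurable
qed


section \<open>Smoothing a law by a Gaussian kernel\<close>

definition char_fun :: "complex measure \<Rightarrow> complex \<Rightarrow> complex" where
  "char_fun P t = (\<integral>x. cis (t \<bullet> x) \<partial>P)"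

locale complex_law = prob_space P for P :: "complex measure" +
  assumes sets_P [measurable_cong]: "sets P = sets borel"
begin

sublocale PL: pair_sigma_finite P "lborel :: complex measure" ..

lemma measurable_char_fun [measurable]: "char_fun P \<in> borel_measurable borel"
proof -
  have "(\<lambda>t. \<integral>x. cis (t \<bullet> x) \<partial>P) \<in> borel_measurable borel" by measurable
  thus ?thesis by (simp add: char_fun_def[abs_def])
qed

text \<open>The Gaussian kernel is the Fourier transform of a Gaussian; exchange the two integrals.\<close>

lemma gauss_expectation:
  assumes d: "\<delta> > 0"
  shows "of_real (\<integral>x. gauss \<delta> (x - c) \<partial>P)
     = of_real (\<delta>\<^sup>2 / (2 * pi)) * (\<integral>t. char_fun P t * cis (- (t \<bullet> c)) * of_real (exp (- (\<delta>\<^sup>2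
         * (cmod t)\<^sup>2 / 2))) \<partial>lborel)"
proof -
  define G where "G t = complex_of_real (exp (- (\<delta>\<^sup>2 * (cmod t)\<^sup>2 / 2)))" for t :: complex
  have [measurable]: "G \<in> borel_measurable borel" unfolding G_def[abs_def] by measurable
  have Gint: "integrable lborel G" using complex_gaussian_fourier(1)[OF d, of 0] by (simp add: G_def[abs_def])
  have k: "complex_of_real (gauss \<delta> z) = of_real (\<delta>\<^sup>2 / (2 * pi)) * (\<integral>t. cis (t \<bullet> z) * G t \<partial>lborel)" for z
    unfolding G_def complex_gaussian_fourier(2)[OF d] gauss_def using d by simp
  have fub: "integrable (P \<Otimes>\<^sub>M lborel) (\<lambda>(x, t). cis (t \<bullet> (x - c)) * G t)"
  proof (rule PL.Fubini_integrable)
    show "(\<lambda>(x, t). cis (t \<bullet> (x - c)) * G t) \<in> borel_measurable (P \<Otimes>\<^sub>M lborel)" by measurable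
    show "integrable P (\<lambda>x. \<integral>t. norm (case (x, t) of (x, t) \<Rightarrow> cis (t \<bullet> (x - c)) * G t) \<partial>lborel)"
      by (simp add: norm_mult)
    show "AE x in P. integrable lborel (\<lambda>t. case (x, t) of (x, t) \<Rightarrow> cis (t \<bullet> (x - c)) * G t)"
      using complex_gaussian_fourier(1)[OF d] by (simp add: G_def)
  qed
  have "of_real (\<integral>x. gauss \<delta> (x - c) \<partial>P) = (\<integral>x. complex_of_real (gauss \<delta> (x - c)) \<partial>P)"
    by (rule integral_complex_of_real[symmetric])
  also have "\<dots> = of_real (\<delta>\<^sup>2 / (2 * pi)) * (\<integral>x. (\<integral>t. cis (t \<bullet> (x - c)) * G t \<partial>lborel) \<partial>P)"
    unfolding k by simp
  also have "(\<integral>x. (\<integral>t. cis (t \<bullet> (x - c)) * G t \<partial>lborel) \<partial>P) = (\<integral>t. (\<integral>x. cis (t \<bullet> (x - c)) * G t \<partial>P) \<partial>lborel)"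
    by (rule PL.Fubini_integral[OF fub, symmetric])
  also have "\<dots> = (\<integral>t. char_fun P t * cis (- (t \<bullet> c)) * G t \<partial>lborel)"
  proof (intro Bochner_Integration.integral_cong refl)
    fix t
    have e: "cis (t \<bullet> (x - c)) = cis (t \<bullet> x) * cis (- (t \<bullet> c))" for x
      by (simp add: cis_mult inner_diff_right)
    show "(\<integral>x. cis (t \<bullet> (x - c)) * G t \<partial>P) = char_fun P t * cis (- (t \<bullet> c)) * G t"
      unfolding e char_fun_def by simp
  qed
  finally show ?thesis by (simp only: G_def)
qed

lemma gauss_mass_Fubini:
  assumes d: "\<delta> > 0" and A: "A \<in> sets borel"
  shows "(\<integral>y. indicator A y * (\<integral>x. gauss \<delta> (x - c - y) \<partial>P) \<partial>lborel) = (\<integral>x. (\<integral>y. indicator A y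
      * gauss \<delta> (x - c - y) \<partial>lborel) \<partial>P)"
    and "integrable P (\<lambda>x. \<integral>y. indicator A y * gauss \<delta> (x - c - y) \<partial>lborel)"
proof -
  note A [measurable]
  have int_y: "integrable lborel (\<lambda>y. indicator A y * gauss \<delta> (x - c - y))" for x
    using gauss_bounds[of \<delta>] A
    by (intro Bochner_Integration.integrable_bound[OF gauss_integral(1)[OF d, of "x - c"]])
       (auto simp: indicator_def less_imp_le)
  have fub: "integrable (P \<Otimes>\<^sub>M lborel) (\<lambda>(x, y). indicator A y * gauss \<delta> (x - c - y))"
  proof (rule PL.Fubini_integrable)
    show "(\<lambda>(x, y). indicator A y * gauss \<delta> (x - c - y)) \<in> borel_measurable (P \<Otimes>\<^sub>M lborel)" by measurable
    show "AE x in P. integrable lborel (\<lambda>y. case (x, y) of (x, y) \<Rightarrow> indicator A y * gauss \<delta> (x - c - y))"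
      using int_y by simp
    have "norm (\<integral>y. norm (indicator A y * gauss \<delta> (x - c - y)) \<partial>lborel) \<le> 2 * pi * \<delta>\<^sup>2" for x
    proof -
      have "(\<integral>y. norm (indicator A y * gauss \<delta> (x - c - y)) \<partial>lborel) \<le> (\<integral>y. gauss \<delta> (x - c - y) \<partial>lborel)"
        using int_y[of x] gauss_bounds[of \<delta>] by (intro integral_mono gauss_integral(1)[OF d])
            (auto simp: indicator_def less_imp_le)
      also have "\<dots> = 2 * pi * \<delta>\<^sup>2" by (rule gauss_integral(2)[OF d])
      finally show ?thesis by (simp add: integral_nonneg_AE)
    qed
    moreover have "(\<lambda>x. \<integral>y. norm (indicator A y * gauss \<delta> (x - c - y)) \<partial>lborel) \<in> borel_measurable P"
        by measurable
    ultimately show "integrable P (\<lambda>x. \<integral>y. norm (case (x, y) of (x, y) \<Rightarrow> indicator A y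
        * gauss \<delta> (x - c - y)) \<partial>lborel)"
      by (intro integrable_const_bound[where B = "2 * pi * \<delta>\<^sup>2"]) auto
  qed
  show "integrable P (\<lambda>x. \<integral>y. indicator A y * gauss \<delta> (x - c - y) \<partial>lborel)"
    using PL.integrable_fst[OF fub] by simp
  have "(\<integral>y. indicator A y * (\<integral>x. gauss \<delta> (x - c - y) \<partial>P) \<partial>lborel) = (\<integral>y. (\<integral>x. indicator A y
      * gauss \<delta> (x - c - y) \<partial>P) \<partial>lborel)"
    by simp
  also have "\<dots> = (\<integral>x. (\<integral>y. indicator A y * gauss \<delta> (x - c - y) \<partial>lborel) \<partial>P)"
    by (rule PL.Fubini_integral[OF fub])
  finally show "(\<integral>y. indicator A y * (\<integral>x. gauss \<delta> (x - c - y) \<partial>P) \<partial>lborel) = (\<integral>x. (\<integral>y. indicator A y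
      * gauss \<delta> (x - c - y) \<partial>lborel) \<partial>P)" .
qed

end

definition gauss_mass :: "real \<Rightarrow> complex set \<Rightarrow> complex \<Rightarrow> real" where
  "gauss_mass \<delta> A x = (\<integral>y. indicator A y * gauss \<delta> (x - y) \<partial>lborel)"

lemma integrable_indicator_gauss:
  assumes d: "\<delta> > 0" and [measurable]: "A \<in> sets borel"
  shows "integrable lborel (\<lambda>y. indicator A y * gauss \<delta> (x - y))"
  using gauss_bounds[of \<delta>]
  by (intro Bochner_Integration.integrable_bound[OF gauss_integral(1)[OF d, of x]])
     (auto simp: indicator_def less_imp_le)

lemma gauss_mass_bounds:
  assumes d: "\<delta> > 0" and A: "A \<in> sets borel"
  shows "0 \<le> gauss_mass \<delta> A x" "gauss_mass \<delta> A x \<le> 2 * pi * \<delta>\<^sup>2"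
proof -
  show "0 \<le> gauss_mass \<delta> A x"
    using gauss_bounds[of \<delta>] unfolding gauss_mass_def by (intro integral_nonneg_AE AE_I2)
        (auto simp: less_imp_le)
  have "gauss_mass \<delta> A x \<le> (\<integral>y. gauss \<delta> (x - y) \<partial>lborel)"
    using gauss_bounds[of \<delta>] unfolding gauss_mass_def
    by (intro integral_mono gauss_integral(1)[OF d] integrable_indicator_gauss[OF d A])
        (auto simp: indicator_def less_imp_le)
  thus "gauss_mass \<delta> A x \<le> 2 * pi * \<delta>\<^sup>2" using gauss_integral(2)[OF d] by simp
qed

text \<open>A bound, up to the factor \<open>2\<close>, for the fraction of the mass of the kernel of width \<open>\<delta>\<close> that lies at
distance \<open>\<eta>\<close> or more: out there the kernel is at most \<open>leak \<eta> \<delta>\<close> times the kernel of width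
\<open>sqrt 2 * \<delta>\<close>.\<close>

definition leak :: "real \<Rightarrow> real \<Rightarrow> real" where
  "leak \<eta> \<delta> = exp (- (\<eta>\<^sup>2 / (4 * \<delta>\<^sup>2)))"

lemma gauss_far:
  assumes d: "\<delta> > 0" and z: "\<eta> \<le> cmod z" "\<eta> \<ge> 0"
  shows "gauss \<delta> z \<le> leak \<eta> \<delta> * gauss (sqrt 2 * \<delta>) z"
proof -
  have "gauss \<delta> z = exp (- ((cmod z)\<^sup>2 / (4 * \<delta>\<^sup>2))) * gauss (sqrt 2 * \<delta>) z"
    unfolding gauss_def exp_add[symmetric] by (intro arg_cong[where f = exp]) (simp add: power_mult_distrib)
  moreover have "\<eta>\<^sup>2 / (4 * \<delta>\<^sup>2) \<le> (cmod z)\<^sup>2 / (4 * \<delta>\<^sup>2)" using z by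
      (intro divide_right_mono power_mono) auto
  ultimately show ?thesis
    using gauss_bounds[of "sqrt 2 * \<delta>" z] by (simp add: leak_def mult_right_mono)
qed

lemma gauss_mass_near:
  assumes d: "\<delta> > 0" and A: "A \<in> sets borel" and ball: "ball x \<eta> \<subseteq> A" and e: "\<eta> \<ge> 0"
  shows "2 * pi * \<delta>\<^sup>2 * (1 - 2 * leak \<eta> \<delta>) \<le> gauss_mass \<delta> A x"
proof -
  have d2: "sqrt 2 * \<delta> > 0" using d by simp
  have "2 * pi * \<delta>\<^sup>2 = (\<integral>y. gauss \<delta> (x - y) \<partial>lborel)" by (rule gauss_integral(2)[OF d, symmetric])
  also have "\<dots> \<le> (\<integral>y. indicator A y * gauss \<delta> (x - y) + leak \<eta> \<delta> * gauss (sqrt 2 * \<delta>) (x - y) \<partial>lborel)"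
  proof (rule integral_mono)
    show "integrable lborel (\<lambda>y. gauss \<delta> (x - y))" by (rule gauss_integral(1)[OF d])
    show "integrable lborel (\<lambda>y. indicator A y * gauss \<delta> (x - y) + leak \<eta> \<delta> * gauss (sqrt 2 * \<delta>) (x - y))"
      by (intro Bochner_Integration.integrable_add integrable_indicator_gauss[OF d A]
          integrable_mult_right gauss_integral(1)[OF d2])
    show "gauss \<delta> (x - y) \<le> indicator A y * gauss \<delta> (x - y) + leak \<eta> \<delta> * gauss (sqrt 2 * \<delta>) (x - y)" for y
    proof (cases "y \<in> A")
      case True
      thus ?thesis using gauss_bounds[of "sqrt 2 * \<delta>" "x - y"] by (simp add: leak_def)
    next
      case False
      hence "\<eta> \<le> cmod (x - y)" using ball by (auto simp: dist_norm subset_iff not_less[symmetric])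
      from gauss_far[OF d this e] False show ?thesis by simp
    qed
  qed
  also have "\<dots> = gauss_mass \<delta> A x + leak \<eta> \<delta> * (2 * pi * (sqrt 2 * \<delta>)\<^sup>2)"
    unfolding gauss_mass_def gauss_integral(2)[OF d2, of x, symmetric]
    by (subst Bochner_Integration.integral_add)
        (auto intro!: integrable_indicator_gauss[OF d A] gauss_integral(1)[OF d2])
  finally show ?thesis by (simp add: power_mult_distrib algebra_simps)
qed

lemma gauss_mass_far:
  assumes d: "\<delta> > 0" and A: "A \<in> sets borel" and far: "\<And>y. y \<in> A \<Longrightarrow> \<eta> \<le> cmod (x - y)" and e: "\<eta> \<ge> 0"
  shows "gauss_mass \<delta> A x \<le> leak \<eta> \<delta> * gauss_mass (sqrt 2 * \<delta>) A x"
proof -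
  have d2: "sqrt 2 * \<delta> > 0" using d by simp
  have "gauss_mass \<delta> A x \<le> (\<integral>y. leak \<eta> \<delta> * (indicator A y * gauss (sqrt 2 * \<delta>) (x - y)) \<partial>lborel)"
    unfolding gauss_mass_def
    using gauss_far[OF d far e]
    by (intro integral_mono integrable_indicator_gauss[OF d A] integrable_mult_right
        integrable_indicator_gauss[OF d2 A])
       (auto simp: indicator_def)
  thus ?thesis by (simp add: gauss_mass_def)
qed


section \<open>A local limit theorem in the plane\<close>

text \<open>The hypotheses say that, on the scale \<open>sqrt N\<close>, the characteristic functions converge to that of a
standard Gaussian vector, and that a Gaussian kernel of fixed width makes this convergence dominated.
The law \<open>P n\<close> itself is not rescaled, and is studied at distance of order one from
\<open>sqrt N * b\<close>.\<close>

locale local_limit =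
  fixes P :: "nat \<Rightarrow> complex measure" and N :: "nat \<Rightarrow> real" and W :: "complex \<Rightarrow> real" and b :: complex
  assumes law: "\<And>n. complex_law (P n)"
    and N_top: "filterlim N at_top sequentially"
    and char_fun_limit: "\<And>u. (\<lambda>n. char_fun (P n) (u / of_real (sqrt (N n))))
        \<longlonglongrightarrow> of_real (exp (- (cmod u)\<^sup>2 / 2))"
    and W: "integrable lborel W"
    and domination: "\<And>\<delta>. \<delta> > 0 \<Longrightarrow> \<forall>\<^sub>F n in sequentially. \<forall>u.
        cmod (char_fun (P n) (u / of_real (sqrt (N n)))) * exp (- (\<delta>\<^sup>2 * (cmod u)\<^sup>2 / (2 * N n))) \<le> W u"
begin

definition center :: "nat \<Rightarrow> complex" where "center n = of_real (sqrt (N n)) * b"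

text \<open>\<open>N n\<close> times the density at \<open>center n + y\<close>, up to the mass of the kernel, of the convolution of
\<open>P n\<close> with the kernel. The function \<open>integrand\<close> is the one in its Fourier representation after the
substitution \<open>t = u / sqrt N\<close>, whose Jacobian cancels the factor \<open>N n\<close>.\<close>

definition smoothed :: "real \<Rightarrow> nat \<Rightarrow> complex \<Rightarrow> real" where
  "smoothed \<delta> n y = N n * (\<integral>x. gauss \<delta> (x - center n - y) \<partial>P n)"

definition integrand :: "real \<Rightarrow> nat \<Rightarrow> complex \<Rightarrow> complex \<Rightarrow> complex" where
  "integrand \<delta> n y u = char_fun (P n) (u / of_real (sqrt (N n))) * cis (- (u \<bullet> b))
      * cis (- ((u \<bullet> y) / sqrt (N n)))
     * of_real (exp (- (\<delta>\<^sup>2 * (cmod u)\<^sup>2 / (2 * N n))))"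

lemma measurable_integrand [measurable]: "integrand \<delta> n y \<in> borel_measurable borel"
proof -
  interpret complex_law "P n" by (rule law)
  show ?thesis unfolding integrand_def[abs_def] by measurable
qed

lemma eventually_N_pos: "\<forall>\<^sub>F n in sequentially. N n > 0"
  using N_top by (auto simp: filterlim_at_top_dense)

lemma smoothed_eq_integral:
  assumes d: "\<delta> > 0" and N: "N n > 0"
  shows "of_real (smoothed \<delta> n y) = of_real (\<delta>\<^sup>2 / (2 * pi)) * (\<integral>u. integrand \<delta> n y u \<partial>lborel)"
proof -
  interpret complex_law "P n" by (rule law)
  define c where "c = center n + y"
  define f where "f t = char_fun (P n) t * cis (- (t \<bullet> c)) * of_real (exp (- (\<delta>\<^sup>2 * (cmod t)\<^sup>2 / 2)))" for t
  have [measurable]: "f \<in> borel_measurable borel" unfolding f_def[abs_def] by measurable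
  define r where "r = 1 / sqrt (N n)"
  have r: "r > 0" "r\<^sup>2 = 1 / N n" using N by (auto simp: r_def power_divide)
  have fr: "f (r *\<^sub>R u) = integrand \<delta> n y u" for u
  proof -
    have "r *\<^sub>R u = u / of_real (sqrt (N n))" by (simp add: r_def scaleR_conv_of_real)
    moreover have "(r *\<^sub>R u) \<bullet> c = u \<bullet> b + (u \<bullet> y) / sqrt (N n)"
    proof -
      have "c = sqrt (N n) *\<^sub>R b + y" by (simp add: c_def center_def scaleR_conv_of_real)
      thus ?thesis using N by (simp add: inner_add_right r_def add_divide_distrib)
    qed
    moreover have "\<delta>\<^sup>2 * (cmod (r *\<^sub>R u))\<^sup>2 / 2 = \<delta>\<^sup>2 * (cmod u)\<^sup>2 / (2 * N n)"
      by (simp add: power_mult_distrib r(2))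
    ultimately show ?thesis by (simp add: f_def integrand_def cis_mult mult.assoc)
  qed
  have "of_real (\<integral>x. gauss \<delta> (x - center n - y) \<partial>P n) = complex_of_real (\<integral>x. gauss \<delta> (x - c) \<partial>P n)"
    by (simp add: c_def diff_diff_eq)
  also have "\<dots> = of_real (\<delta>\<^sup>2 / (2 * pi)) * (\<integral>t. f t \<partial>lborel)" unfolding f_def
      by (rule gauss_expectation[OF d])
  also have "(\<integral>t. f t \<partial>lborel) = r\<^sup>2 *\<^sub>R (\<integral>u. f (r *\<^sub>R u) \<partial>lborel)"
    by (rule complex_integral_scale[OF r(1)]) measurable
  finally have "complex_of_real (\<integral>x. gauss \<delta> (x - center n - y) \<partial>P n)
     = of_real (\<delta>\<^sup>2 / (2 * pi)) * (of_real (1 / N n) * (\<integral>u. integrand \<delta> n y u \<partial>lborel))"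
    unfolding fr r(2) by (simp only: scaleR_conv_of_real)
  hence "complex_of_real (N n) * complex_of_real (\<integral>x. gauss \<delta> (x - center n - y) \<partial>P n)
     = of_real (\<delta>\<^sup>2 / (2 * pi)) * (\<integral>u. integrand \<delta> n y u \<partial>lborel)"
    using N less_imp_neq[OF N] by simp
  thus ?thesis by (simp add: smoothed_def)
qed

lemma norm_integrand_le:
  assumes "cmod (char_fun (P n) (u / of_real (sqrt (N n)))) * exp (- (\<delta>\<^sup>2 * (cmod u)\<^sup>2 / (2 * N n))) \<le> W u"
  shows "cmod (integrand \<delta> n y u) \<le> W u"
  using assms by (simp add: integrand_def norm_mult)

lemma smoothed_limit:
  assumes d: "\<delta> > 0"
  shows "(\<lambda>n. smoothed \<delta> n y) \<longlonglongrightarrow> \<delta>\<^sup>2 * exp (- (cmod b)\<^sup>2 / 2)"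
proof -
  obtain n0 where n0: "\<And>n u. n \<ge> n0 \<Longrightarrow> cmod (char_fun (P n) (u / of_real (sqrt (N n)))) * exp (- (\<delta>\<^sup>2
      * (cmod u)\<^sup>2 / (2 * N n))) \<le> W u"
    using domination[OF d] by (auto simp: eventually_sequentially)
  define L where "L u = cis (u \<bullet> (- b)) * complex_of_real (exp (- (1\<^sup>2 * (cmod u)\<^sup>2 / 2)))" for u
  have invN: "(\<lambda>n. 1 / N n) \<longlonglongrightarrow> 0"
    using tendsto_inverse_0_at_top[OF N_top] by (simp add: inverse_eq_divide)
  have invsN: "(\<lambda>n. 1 / sqrt (N n)) \<longlonglongrightarrow> 0"
    using tendsto_real_sqrt[OF invN] by (simp add: real_sqrt_divide)
  have pw: "(\<lambda>n. integrand \<delta> n y u) \<longlonglongrightarrow> L u" for u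
  proof -
    have 1: "(\<lambda>n. cis (- ((u \<bullet> y) * (1 / sqrt (N n))))) \<longlonglongrightarrow> cis (- ((u \<bullet> y) * 0))"
      by (intro tendsto_cis tendsto_minus tendsto_mult tendsto_const invsN)
    have 2: "(\<lambda>n. complex_of_real (exp (- ((\<delta>\<^sup>2 * (cmod u)\<^sup>2 / 2) * (1 / N n)))))
        \<longlonglongrightarrow> of_real (exp (- ((\<delta>\<^sup>2 * (cmod u)\<^sup>2 / 2) * 0)))"
      by (intro tendsto_of_real tendsto_exp tendsto_minus tendsto_mult tendsto_const invN)
    have "(\<lambda>n. char_fun (P n) (u / of_real (sqrt (N n))) * cis (- (u \<bullet> b)) * cis (- ((u \<bullet> y)
        * (1 / sqrt (N n))))
       * complex_of_real (exp (- ((\<delta>\<^sup>2 * (cmod u)\<^sup>2 / 2) * (1 / N n)))))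
       \<longlonglongrightarrow> of_real (exp (- (cmod u)\<^sup>2 / 2)) * cis (- (u \<bullet> b)) * cis (- ((u \<bullet> y) * 0))
           * of_real (exp (- ((\<delta>\<^sup>2 * (cmod u)\<^sup>2 / 2) * 0)))"
      by (intro tendsto_mult char_fun_limit tendsto_const 1 2)
    thus ?thesis by (simp add: integrand_def L_def mult.commute)
  qed
  have "(\<lambda>n. \<integral>u. integrand \<delta> (n + n0) y u \<partial>lborel) \<longlonglongrightarrow> (\<integral>u. L u \<partial>lborel)"
  proof (rule integral_dominated_convergence[where w = W])
    show "AE u in lborel. (\<lambda>n. integrand \<delta> (n + n0) y u) \<longlonglongrightarrow> L u"
      using pw by (intro AE_I2 LIMSEQ_ignore_initial_segment)
    show "AE u in lborel. cmod (integrand \<delta> (n + n0) y u) \<le> W u" for n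
      by (intro AE_I2 norm_integrand_le n0) simp
    show "L \<in> borel_measurable lborel" unfolding L_def[abs_def] by measurable
  qed (use W in measurable)
  hence "(\<lambda>n. \<integral>u. integrand \<delta> n y u \<partial>lborel) \<longlonglongrightarrow> (\<integral>u. L u \<partial>lborel)" by (rule LIMSEQ_offset)
  moreover have "(\<integral>u. L u \<partial>lborel) = of_real (2 * pi * exp (- (cmod b)\<^sup>2 / 2))"
    unfolding L_def by (subst complex_gaussian_fourier(2)) auto
  ultimately have "(\<lambda>n. of_real (\<delta>\<^sup>2 / (2 * pi)) * (\<integral>u. integrand \<delta> n y u \<partial>lborel))
      \<longlonglongrightarrow> of_real (\<delta>\<^sup>2 / (2 * pi)) * of_real (2 * pi * exp (- (cmod b)\<^sup>2 / 2))"
    by (intro tendsto_mult tendsto_const) simp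
  moreover have "\<forall>\<^sub>F n in sequentially. of_real (\<delta>\<^sup>2 / (2 * pi)) * (\<integral>u. integrand \<delta> n y u \<partial>lborel)
      = complex_of_real (smoothed \<delta> n y)"
    using eventually_N_pos by eventually_elim (rule smoothed_eq_integral[OF d, symmetric])
  ultimately have "(\<lambda>n. complex_of_real (smoothed \<delta> n y)) \<longlonglongrightarrow> of_real (\<delta>\<^sup>2 / (2 * pi)) * of_real (2 * pi
      * exp (- (cmod b)\<^sup>2 / 2))"
    by (rule Lim_transform_eventually)
  hence "(\<lambda>n. complex_of_real (smoothed \<delta> n y)) \<longlonglongrightarrow> of_real (\<delta>\<^sup>2 * exp (- (cmod b)\<^sup>2 / 2))" by simp
  thus ?thesis by (simp only: tendsto_of_real_iff)
qed

lemma smoothed_bounded: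
  assumes d: "\<delta> > 0"
  shows "\<forall>\<^sub>F n in sequentially. \<forall>y. \<bar>smoothed \<delta> n y\<bar> \<le> \<delta>\<^sup>2 / (2 * pi) * (\<integral>u. W u \<partial>lborel)"
  using domination[OF d] eventually_N_pos
proof eventually_elim
  case (elim n)
  show ?case
  proof
    fix y
    have le: "cmod (integrand \<delta> n y u) \<le> W u" for u using elim by (intro norm_integrand_le) auto
    have int: "integrable lborel (integrand \<delta> n y)"
      by (rule Bochner_Integration.integrable_bound[OF W]) (auto intro!: AE_I2 order.trans[OF le abs_ge_self])
    have "\<bar>smoothed \<delta> n y\<bar> = cmod (complex_of_real (smoothed \<delta> n y))" by simp
    also have "\<dots> = \<delta>\<^sup>2 / (2 * pi) * cmod (\<integral>u. integrand \<delta> n y u \<partial>lborel)"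
      unfolding smoothed_eq_integral[OF d elim(2)] norm_mult norm_of_real by simp
    also have "\<dots> \<le> \<delta>\<^sup>2 / (2 * pi) * (\<integral>u. W u \<partial>lborel)"
      by (intro mult_left_mono Bochner_Integration.integral_norm_bound_integral int W le) auto
    finally show "\<bar>smoothed \<delta> n y\<bar> \<le> \<delta>\<^sup>2 / (2 * pi) * (\<integral>u. W u \<partial>lborel)" .
  qed
qed

text \<open>The densities converge pointwise and are bounded uniformly in the position, so their integrals over a
bounded set converge.\<close>

lemma gauss_mass_limit:
  assumes d: "\<delta> > 0" and A: "A \<in> sets borel" "bounded A"
  shows "(\<lambda>n. N n * (\<integral>x. gauss_mass \<delta> A (x - center n) \<partial>P n)) \<longlonglongrightarrow> \<delta>\<^sup>2 * exp (- (cmod b)\<^sup>2 / 2)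
      * measure lborel A"
proof -
  note A(1) [measurable]
  define C where "C = \<delta>\<^sup>2 / (2 * pi) * (\<integral>u. W u \<partial>lborel)"
  obtain n0 where n0: "\<And>n y. n \<ge> n0 \<Longrightarrow> \<bar>smoothed \<delta> n y\<bar> \<le> C"
    using smoothed_bounded[OF d] by (auto simp: eventually_sequentially C_def)
  have finA: "emeasure lborel A < \<infinity>" using emeasure_bounded_finite[OF A(2)] .
  have ms [measurable]: "smoothed \<delta> n \<in> borel_measurable borel" for n
  proof -
    interpret complex_law "P n" by (rule law)
    show ?thesis unfolding smoothed_def[abs_def] by measurable
  qed
  have eq: "(\<integral>y. indicator A y * smoothed \<delta> n y \<partial>lborel) = N n
      * (\<integral>x. gauss_mass \<delta> A (x - center n) \<partial>P n)" for n
  proof -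
    interpret complex_law "P n" by (rule law)
    show ?thesis
      using gauss_mass_Fubini(1)[OF d A(1), of "center n"]
      by (simp add: smoothed_def gauss_mass_def mult.left_commute[of "indicator A _" "N n"])
  qed
  have "(\<lambda>n. \<integral>y. indicator A y * smoothed \<delta> (n + n0) y \<partial>lborel) \<longlonglongrightarrow> (\<integral>y. indicator A y * (\<delta>\<^sup>2
      * exp (- (cmod b)\<^sup>2 / 2)) \<partial>lborel)"
  proof (rule integral_dominated_convergence[where w = "\<lambda>y. indicator A y * C"])
    show "integrable lborel (\<lambda>y. indicator A y * C)" using finA A by (intro integrable_mult_left) simp
    show "AE y in lborel. (\<lambda>n. indicator A y * smoothed \<delta> (n + n0) y) \<longlonglongrightarrow> indicator A y * (\<delta>\<^sup>2
        * exp (- (cmod b)\<^sup>2 / 2))"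
      by (intro AE_I2 tendsto_mult tendsto_const LIMSEQ_ignore_initial_segment smoothed_limit d)
    show "AE y in lborel. norm (indicator A y * smoothed \<delta> (n + n0) y) \<le> indicator A y * C" for n
      using n0[of "n + n0"] by (intro AE_I2) (simp add: indicator_def)
  qed measurable
  hence "(\<lambda>n. \<integral>y. indicator A y * smoothed \<delta> n y \<partial>lborel) \<longlonglongrightarrow> (\<integral>y. indicator A y * (\<delta>\<^sup>2
      * exp (- (cmod b)\<^sup>2 / 2)) \<partial>lborel)"
    by (rule LIMSEQ_offset)
  thus ?thesis unfolding eq using finA A by (simp add: mult.commute)
qed

definition hit :: "complex set \<Rightarrow> nat \<Rightarrow> real" where
  "hit B n = N n * measure (P n) {x. x - center n \<in> B}"

lemma shifted_borel:
  assumes "B \<in> sets borel" shows "{x. x - center n \<in> B} \<in> sets borel"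
proof -
  have "(\<lambda>x. x - center n) -` B \<inter> space borel \<in> sets borel" by (rule measurable_sets[OF _ assms]) measurable
  thus ?thesis by (simp add: vimage_def)
qed

text \<open>A point of \<open>B\<close> keeps all but a small part of the mass of its kernel within \<open>A\<close>.\<close>

lemma hit_upper:
  assumes B: "B \<in> sets borel" and d: "\<delta> > 0" and e: "\<eta> \<ge> 0" and A: "A \<in> sets borel"
    and nb: "\<And>x. x \<in> B \<Longrightarrow> ball x \<eta> \<subseteq> A" and N: "N n \<ge> 0"
  shows "2 * pi * \<delta>\<^sup>2 * (1 - 2 * leak \<eta> \<delta>) * hit B n \<le> N n * (\<integral>x. gauss_mass \<delta> A (x - center n) \<partial>P n)"
proof -
  interpret complex_law "P n" by (rule law)
  let ?\<kappa> = "2 * pi * \<delta>\<^sup>2 * (1 - 2 * leak \<eta> \<delta>)"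
  let ?E = "{x. x - center n \<in> B}"
  have Em: "?E \<in> sets (P n)" using shifted_borel[OF B] sets_P by simp
  have "?\<kappa> * measure (P n) ?E = (\<integral>x. indicator ?E x * ?\<kappa> \<partial>P n)" using Em by simp
  also have "\<dots> \<le> (\<integral>x. gauss_mass \<delta> A (x - center n) \<partial>P n)"
  proof (rule integral_mono)
    show "integrable (P n) (\<lambda>x. indicator ?E x * ?\<kappa>)" using Em by (intro integrable_mult_left)
        (simp add: emeasure_eq_measure)
    show "integrable (P n) (\<lambda>x. gauss_mass \<delta> A (x - center n))"
      using gauss_mass_Fubini(2)[OF d A, of "center n"] by (simp add: gauss_mass_def)
    show "indicator ?E x * ?\<kappa> \<le> gauss_mass \<delta> A (x - center n)" for x
      using gauss_mass_near[OF d A nb e] gauss_mass_bounds(1)[OF d A] by (auto simp: indicator_def)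
  qed
  finally have "N n * (?\<kappa> * measure (P n) ?E) \<le> N n * (\<integral>x. gauss_mass \<delta> A (x - center n) \<partial>P n)"
    using N by (rule mult_left_mono)
  thus ?thesis by (simp add: hit_def mult_ac)
qed

text \<open>Points outside \<open>B\<close> are far from \<open>A\<close>. Their contribution is compared with the kernel of width
\<open>sqrt 2 * \<delta>\<close>, for which the limit is known as well.\<close>

lemma hit_lower:
  assumes B: "B \<in> sets borel" and d: "\<delta> > 0" and e: "\<eta> \<ge> 0" and A: "A \<in> sets borel"
    and far: "\<And>x y. x \<notin> B \<Longrightarrow> y \<in> A \<Longrightarrow> \<eta> \<le> cmod (x - y)" and N: "N n \<ge> 0"
  shows "N n * (\<integral>x. gauss_mass \<delta> A (x - center n) \<partial>P n) \<le> 2 * pi * \<delta>\<^sup>2 * hit B n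
     + leak \<eta> \<delta> * (N n * (\<integral>x. gauss_mass (sqrt 2 * \<delta>) A (x - center n) \<partial>P n))"
proof -
  interpret complex_law "P n" by (rule law)
  let ?E = "{x. x - center n \<in> B}"
  let ?\<epsilon> = "leak \<eta> \<delta>"
  have d2: "sqrt 2 * \<delta> > 0" using d by simp
  have Em: "?E \<in> sets (P n)" using shifted_borel[OF B] sets_P by simp
  have i: "integrable (P n) (\<lambda>x. indicator ?E x * (2 * pi * \<delta>\<^sup>2))" using Em by
      (intro integrable_mult_left) (simp add: emeasure_eq_measure)
  have g: "integrable (P n) (\<lambda>x. gauss_mass \<delta>' A (x - center n))" if "\<delta>' > 0" for \<delta>'
    using gauss_mass_Fubini(2)[OF that A, of "center n"] by (simp add: gauss_mass_def)
  have "(\<integral>x. gauss_mass \<delta> A (x - center n) \<partial>P n)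
      \<le> (\<integral>x. indicator ?E x * (2 * pi * \<delta>\<^sup>2) + ?\<epsilon> * gauss_mass (sqrt 2 * \<delta>) A (x - center n) \<partial>P n)"
  proof (rule integral_mono)
    show "integrable (P n) (\<lambda>x. indicator ?E x * (2 * pi * \<delta>\<^sup>2) + ?\<epsilon> * gauss_mass (sqrt 2
        * \<delta>) A (x - center n))"
      by (intro Bochner_Integration.integrable_add i integrable_mult_right g d2)
    show "gauss_mass \<delta> A (x - center n) \<le> indicator ?E x * (2 * pi * \<delta>\<^sup>2) + ?\<epsilon> * gauss_mass (sqrt 2
        * \<delta>) A (x - center n)" for x
    proof (cases "x - center n \<in> B")
      case True
      moreover have "0 \<le> ?\<epsilon> * gauss_mass (sqrt 2 * \<delta>) A (x - center n)"
        using gauss_mass_bounds(1)[OF d2 A] by (intro mult_nonneg_nonneg) (auto simp: leak_def)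
      ultimately show ?thesis using gauss_mass_bounds(2)[OF d A, of "x - center n"] by simp
    next
      case False
      from gauss_mass_far[OF d A far[OF this] e] False show ?thesis by simp
    qed
  qed (rule g[OF d])
  also have "\<dots> = 2 * pi * \<delta>\<^sup>2 * measure (P n) ?E + ?\<epsilon> * (\<integral>x. gauss_mass (sqrt 2 * \<delta>) A (x - center n) \<partial>P n)"
    using i g[OF d2] Em by (subst Bochner_Integration.integral_add) (auto simp: mult.commute)
  finally have "N n * (\<integral>x. gauss_mass \<delta> A (x - center n) \<partial>P n)
     \<le> N n * (2 * pi * \<delta>\<^sup>2 * measure (P n) ?E + ?\<epsilon> * (\<integral>x. gauss_mass (sqrt 2 * \<delta>) A (x - center n) \<partial>P n))"
    using N by (rule mult_left_mono)
  thus ?thesis by (simp add: hit_def algebra_simps)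
qed

text \<open>\<open>U k\<close> and \<open>I k\<close> are the enlargement of \<open>B\<close> and the shrinking of \<open>B\<close> by \<open>\<eta> = 1 / (k + 1)\<close>. They
approximate the closure and the interior of \<open>B\<close>, which have the same measure. For a given error one
chooses \<open>k\<close> first and then \<open>\<delta>\<close> so small that little mass leaks over the distance \<open>\<eta>\<close>.\<close>

lemma hit_limit:
  assumes B: "B \<in> sets borel" and bdd: "bounded B" and fr: "emeasure lborel (frontier B) = 0"
  shows "hit B \<longlonglongrightarrow> 1 / (2 * pi) * exp (- (cmod b)\<^sup>2 / 2) * measure lborel B"
proof -
  define g where "g = exp (- (cmod b)\<^sup>2 / 2)"
  define c where "c = 1 / (2 * pi) * g"
  have g0: "g > 0" by (simp add: g_def)
  have c0: "c > 0" using g0 by (simp add: c_def)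
  define U where "U k = (\<Union>x\<in>B. ball x (1 / real (Suc k)))" for k
  define I where "I k = - (\<Union>x\<in>-B. ball x (1 / real (Suc k)))" for k
  have U_borel: "U k \<in> sets borel" for k unfolding U_def by (intro borel_open open_UN) auto
  have I_borel: "I k \<in> sets borel" for k unfolding I_def by (intro borel_closed closed_Compl open_UN) auto
  have IB: "I k \<subseteq> B" for k
  proof
    fix y assume y: "y \<in> I k"
    show "y \<in> B"
    proof (rule ccontr)
      assume "y \<notin> B"
      moreover have "y \<in> ball y (1 / real (Suc k))" by simp
      ultimately have "y \<in> (\<Union>x\<in>-B. ball x (1 / real (Suc k)))" by blast
      thus False using y by (simp add: I_def)
    qed
  qed
  have I_bdd: "bounded (I k)" for k using bounded_subset[OF bdd IB] .
  have U_bdd: "bounded (U k)" for k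
  proof -
    obtain R where R: "\<And>x. x \<in> B \<Longrightarrow> cmod x \<le> R" using bdd by (auto simp: bounded_iff)
    have "cmod y \<le> R + 1" if y: "y \<in> U k" for y
    proof -
      obtain x where x: "x \<in> B" "dist x y < 1 / real (Suc k)" using y by (auto simp: U_def)
      have "1 / real (Suc k) \<le> 1" by simp
      moreover have "cmod y \<le> cmod x + dist x y"
        using norm_triangle_ineq[of x "y - x"] by (simp add: dist_norm norm_minus_commute)
      ultimately show ?thesis using x R[OF x(1)] by linarith
    qed
    thus ?thesis by (auto simp: bounded_iff)
  qed
  have fin: "emeasure lborel S \<noteq> \<infinity>" if "bounded S" for S :: "complex set"
    using emeasure_bounded_finite[OF that] by simp
  have eqm: "measure lborel (closure B) = measure lborel B" "measure lborel (interior B) = measure lborel B"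
  proof -
    have null: "frontier B \<in> null_sets lborel" using fr by (simp add: null_sets_def)
    have "emeasure lborel (B \<union> frontier B) = emeasure lborel B"
      using B null by (intro emeasure_Un_null_set) auto
    moreover have "B \<union> frontier B = closure B"
      using closure_subset[of B] interior_subset[of B] by (auto simp: frontier_def)
    ultimately show "measure lborel (closure B) = measure lborel B" by (simp add: measure_def)
    have "emeasure lborel (interior B \<union> frontier B) = emeasure lborel (interior B)"
      using null by (intro emeasure_Un_null_set) auto
    moreover have "interior B \<union> frontier B = closure B"
      using closure_subset[of B] interior_subset[of B] by (auto simp: frontier_def)
    ultimately show "measure lborel (interior B) = measure lborel B"
      using \<open>measure lborel (closure B) = measure lborel B\<close> by (simp add: measure_def)
  qed
  have U_lim: "(\<lambda>k. measure lborel (U k)) \<longlonglongrightarrow> measure lborel B"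
  proof -
    have "(\<lambda>k. measure lborel (U k)) \<longlonglongrightarrow> measure lborel (\<Inter>k. U k)"
    proof (rule Lim_measure_decseq)
      show "range U \<subseteq> sets lborel" using U_borel by auto
      show "decseq U" unfolding decseq_def
      proof (intro allI impI)
        fix k l :: nat assume "k \<le> l"
        hence "1 / real (Suc l) \<le> 1 / real (Suc k)" by (simp add: frac_le)
        thus "U l \<subseteq> U k" unfolding U_def by (intro UN_mono subset_ball) auto
      qed
      show "emeasure lborel (U k) \<noteq> \<infinity>" for k by (rule fin[OF U_bdd])
    qed
    also have "(\<Inter>k. U k) = closure B"
    proof (intro Set.set_eqI iffI)
      fix y assume "y \<in> closure B"
      hence "\<exists>x\<in>B. dist x y < 1 / real (Suc k)" for k by (simp add: closure_approachable)
      thus "y \<in> (\<Inter>k. U k)" by (auto simp: U_def)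
    next
      fix y assume y: "y \<in> (\<Inter>k. U k)"
      show "y \<in> closure B" unfolding closure_approachable
      proof (intro allI impI)
        fix e :: real assume "e > 0"
        then obtain k where k: "1 / real (Suc k) < e" using nat_approx_posE by blast
        from y obtain x where "x \<in> B" "dist x y < 1 / real (Suc k)" by (auto simp: U_def)
        thus "\<exists>x\<in>B. dist x y < e" using k by (intro bexI[of _ x]) auto
      qed
    qed
    finally show ?thesis by (simp only: eqm)
  qed
  have I_lim: "(\<lambda>k. measure lborel (I k)) \<longlonglongrightarrow> measure lborel B"
  proof -
    have "(\<Union>k. I k) = interior B"
    proof (intro Set.set_eqI iffI)
      fix y assume "y \<in> (\<Union>k. I k)"
      then obtain k where k: "y \<in> I k" by auto
      have "ball y (1 / real (Suc k)) \<subseteq> B"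
      proof
        fix x assume "x \<in> ball y (1 / real (Suc k))"
        hence "y \<in> ball x (1 / real (Suc k))" by (simp add: dist_commute)
        thus "x \<in> B" using k unfolding I_def by blast
      qed
      thus "y \<in> interior B" by (intro interiorI[of "ball y (1 / real (Suc k))"]) auto
    next
      fix y assume "y \<in> interior B"
      then obtain e where e: "e > 0" "ball y e \<subseteq> B" by (auto simp: mem_interior)
      then obtain k where k: "1 / real (Suc k) < e" using nat_approx_posE by blast
      have "y \<in> I k"
      proof (rule ccontr)
        assume "y \<notin> I k"
        then obtain x where x: "x \<notin> B" "dist x y < 1 / real (Suc k)" by (auto simp: I_def)
        hence "x \<in> ball y e" using k by (simp add: dist_commute)
        thus False using x e by blast
      qed
      thus "y \<in> (\<Union>k. I k)" by blast
    qed
    moreover have "(\<lambda>k. measure lborel (I k)) \<longlonglongrightarrow> measure lborel (\<Union>k. I k)"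
    proof (rule Lim_measure_incseq)
      show "range I \<subseteq> sets lborel" using I_borel by auto
      show "incseq I" unfolding incseq_def
      proof (intro allI impI)
        fix k l :: nat assume "k \<le> l"
        hence "1 / real (Suc l) \<le> 1 / real (Suc k)" by (simp add: frac_le)
        hence "(\<Union>x\<in>-B. ball x (1 / real (Suc l))) \<subseteq> (\<Union>x\<in>-B. ball x (1 / real (Suc k)))"
          by (intro UN_mono subset_ball) auto
        thus "I k \<subseteq> I l" unfolding I_def by blast
      qed
      have "bounded (\<Union>k. I k)" using IB by (intro bounded_subset[OF bdd]) blast
      thus "emeasure lborel (\<Union>k. I k) \<noteq> \<infinity>" by (rule fin)
    qed
    ultimately show ?thesis by (simp only: eqm)
  qed
  have small: "((\<lambda>\<delta>. leak \<eta> \<delta>) \<longlongrightarrow> 0) (at_right 0)" if "\<eta> > 0" for \<eta> :: real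
    using that unfolding leak_def by real_asymp
  have N_nonneg: "\<forall>\<^sub>F n in sequentially. N n \<ge> 0" using eventually_N_pos by eventually_elim simp
  have "hit B \<longlonglongrightarrow> c * measure lborel B"
  proof (rule order_tendstoI)
    fix a assume a: "a < c * measure lborel B"
    have "(\<lambda>k. c * measure lborel (I k)) \<longlonglongrightarrow> c * measure lborel B" by (intro tendsto_mult tendsto_const I_lim)
    from order_tendstoD(1)[OF this a] obtain k where k: "a < c * measure lborel (I k)"
      by (auto simp: eventually_sequentially)
    define \<eta> where "\<eta> = 1 / real (Suc k)"
    have e: "\<eta> > 0" by (simp add: \<eta>_def)
    have "((\<lambda>\<delta>. c * measure lborel (I k) * (1 - 2 * leak \<eta> \<delta>)) \<longlongrightarrow> c * measure lborel (I k) * (1 - 2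
        * 0)) (at_right 0)"
      by (intro tendsto_mult tendsto_diff tendsto_const small e)
    hence "\<forall>\<^sub>F \<delta> in at_right 0. a < c * measure lborel (I k) * (1 - 2 * leak \<eta> \<delta>)"
      using k by (intro order_tendstoD(1)) auto
    then obtain \<delta> where d: "\<delta> > 0" and ad: "a < c * measure lborel (I k) * (1 - 2 * leak \<eta> \<delta>)"
      by (auto simp: eventually_at_right_field dest: dense)
    have d2: "sqrt 2 * \<delta> > 0" using d by simp
    define q where "q = leak \<eta> \<delta>"
    define X where "X n = N n * (\<integral>x. gauss_mass \<delta> (I k) (x - center n) \<partial>P n)" for n
    define Y where "Y n = N n * (\<integral>x. gauss_mass (sqrt 2 * \<delta>) (I k) (x - center n) \<partial>P n)" for n
    have "(\<lambda>n. (X n - q * Y n) / (2 * pi * \<delta>\<^sup>2)) \<longlonglongrightarrow>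
       (\<delta>\<^sup>2 * g * measure lborel (I k) - q * ((sqrt 2 * \<delta>)\<^sup>2 * g * measure lborel (I k))) / (2 * pi * \<delta>\<^sup>2)"
      unfolding X_def Y_def g_def using d
      by (intro tendsto_divide tendsto_diff tendsto_mult[OF tendsto_const] gauss_mass_limit I_borel
          I_bdd d2 tendsto_const) auto
    also have "(\<delta>\<^sup>2 * g * measure lborel (I k) - q * ((sqrt 2 * \<delta>)\<^sup>2 * g * measure lborel (I k))) / (2
        * pi * \<delta>\<^sup>2)
        = c * measure lborel (I k) * (1 - 2 * q)"
      using d by (simp add: c_def power_mult_distrib field_simps)
    finally have "\<forall>\<^sub>F n in sequentially. a < (X n - q * Y n) / (2 * pi * \<delta>\<^sup>2)"
      using ad by (intro order_tendstoD(1)) (auto simp: q_def)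
    thus "\<forall>\<^sub>F n in sequentially. a < hit B n"
      using N_nonneg
    proof eventually_elim
      case (elim n)
      have far: "\<eta> \<le> cmod (x - y)" if "x \<notin> B" "y \<in> I k" for x y
        using that by (force simp: I_def \<eta>_def dist_norm not_less)
      have "X n \<le> 2 * pi * \<delta>\<^sup>2 * hit B n + q * Y n"
        unfolding X_def Y_def q_def by (rule hit_lower[OF B d _ I_borel far elim(2)]) (use e in auto)
      hence "(X n - q * Y n) / (2 * pi * \<delta>\<^sup>2) \<le> hit B n"
        using d by (subst pos_divide_le_eq) (auto simp: algebra_simps)
      thus ?case using elim(1) by linarith
    qed
  next
    fix a assume a: "c * measure lborel B < a"
    have "(\<lambda>k. c * measure lborel (U k)) \<longlonglongrightarrow> c * measure lborel B" by (intro tendsto_mult tendsto_const U_lim)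
    from order_tendstoD(2)[OF this a] obtain k where k: "c * measure lborel (U k) < a"
      by (auto simp: eventually_sequentially)
    define \<eta> where "\<eta> = 1 / real (Suc k)"
    have e: "\<eta> > 0" by (simp add: \<eta>_def)
    have L: "((\<lambda>\<delta>. 1 - 2 * leak \<eta> \<delta>) \<longlongrightarrow> 1 - 2 * 0) (at_right 0)"
      by (intro tendsto_mult tendsto_diff tendsto_const small e)
    hence "((\<lambda>\<delta>. c * measure lborel (U k) / (1 - 2 * leak \<eta> \<delta>)) \<longlongrightarrow> c * measure lborel (U k) / (1 - 2
        * 0)) (at_right 0)"
      by (intro tendsto_divide tendsto_const) auto
    hence "\<forall>\<^sub>F \<delta> in at_right 0. c * measure lborel (U k) / (1 - 2 * leak \<eta> \<delta>) < a"
      using k by (intro order_tendstoD(2)) auto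
    moreover have "\<forall>\<^sub>F \<delta> in at_right 0. 0 < 1 - 2 * leak \<eta> \<delta>"
      using L by (intro order_tendstoD(1)) auto
    ultimately have "\<forall>\<^sub>F \<delta> in at_right 0. c * measure lborel (U k) / (1 - 2 * leak \<eta> \<delta>) < a \<and> 0 < 1 - 2
        * leak \<eta> \<delta>"
      by (rule eventually_conj)
    then obtain \<delta> where d: "\<delta> > 0" and ad: "c * measure lborel (U k) / (1 - 2 * leak \<eta> \<delta>) < a"
      and q0: "0 < 1 - 2 * leak \<eta> \<delta>"
      by (auto simp: eventually_at_right_field dest: dense)
    define \<kappa> where "\<kappa> = 1 - 2 * leak \<eta> \<delta>"
    have k0: "\<kappa> > 0" using q0 by (simp add: \<kappa>_def)
    define X where "X n = N n * (\<integral>x. gauss_mass \<delta> (U k) (x - center n) \<partial>P n)" for n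
    have "(\<lambda>n. X n / (2 * pi * \<delta>\<^sup>2 * \<kappa>)) \<longlonglongrightarrow> \<delta>\<^sup>2 * g * measure lborel (U k) / (2 * pi * \<delta>\<^sup>2 * \<kappa>)"
      unfolding X_def g_def using d k0
      by (intro tendsto_divide gauss_mass_limit U_borel U_bdd tendsto_const) auto
    also have "\<delta>\<^sup>2 * g * measure lborel (U k) / (2 * pi * \<delta>\<^sup>2 * \<kappa>) = c * measure lborel (U k) / \<kappa>"
      using d k0 by (simp add: c_def field_simps)
    finally have "\<forall>\<^sub>F n in sequentially. X n / (2 * pi * \<delta>\<^sup>2 * \<kappa>) < a"
      using ad by (intro order_tendstoD(2)) (auto simp: \<kappa>_def)
    thus "\<forall>\<^sub>F n in sequentially. hit B n < a"
      using N_nonneg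
    proof eventually_elim
      case (elim n)
      have nb: "ball x \<eta> \<subseteq> U k" if "x \<in> B" for x using that by (auto simp: U_def \<eta>_def)
      have "2 * pi * \<delta>\<^sup>2 * \<kappa> * hit B n \<le> X n"
        unfolding X_def \<kappa>_def by (rule hit_upper[OF B d _ U_borel nb elim(2)]) (use e in auto)
      hence "hit B n \<le> X n / (2 * pi * \<delta>\<^sup>2 * \<kappa>)"
        using d k0 by (subst pos_le_divide_eq) (auto simp: algebra_simps)
      thus ?case using elim(1) by linarith
    qed
  qed
  thus ?thesis by (simp only: c_def g_def)
qed

end

section \<open>The theorem\<close>

theorem theorem2:
  fixes M :: "nat \<Rightarrow> 'w measure"
    and g :: "nat \<Rightarrow> 'w \<Rightarrow> complex mat"
    and B :: "complex set"
    and b :: complex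
  assumes "\<And>n. n \<ge> 1 \<Longrightarrow> prob_space (M n)"
    and "\<And>n. n \<ge> 1 \<Longrightarrow> g n \<in> measurable (M n) (unitary_borel n)"
    and "\<And>n. n \<ge> 1 \<Longrightarrow> haar_unitary n (distr (M n) (unitary_borel n) (g n))"
    and "bounded B"
    and "B \<in> sets borel"
    and "emeasure lborel (frontier B) = 0"
  shows "(\<lambda>n. (ln (real n) / 2) *
            measure (M n) {\<omega> \<in> space (M n).
              logdet_one_minus (g n \<omega>) - of_real (sqrt (ln (real n) / 2)) * b \<in> B})
         \<longlonglongrightarrow> 1 / (2 * pi) * exp (- (cmod b)\<^sup>2 / 2) * measure lborel B"
proof -
  define \<mu> where "\<mu> n = distr (M n) (unitary_borel n) (g n)" for n
  \<comment> \<open>the sequences are shifted by one, because nothing is known for \<open>n = 0\<close>\<close>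
  define N where "N n = ln (real (Suc n)) / 2" for n
  define P where "P n = distr (\<mu> (Suc n)) borel logdet_one_minus" for n
  define W where "W u = exp (- (cmod u)\<^sup>2 / 16) + 1 / (1 + (cmod u)\<^sup>2)\<^sup>2" for u :: complex
  have H: "haar_unitary n (\<mu> n)" if "n \<ge> 1" for n
    unfolding \<mu>_def by (rule assms(3)[OF that])
  have L_meas: "logdet_one_minus \<in> borel_measurable (\<mu> n)" for n
    unfolding \<mu>_def using measurable_logdet by simp
  have law: "complex_law (P n)" for n
    unfolding complex_law_def complex_law_axioms_def P_def
    using prob_space.prob_space_distr[OF haar_prob[OF H] L_meas, of "Suc n"] by simp
  have char_fun_P: "char_fun (P n) t = (\<Prod>k=1..Suc n. corner_charfun (\<mu> k) t)" for n t
  proof -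
    have "char_fun (P n) t = logdet_charfun (\<mu> (Suc n)) t"
      unfolding char_fun_def P_def logdet_charfun_def by (rule integral_distr[OF L_meas]) measurable
    also have "\<dots> = (\<Prod>k=1..Suc n. corner_charfun (\<mu> k) t)"
      by (intro logdet_charfun_prod H) simp_all
    finally show ?thesis .
  qed
  interpret near_gaussian_product "\<lambda>k. corner_charfun (\<mu> k)"
  proof
    fix k :: nat and t :: complex assume k: "k \<ge> 1"
    interpret prob_space "\<mu> k" by (rule haar_prob[OF H[OF k]])
    have "cmod (corner_charfun (\<mu> k) t) \<le> (\<integral>h. cmod (cis (t \<bullet> Ln (1 - h $$ (0, 0)))) \<partial>\<mu> k)"
      unfolding corner_charfun_def by (rule integral_norm_bound)
    thus "cmod (corner_charfun (\<mu> k) t) \<le> 1" by (simp add: prob_space)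
    show "cmod (corner_charfun (\<mu> k) t - of_real (1 - (cmod t)\<^sup>2 / (4 * real k)))
        \<le> 3 * (cmod t)\<^sup>2 * (1 + cmod t) / (real k * sqrt (real k))"
      by (rule corner_charfun_estimate[OF H[OF k] k])
  qed
  interpret local_limit P N W b
  proof (rule local_limit.intro)
    show "complex_law (P n)" for n by (rule law)
    show "filterlim N at_top sequentially" unfolding N_def[abs_def] by real_asymp
    show "(\<lambda>n. char_fun (P n) (u / of_real (sqrt (N n)))) \<longlonglongrightarrow> of_real (exp (- (cmod u)\<^sup>2 / 2))" for u
      unfolding char_fun_P N_def by (rule LIMSEQ_Suc[OF product_limit])
    show "integrable lborel W" unfolding W_def[abs_def] by (rule integrable_gaussian_dominator)
    fix \<delta> :: real assume "\<delta> > 0"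
    from product_domination[OF this]
    have "\<forall>\<^sub>F n in sequentially. \<forall>u. cmod (\<Prod>k=1..Suc n. corner_charfun (\<mu> k) (u / of_real (sqrt (ln
        (real (Suc n)) / 2))))
      * exp (- (\<delta>\<^sup>2 * (cmod u)\<^sup>2 / (2 * (ln (real (Suc n)) / 2)))) \<le> exp (- (cmod u)\<^sup>2 / 16) + 1 / (1
          + (cmod u)\<^sup>2)\<^sup>2"
      by (rule eventually_sequentially_Suc[THEN iffD2])
    thus "\<forall>\<^sub>F n in sequentially. \<forall>u. cmod (char_fun (P n) (u / of_real (sqrt (N n)))) * exp (- (\<delta>\<^sup>2
        * (cmod u)\<^sup>2 / (2 * N n))) \<le> W u"
      by (simp only: char_fun_P N_def W_def)
  qed
  have hit_eq: "hit B n = ln (real (Suc n)) / 2 * measure (M (Suc n)) {\<omega> \<in> space (M (Suc n)).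
      logdet_one_minus (g (Suc n) \<omega>) - of_real (sqrt (ln (real (Suc n)) / 2)) * b \<in> B}" for n
  proof -
    have gm: "g (Suc n) \<in> measurable (M (Suc n)) (unitary_borel (Suc n))" by (rule assms(2)) simp
    have "P n = distr (M (Suc n)) borel (\<lambda>\<omega>. logdet_one_minus (g (Suc n) \<omega>))"
      unfolding P_def \<mu>_def by (subst distr_distr[OF measurable_logdet gm]) (simp add: o_def)
    moreover have "{x. x - center n \<in> B} \<in> sets borel" by (rule shifted_borel[OF assms(5)])
    ultimately have "measure (P n) {x. x - center n \<in> B}
        = measure (M (Suc n)) ((\<lambda>\<omega>. logdet_one_minus (g (Suc n) \<omega>)) -` {x. x - center n
            \<in> B} \<inter> space (M (Suc n)))"
      by (simp add: measure_distr[OF measurable_compose[OF gm measurable_logdet]])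
    also have "(\<lambda>\<omega>. logdet_one_minus (g (Suc n) \<omega>)) -` {x. x - center n \<in> B} \<inter> space (M (Suc n))
        = {\<omega> \<in> space (M (Suc n)). logdet_one_minus (g (Suc n) \<omega>) - of_real (sqrt (ln (real (Suc n)) /
            2)) * b \<in> B}"
      by (auto simp: center_def N_def)
    finally have "measure (P n) {x. x - center n \<in> B} = measure (M (Suc n)) {\<omega> \<in> space (M (Suc n)).
        logdet_one_minus (g (Suc n) \<omega>) - of_real (sqrt (ln (real (Suc n)) / 2)) * b \<in> B}" .
    thus ?thesis unfolding hit_def by (simp only:) (simp add: N_def)
  qed
  have "hit B \<longlonglongrightarrow> 1 / (2 * pi) * exp (- (cmod b)\<^sup>2 / 2) * measure lborel B"
    by (rule hit_limit[OF assms(5,4,6)])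
  thus ?thesis
    unfolding hit_eq[abs_def] by (rule LIMSEQ_imp_Suc)
qed

end
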